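(* Let $(\Omega,\mu,T,\alpha)$ be a topologically mixing, measure-preserving Gibbs-Markov system. Let $$f=\sum_{n=1}^\infty\gamma_ng_n$$ (the series converging in $L^2(\mu)$), where $g_n\in L$ are real-valued, $\gamma_n\in\mathbb R$, $\int_\Omega g_n\,d\mu=0$ for all $n$, $\sup_{n}\|g_n\|_2<\infty$, $\sup_{n}|\gamma_n|\,\|g_n\|<\infty$, and, for some constants $K,\eta>0$, $\sum_{k=n+1}^\infty|\gamma_k|\leq Kn^{-3-\eta}$ for all $n\geq1$. Suppose that the asymptotic variances of the functions $\sum_{k=1}^n\gamma_kg_k$, $n\geq1$, are bounded away from $0$ uniformly in $n$. Then there is a sequence $\sigma_n>0$ such that $$\frac1{\sqrt n\,\sigma_n}\sum_{j=0}^{n-1}f\circ T^j\Rightarrow\mathcal N(0,1)$$ as $n\to\infty$ (convergence in distribution under $\mu$).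
   Context: Gibbs-Markov systems. Let $(\Omega,\mathcal B,\mu,T)$ be a nonsingular transformation of a standard probability space and $\alpha=\{a_i:i\in I\}$ a countable partition of $\Omega$ mod $\mu$. Write $\sigma(\cdot)$ for the generated $\sigma$-algebra and $T\alpha=\{Ta:a\in\alpha\}$. For $x,y\in\Omega$ let $s(x,y)=\min\{n+1: n\geq 0,\ T^n(x)\text{ and }T^n(y)\text{ belong to different elements of }\alpha\}$ ($=\infty$ if there is no such $n$), and for $r\in(0,1)$ let $r(x,y)=r^{s(x,y)}$. $(\Omega,\mu,T,\alpha)$ is a Gibbs-Markov system if, modulo $\mu$: (1) $\sigma(\{T^{-n}\alpha:n\geq0\})=\mathcal B$; (2) for every $a\in\alpha$, $Ta\in\sigma(\alpha)$ and $T|_a$ is invertible and two-sided nonsingular; (3) $\inf_{a\in\alpha}\mu(Ta)>0$; (4) for $n\geq1$ and $a\in\bigvee_{i=0}^{n-1}T^{-i}\alpha$, let $v_a:T^na\to a$ be the nonsingular inverse branch of $T^n$ and $v_a'$ its Radon-Nikodym derivative; there exist $r\in(0,1)$ and $M>0$ such that for all such $n,a$ and all $x,y\in T^na$, $\left|\frac{v_a'(x)}{v_a'(y)}-1\right|\leq M\,r(x,y)$. The number $r$ (hence the metric $r(\cdot,\cdot)$) is fixed as part of the system. Measure-preserving means $\mu\circ T^{-1}=\mu$. Topologically mixing means: for any $a,b\in\alpha$ there is $n_{a,b}\in\mathbb N$ such that $b\subset T^na$ for every $n>n_{a,b}$. Function space. For a partition $\rho$ of $\Omega$ and $f:\Omega\to\mathbb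 C$ let $D_\rho f=\sup_{b\in\rho}\sup_{x,y\in b,\,x\neq y}\frac{|f(x)-f(y)|}{r(x,y)}$ (suprema understood $\mu$-almost everywhere). Fix a partition $\beta$ with $\sigma(\beta)=\sigma(T\alpha)$. Put $\|f\|=\|f\|_\infty+D_\beta f$ and let $L$ be the Banach space of functions $f$ with $\|f\|<\infty$. $\|\cdot\|_2$ is the $L^2(\mu)$ norm. For a real-valued $g\in L$ with $\int g\,d\mu=0$ the asymptotic variance of $g$ is $\lim_{N\to\infty}\frac1N\int_\Omega\big(\sum_{m=0}^{N-1}g\circ T^m\big)^2d\mu$ (the limit exists). *)

theory Defs
  imports "HOL-Probability.Probability"
begin

definition standard_prob_space :: "'a measure \<Rightarrow> bool" where
  "standard_prob_space M \<longleftrightarrow> prob_space M \<and>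
     (\<exists>S. completely_metrizable_space S \<and> second_countable S \<and> topspace S = space M \<and>
          sets M = sigma_sets (space M) {U. openin S U})"

definition nonsingular :: "'a measure \<Rightarrow> ('a \<Rightarrow> 'a) \<Rightarrow> bool" where
  "nonsingular M T \<longleftrightarrow> T \<in> measurable M M \<and>
     (\<forall>A\<in>sets M. emeasure M (T -` A \<inter> space M) = 0 \<longleftrightarrow> emeasure M A = 0)"

definition measure_preserving :: "'a measure \<Rightarrow> ('a \<Rightarrow> 'a) \<Rightarrow> bool" where
  "measure_preserving M T \<longleftrightarrow> T \<in> measurable M M \<and> distr M M T = M"

text \<open>
  ``Modulo \<open>\<mu>\<close>'' is made explicit by a forward invariant set \<open>X\<close> of full measure: a property holds
  modulo \<open>\<mu>\<close> if it holds after discarding the null set \<open>space M - X\<close>. In particular the forward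
  image \<open>T\<^sup>n a\<close> stands for \<open>(T ^^ n) ` (a \<inter> X)\<close>, since the image of the
  discarded part of \<open>a\<close> is arbitrary.
  The same \<open>X\<close> has to be used for all properties that involve forward images.
\<close>

definition full_invariant :: "'a measure \<Rightarrow> ('a \<Rightarrow> 'a) \<Rightarrow> 'a set \<Rightarrow> bool" where
  "full_invariant M T X \<longleftrightarrow> X \<in> sets M \<and> space M - X \<in> null_sets M \<and> T ` X \<subseteq> X"

definition partition_mod :: "'a measure \<Rightarrow> 'a set \<Rightarrow> 'a set set \<Rightarrow> bool" where
  "partition_mod M X \<rho> \<longleftrightarrow> countable \<rho> \<and> \<rho> \<subseteq> sets M \<and> X \<subseteq> \<Union>\<rho> \<and>
     (\<forall>a\<in>\<rho>. \<forall>b\<in>\<rho>. a \<noteq> b \<longrightarrow> a \<inter> b \<inter> X = {})"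

definition sigma_mod :: "'a set \<Rightarrow> 'a set set \<Rightarrow> 'a set set" where
  "sigma_mod X \<A> = sigma_sets X ((\<lambda>A. A \<inter> X) ` \<A>)"

definition separation_time :: "('a \<Rightarrow> 'a) \<Rightarrow> 'a set set \<Rightarrow> 'a \<Rightarrow> 'a \<Rightarrow> enat" where
  "separation_time T \<alpha> x y =
     (INF n\<in>{n. \<exists>a\<in>\<alpha>. \<exists>b\<in>\<alpha>. a \<noteq> b \<and> (T ^^ n) x \<in> a \<and> (T ^^ n) y \<in> b}. enat (n + 1))"

definition sep_dist :: "('a \<Rightarrow> 'a) \<Rightarrow> 'a set set \<Rightarrow> real \<Rightarrow> 'a \<Rightarrow> 'a \<Rightarrow> real" where
  "sep_dist T \<alpha> r x y = (case separation_time T \<alpha> x y of enat k \<Rightarrow> r ^ k | \<infinity> \<Rightarrow> 0)"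

definition cylinders :: "('a \<Rightarrow> 'a) \<Rightarrow> 'a set set \<Rightarrow> 'a set \<Rightarrow> nat \<Rightarrow> 'a set set" where
  "cylinders T \<alpha> X n = {{x\<in>X. \<forall>i<n. (T ^^ i) x \<in> c i} |c. \<forall>i<n. c i \<in> \<alpha>}"

definition inverse_branch :: "('a \<Rightarrow> 'a) \<Rightarrow> nat \<Rightarrow> 'a set \<Rightarrow> 'a \<Rightarrow> 'a" where
  "inverse_branch T n a = the_inv_into a (T ^^ n)"

text \<open>The derivative \<open>v\<^sub>a' = d(\<mu> \<circ> v\<^sub>a) / d\<mu>\<close> on \<open>T\<^sup>n a\<close>; it is determined only up to null sets.\<close>

definition inverse_branch_deriv ::
    "'a measure \<Rightarrow> ('a \<Rightarrow> 'a) \<Rightarrow> nat \<Rightarrow> 'a set \<Rightarrow> 'a \<Rightarrow> real" where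
  "inverse_branch_deriv M T n a x =
     (let Y = restrict_space M ((T ^^ n) ` a) in
      enn2real (RN_deriv Y
        (measure_of (space Y) (sets Y) (\<lambda>B. emeasure M (inverse_branch T n a ` B))) x))"

text \<open>
  ``Invertible'' includes measurability of the inverse of \<open>T\<close> on \<open>a\<close>, i.e. of the forward images.
  In the distortion bound the null set \<open>N\<close> accounts for the arbitrary choice of the
  Radon-Nikodym derivative.
\<close>

definition gibbs_markov ::
    "'a measure \<Rightarrow> ('a \<Rightarrow> 'a) \<Rightarrow> 'a set set \<Rightarrow> real \<Rightarrow> 'a set \<Rightarrow> bool" where
  "gibbs_markov M T \<alpha> r X \<longleftrightarrow>
     standard_prob_space M \<and> nonsingular M T \<and> full_invariant M T X \<and>
     partition_mod M X \<alpha> \<and> 0 < r \<and> r < 1 \<and>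
     sigma_mod X {(T ^^ n) -` a |n a. a \<in> \<alpha>} = sets (restrict_space M X) \<and>
     (\<forall>a\<in>\<alpha>. T ` (a \<inter> X) \<in> sigma_mod X \<alpha> \<and> inj_on T (a \<inter> X) \<and>
        (\<forall>B\<in>sets M. B \<subseteq> a \<inter> X \<longrightarrow>
           T ` B \<in> sets M \<and> (emeasure M (T ` B) = 0 \<longleftrightarrow> emeasure M B = 0))) \<and>
     (INF a\<in>\<alpha>. emeasure M (T ` (a \<inter> X))) > 0 \<and>
     (\<exists>C>0. \<forall>n\<ge>1. \<forall>a\<in>cylinders T \<alpha> X n. \<exists>N\<in>null_sets M.
        \<forall>x\<in>(T ^^ n) ` a - N. \<forall>y\<in>(T ^^ n) ` a - N.
          \<bar>inverse_branch_deriv M T n a x / inverse_branch_deriv M T n a y - 1\<bar>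
            \<le> C * sep_dist T \<alpha> r x y)"

definition topologically_mixing :: "('a \<Rightarrow> 'a) \<Rightarrow> 'a set set \<Rightarrow> 'a set \<Rightarrow> bool" where
  "topologically_mixing T \<alpha> X \<longleftrightarrow>
     (\<forall>a\<in>\<alpha>. \<forall>b\<in>\<alpha>. \<exists>m. \<forall>n>m. b \<inter> X \<subseteq> (T ^^ n) ` (a \<inter> X))"

text \<open>
  The essential supremum over pairs: the null set \<open>N\<close> is removed from the space, not from the
  product. For \<open>r(x,y) = 0\<close> the quotient is \<open>0\<close> if \<open>f x = f y\<close> and \<open>\<infinity>\<close> otherwise.
\<close>

definition D_seminorm :: "'a measure \<Rightarrow> ('a \<Rightarrow> 'a) \<Rightarrow> 'a set set \<Rightarrow> real \<Rightarrow> 'a set set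
    \<Rightarrow> ('a \<Rightarrow> complex) \<Rightarrow> ennreal" where
  "D_seminorm M T \<alpha> r \<rho> f =
     (INF N\<in>null_sets M. SUP b\<in>\<rho>. SUP x\<in>b - N. SUP y\<in>b - N - {x}.
        ennreal (cmod (f x - f y)) / ennreal (sep_dist T \<alpha> r x y))"

definition L_norm :: "'a measure \<Rightarrow> ('a \<Rightarrow> 'a) \<Rightarrow> 'a set set \<Rightarrow> real \<Rightarrow> 'a set set
    \<Rightarrow> ('a \<Rightarrow> complex) \<Rightarrow> ennreal" where
  "L_norm M T \<alpha> r \<beta> f =
     esssup M (\<lambda>x. ennreal (cmod (f x))) + D_seminorm M T \<alpha> r \<beta> f"

definition L_space :: "'a measure \<Rightarrow> ('a \<Rightarrow> 'a) \<Rightarrow> 'a set set \<Rightarrow> real \<Rightarrow> 'a set set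
    \<Rightarrow> ('a \<Rightarrow> complex) set" where
  "L_space M T \<alpha> r \<beta> = {f \<in> borel_measurable M. L_norm M T \<alpha> r \<beta> f < \<infinity>}"

definition norm2 :: "'a measure \<Rightarrow> ('a \<Rightarrow> real) \<Rightarrow> real" where
  "norm2 M h = sqrt (\<integral>x. (h x)\<^sup>2 \<partial>M)"

definition asymptotic_variance :: "'a measure \<Rightarrow> ('a \<Rightarrow> 'a) \<Rightarrow> ('a \<Rightarrow> real) \<Rightarrow> real" where
  "asymptotic_variance M T h =
     lim (\<lambda>N. 1 / real N * (\<integral>x. (\<Sum>m<N. h ((T ^^ m) x))\<^sup>2 \<partial>M))"

end

theory Submission
  imports Defs "HOL-Real_Asymp.Real_Asymp"
begin

text \<open>
  No transfer operator is used. Instead, \<open>T\<close> acts by push-forward on finite measures \<open>\<nu>\<close> that are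
  \<^emph>\<open>regular\<close>: on an \<open>n\<close>-cylinder the density of \<open>\<nu>\<close> varies at most by a factor \<open>exp (c * r ^ n)\<close>,
  a condition that can be expressed by values on sets and hence ignores null sets. Bounded distortion
  makes push-forward contract the constant \<open>c\<close>; big images, mixing and invariance give a Doeblin bound
  \<open>T\<^sup>N\<nu> \<ge> 2\<epsilon>\<mu>\<close> which is uniform in \<open>\<nu>\<close>. Subtracting \<open>\<epsilon>\<mu>\<close> keeps regularity, so iteration gives
  \<open>\<bar>T\<^sup>m\<nu> - \<mu>\<bar> \<le> C \<theta>\<^sup>m \<mu>\<close> and thus, for \<open>h\<close> with mean zero, exponential decay
  \<open>\<bar>\<integral>h \<cdot> G \<circ> T\<^sup>m\<bar> \<le> C \<theta>\<^sup>m \<parallel>h\<parallel> \<integral>\<bar>G\<bar>\<close>.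

  Since \<open>exp (i s S\<^sub>p h)\<close> becomes regular after \<open>p\<close> steps, Bernstein's method of blocks and gaps yields
  the central limit theorem for every \<open>h \<in> L\<close>. Finally \<open>\<parallel>S\<^sub>N h\<parallel>\<^sub>2 \<le> (C N \<parallel>h\<parallel> \<parallel>h\<parallel>\<^sub>1)\<^sup>1\<^sup>/\<^sup>2\<close> applied
  to \<open>h = \<gamma>\<^sub>k g\<^sub>k\<close> gives \<open>O((N \<bar>\<gamma>\<^sub>k\<bar>)\<^sup>1\<^sup>/\<^sup>2)\<close>, and \<open>\<bar>\<gamma>\<^sub>k\<bar>\<^sup>1\<^sup>/\<^sup>2\<close> is summable, so that the Birkhoff
  sums of \<open>f\<close> are approximated by those of the partial sums uniformly in \<open>N\<close> at scale \<open>\<surd>N\<close>.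
\<close>

section \<open>Regular set functions\<close>

text \<open>The distortion bound and the norm of \<open>L\<close> ignore null sets, so pointwise
  transfer operators would need versions of all densities that fit together along all branches;
  inequalities between values on sets avoid the choice. They control positive measures only, so
  signed and complex functions are first shifted or split: \<open>iexp\<close> is treated as cosine
  and sine, each raised by 2. The obstacle in the series is that the bound on
  \<open>\<bar>\<gamma> n\<bar>\<close> times the norm of \<open>g n\<close> controls each summand
  but not the partial sums, whose Lipschitz constants may grow. The limit theorem is therefore
  applied to each partial sum separately, and uniformity comes from the variance bound alone. In it
  the Lipschitz norm of a summand stays bounded, while its \<open>L^1\<close> norm is
  \<open>O(\<bar>\<gamma> k\<bar>)\<close> by the bound on \<open>norm2\<close>; the square root
  turns the exponent \<open>-3 - \<eta>\<close> into one below -1, hence summability. The lower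
  bound on the variances makes the limiting variance \<open>w\<close> positive, and
  \<open>\<sigma>\<close> is the constant sequence \<open>sqrt w\<close>.\<close>

definition cyl :: "('a \<Rightarrow> 'a) \<Rightarrow> 'a set \<Rightarrow> (nat \<Rightarrow> 'a set) \<Rightarrow> (nat \<Rightarrow> nat) \<Rightarrow> nat \<Rightarrow> 'a set" where
  "cyl T X P q n = {x\<in>X. \<forall>k<n. (T ^^ k) x \<in> P (q k)}"

text \<open>
  Of the distortion condition (4) only the case \<open>n = 1\<close> enters, in the form \<open>dist\<close> free of derivatives;
  \<open>n\<close> there is the length of the cylinder in the image, and \<open>n = 0\<close> gives the whole image.
\<close>

locale markov_system = prob_space M for M :: "'a measure" +
  fixes T :: "'a \<Rightarrow> 'a" and X :: "'a set" and P :: "nat \<Rightarrow> 'a set" and r \<delta> D :: real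
  assumes T_meas [measurable]: "T \<in> measurable M M"
    and T_pres: "distr M M T = M"
    and X_sets [measurable]: "X \<in> sets M"
    and X_full: "prob X = 1"
    and X_inv: "\<And>x. x \<in> X \<Longrightarrow> T x \<in> X"
    and P_sets [measurable]: "\<And>i. P i \<in> sets M"
    and P_disj: "disjoint_family P"
    and P_Un: "(\<Union>i. P i) = X"
    and img_sets: "\<And>i B. B \<in> sets M \<Longrightarrow> B \<subseteq> P i \<Longrightarrow> T ` B \<in> sets M"
    and img_null: "\<And>i B. B \<in> sets M \<Longrightarrow> B \<subseteq> P i \<Longrightarrow> prob (T ` B) = 0 \<longleftrightarrow> prob B = 0"
    and Markov: "\<And>i j. P j \<subseteq> T ` P i \<or> P j \<inter> T ` P i = {}"
    and big: "\<And>i. P i \<noteq> {} \<Longrightarrow> \<delta> \<le> prob (T ` P i)"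
    and \<delta>_pos: "0 < \<delta>" and r_pos: "0 < r" and r_less: "r < 1" and D_nonneg: "0 \<le> D"
    and dist: "\<And>i q n B B'. B \<in> sets M \<Longrightarrow> B' \<in> sets M \<Longrightarrow> B \<subseteq> cyl T X P q n \<inter> T ` P i \<Longrightarrow>
      B' \<subseteq> cyl T X P q n \<inter> T ` P i \<Longrightarrow>
      prob (P i \<inter> T -` B) * prob B' \<le> exp (D * r ^ (n + 1)) * prob (P i \<inter> T -` B') * prob B"
    and mixing: "\<And>i j. P i \<noteq> {} \<Longrightarrow> P j \<noteq> {} \<Longrightarrow> \<exists>m. \<forall>n>m. P j \<subseteq> (T ^^ n) ` P i"
begin

abbreviation "Cyl \<equiv> cyl T X P"

text \<open>Acting on set functions instead of the type of measures lets differences and multiples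
  such as \<open>\<nu> - \<epsilon> * prob\<close> be formed pointwise.\<close>

definition push :: "('a set \<Rightarrow> real) \<Rightarrow> 'a set \<Rightarrow> real" where
  "push \<nu> B = \<nu> (T -` B \<inter> space M)"

text \<open>A finite measure, absolutely continuous with respect to \<open>prob\<close>, whose
  density has logarithmic oscillation at most \<open>c * r ^ n\<close> on cylinders of length
  \<open>n\<close>; cross-multiplication avoids division by null sets. The index \<open>p\<close>
  admits densities that depend on the first \<open>p\<close> symbols in an uncontrolled way. Even
  for \<open>p = 0\<close> different atoms are not compared, so the density may be
  unbounded.\<close>

definition reg :: "nat \<Rightarrow> real \<Rightarrow> ('a set \<Rightarrow> real) \<Rightarrow> bool" where
  "reg p c \<nu> \<longleftrightarrow>
     (\<forall>B\<in>sets M. 0 \<le> \<nu> B) \<and>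
     (\<forall>A. range A \<subseteq> sets M \<longrightarrow> disjoint_family A \<longrightarrow> (\<lambda>i. \<nu> (A i)) sums \<nu> (\<Union>i. A i)) \<and>
     (\<forall>B\<in>sets M. prob B = 0 \<longrightarrow> \<nu> B = 0) \<and>
     (\<forall>n>p. \<forall>q. \<forall>B\<in>sets M. \<forall>B'\<in>sets M. B \<subseteq> Cyl q n \<longrightarrow> B' \<subseteq> Cyl q n \<longrightarrow>
        \<nu> B * prob B' \<le> exp (c * r ^ n) * \<nu> B' * prob B)"

lemma reg_nonneg: "reg p c \<nu> \<Longrightarrow> B \<in> sets M \<Longrightarrow> 0 \<le> \<nu> B"
  and reg_sums: "reg p c \<nu> \<Longrightarrow> range A \<subseteq> sets M \<Longrightarrow> disjoint_family A \<Longrightarrow> (\<lambda>i. \<nu> (A i)) sums \<nu> (\<Union>i. A i)"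
  and reg_null: "reg p c \<nu> \<Longrightarrow> B \<in> sets M \<Longrightarrow> prob B = 0 \<Longrightarrow> \<nu> B = 0"
  and reg_ratio: "reg p c \<nu> \<Longrightarrow> p < n \<Longrightarrow> B \<in> sets M \<Longrightarrow> B' \<in> sets M \<Longrightarrow> B \<subseteq> Cyl q n \<Longrightarrow> B' \<subseteq> Cyl q n \<Longrightarrow>
        \<nu> B * prob B' \<le> exp (c * r ^ n) * \<nu> B' * prob B"
  unfolding reg_def by blast+

section \<open>Iterates, cylinders and elementary properties of regular set functions\<close>

lemma Int_vimage_sets [measurable]: "A \<in> sets M \<Longrightarrow> B \<in> sets M \<Longrightarrow> A \<inter> T -` B \<in> sets M"
proof -
  assume AB: "A \<in> sets M" "B \<in> sets M"
  have "A \<inter> T -` B = A \<inter> (T -` B \<inter> space M)"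
    using sets.sets_into_space[OF AB(1)] by auto
  with AB show ?thesis by (simp add: measurable_sets[OF T_meas] sets.Int)
qed

lemma Tn_meas [measurable]: "T ^^ n \<in> measurable M M"
  by (induction n) auto

lemma Tn_space: "x \<in> space M \<Longrightarrow> (T ^^ n) x \<in> space M"
  using measurable_space[OF Tn_meas] .

lemma Tn_X: "x \<in> X \<Longrightarrow> (T ^^ n) x \<in> X"
  by (induction n) (auto intro: X_inv)

lemma T_pres_prob: "B \<in> sets M \<Longrightarrow> prob (T -` B \<inter> space M) = prob B"
  using measure_distr[OF T_meas, of B] by (simp add: T_pres)

lemma Tn_pres: "distr M M (T ^^ n) = M"
proof (induction n)
  case (Suc n)
  have "distr M M (T ^^ Suc n) = distr (distr M M (T ^^ n)) M T"
    by (simp add: distr_distr)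
  then show ?case by (simp only: Suc T_pres)
qed (simp add: distr_id2)

lemma Tn_pres_prob: "B \<in> sets M \<Longrightarrow> prob ((T ^^ n) -` B \<inter> space M) = prob B"
  using measure_distr[OF Tn_meas, of B n] by (simp add: Tn_pres)

lemma push_iter: "B \<in> sets M \<Longrightarrow> (push ^^ n) \<nu> B = \<nu> ((T ^^ n) -` B \<inter> space M)"
proof (induction n arbitrary: B)
  case 0
  then show ?case using sets.sets_into_space[of B M] by (auto intro!: arg_cong[where f=\<nu>])
next
  case (Suc n)
  have "(push ^^ Suc n) \<nu> B = (push ^^ n) \<nu> (T -` B \<inter> space M)"
    by (simp add: push_def)
  also have "\<dots> = \<nu> ((T ^^ n) -` (T -` B \<inter> space M) \<inter> space M)"
    using Suc by (simp add: measurable_sets[OF T_meas])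
  also have "(T ^^ n) -` (T -` B \<inter> space M) \<inter> space M = (T ^^ Suc n) -` B \<inter> space M"
    using Tn_space by auto
  finally show ?case .
qed

lemma Cyl_sets [measurable]: "Cyl q n \<in> sets M"
proof -
  have "Cyl q n = X \<inter> {x\<in>space M. \<forall>k\<in>{..<n}. (T ^^ k) x \<in> P (q k)}"
    using sets.sets_into_space[OF X_sets] by (auto simp: cyl_def)
  also have "\<dots> \<in> sets M" by measurable
  finally show ?thesis .
qed

lemma Cyl_1: "Cyl (\<lambda>_. i) 1 = P i"
  using P_Un by (auto simp: cyl_def)

lemma Cyl_0: "Cyl q 0 = X"
  by (auto simp: cyl_def)

lemma P_sub_X: "P i \<subseteq> X"
  using P_Un by auto

lemma TP_sub_X: "T ` P i \<subseteq> X"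
  using P_sub_X X_inv by blast

lemma TP_sets [measurable]: "T ` P i \<in> sets M"
  by (rule img_sets[of _ i]) auto

text \<open>A null atom would have a null image, contrary to \<open>big\<close>.\<close>

lemma prob_P_pos: "P i \<noteq> {} \<Longrightarrow> 0 < prob (P i)"
  using img_null[of "P i" i] big[of i] \<delta>_pos
  by (metis P_sets less_le_not_le measure_nonneg order_antisym_conv order_refl)

lemma reg_empty: "reg p c \<nu> \<Longrightarrow> \<nu> {} = 0"
  by (rule reg_null) auto

lemma reg_add: assumes "reg p c \<nu>" "A \<in> sets M" "B \<in> sets M" "A \<inter> B = {}"
  shows "\<nu> (A \<union> B) = \<nu> A + \<nu> B"
proof -
  have "(\<lambda>i. \<nu> (binaryset A B i)) sums \<nu> (\<Union>i. binaryset A B i)"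
    using assms by (intro reg_sums) (auto simp: binaryset_def disjoint_family_on_def)
  moreover have "(\<lambda>i. \<nu> (binaryset A B i)) sums (\<nu> A + \<nu> B)"
    by (rule binaryset_sums) (rule reg_empty[OF assms(1)])
  ultimately show ?thesis by (simp add: UN_binaryset_eq sums_unique2)
qed

lemma reg_decomp: assumes "reg p c \<nu>" "B \<in> sets M"
  shows "(\<lambda>i. \<nu> (P i \<inter> B)) sums \<nu> B"
proof -
  have 1: "(\<lambda>i. \<nu> (P i \<inter> B)) sums \<nu> (\<Union>i. P i \<inter> B)"
    using assms P_disj by (intro reg_sums) (auto simp: disjoint_family_on_def)
  have 2: "(\<Union>i. P i \<inter> B) = X \<inter> B" using P_Un by auto
  have "prob (B - X) \<le> prob (space M - X)"
    using assms(2) sets.sets_into_space[OF assms(2)] by (intro finite_measure_mono) auto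
  also have "\<dots> = 0" using X_full prob_compl[OF X_sets] by simp
  finally have "\<nu> (B - X) = 0"
    using assms by (intro reg_null[OF assms(1)]) (auto simp: measure_le_0_iff)
  moreover have "\<nu> ((X \<inter> B) \<union> (B - X)) = \<nu> (X \<inter> B) + \<nu> (B - X)"
    using assms by (intro reg_add) auto
  moreover have "(X \<inter> B) \<union> (B - X) = B" by auto
  ultimately show ?thesis using 1 2 by simp
qed

lemma reg_weaken: assumes "reg p c \<nu>" "p \<le> p'" "c \<le> c'" shows "reg p' c' \<nu>"
  unfolding reg_def
proof (intro conjI allI impI ballI)
  fix n q B B' assume n: "p' < n" and B: "B \<in> sets M" "B' \<in> sets M" "B \<subseteq> Cyl q n" "B' \<subseteq> Cyl q n"
  have "\<nu> B * prob B' \<le> exp (c * r ^ n) * \<nu> B' * prob B"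
    using assms n B by (intro reg_ratio[OF assms(1)]) auto
  also have "\<dots> \<le> exp (c' * r ^ n) * \<nu> B' * prob B"
    using assms r_pos reg_nonneg[OF assms(1), of B'] B by (intro mult_right_mono) (auto simp: mult_right_mono)
  finally show "\<nu> B * prob B' \<le> exp (c' * r ^ n) * \<nu> B' * prob B" .
qed (auto intro: reg_nonneg[OF assms(1)] reg_null[OF assms(1)] reg_sums[OF assms(1)])

lemma reg_prob: "reg 0 0 prob"
  unfolding reg_def by (auto intro!: finite_measure_UNION)

text \<open>A cylinder of positive length lies in one atom, so on it the restricted measure is
  either \<open>prob\<close> or zero. These measures start the mixing argument in
  \<open>doeblin\<close>.\<close>

lemma reg_prob_P: "reg 0 0 (\<lambda>B. prob (P j \<inter> B))"
  unfolding reg_def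
proof (intro conjI allI impI ballI)
  fix A :: "nat \<Rightarrow> 'a set" assume A: "range A \<subseteq> sets M" "disjoint_family A"
  have "(\<lambda>i. prob (P j \<inter> A i)) sums prob (\<Union>i. P j \<inter> A i)"
    using A by (intro finite_measure_UNION) (auto simp: disjoint_family_on_def)
  moreover have "(\<Union>i. P j \<inter> A i) = P j \<inter> (\<Union>i. A i)" by auto
  ultimately show "(\<lambda>i. prob (P j \<inter> A i)) sums prob (P j \<inter> (\<Union>i. A i))" by simp
next
  fix n q B B' assume n: "(0::nat) < n" and B: "B \<in> sets M" "B' \<in> sets M" "B \<subseteq> Cyl q n" "B' \<subseteq> Cyl q n"
  have C: "Cyl q n \<subseteq> P (q 0)" using n by (force simp: cyl_def)
  show "prob (P j \<inter> B) * prob B' \<le> exp (0 * r ^ n) * prob (P j \<inter> B') * prob B"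
  proof (cases "q 0 = j")
    case True
    with C B have "P j \<inter> B = B" "P j \<inter> B' = B'" by auto
    then show ?thesis by simp
  next
    case False
    then have "P j \<inter> P (q 0) = {}" using P_disj by (auto simp: disjoint_family_on_def)
    with C B have "P j \<inter> B = {}" "P j \<inter> B' = {}" by auto
    then show ?thesis by simp
  qed
next
  fix B assume "B \<in> sets M" "prob B = 0"
  moreover have "prob (P j \<inter> B) \<le> prob B" using calculation by (intro finite_measure_mono) auto
  ultimately show "prob (P j \<inter> B) = 0" by (simp add: measure_le_0_iff)
qed auto

text \<open>The preimage of an \<open>n\<close>-cylinder under one branch lies in a cylinder of
  length \<open>n + 1\<close>. There \<open>\<nu>\<close> contributes \<open>c * r ^ (n + 1)\<close>
  and the branch distortion \<open>D * r ^ (n + 1)\<close>, together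
  \<open>r * (c + D) * r ^ n\<close>; summation over branches keeps the bound. One symbol is used
  up, so \<open>Suc p\<close> drops to \<open>p\<close>.\<close>

lemma reg_push: assumes "reg (Suc p) c \<nu>" shows "reg p (r * (c + D)) (push \<nu>)"
  unfolding reg_def
proof (intro conjI allI impI ballI)
  fix B assume "B \<in> sets M" then show "0 \<le> push \<nu> B"
    unfolding push_def by (intro reg_nonneg[OF assms]) simp
next
  fix A :: "nat \<Rightarrow> 'a set" assume A: "range A \<subseteq> sets M" "disjoint_family A"
  have "(\<lambda>i. \<nu> (T -` A i \<inter> space M)) sums \<nu> (\<Union>i. T -` A i \<inter> space M)"
    using A by (intro reg_sums[OF assms]) (auto simp: disjoint_family_on_def)
  moreover have "(\<Union>i. T -` A i \<inter> space M) = T -` (\<Union>i. A i) \<inter> space M" by auto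
  ultimately show "(\<lambda>i. push \<nu> (A i)) sums push \<nu> (\<Union>i. A i)" by (simp add: push_def)
next
  fix B assume "B \<in> sets M" "prob B = 0"
  then show "push \<nu> B = 0"
    unfolding push_def by (intro reg_null[OF assms]) (simp_all add: T_pres_prob)
next
  fix n q B B' assume n: "p < n" and B [measurable]: "B \<in> sets M" "B' \<in> sets M" and BC: "B \<subseteq> Cyl q n" "B' \<subseteq> Cyl q n"
  define E where "E = exp (r * (c + D) * r ^ n)"
  have sums: "(\<lambda>i. \<nu> (P i \<inter> T -` B)) sums push \<nu> B" if [measurable]: "B \<in> sets M" for B
  proof -
    have "P i \<inter> (T -` B \<inter> space M) = P i \<inter> T -` B" for i
      using sets.sets_into_space[OF P_sets] by auto
    then show ?thesis using reg_decomp[OF assms, of "T -` B \<inter> space M"] by (simp add: push_def)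
  qed
  have C: "Cyl q n \<subseteq> P (q 0)" using n by (force simp: cyl_def)
  \<comment> \<open>The cylinder lies in the single atom \<open>P (q 0)\<close>, so by the Markov
    property the image of \<open>P i\<close> contains it or misses it.\<close>
  have "\<nu> (P i \<inter> T -` B) * prob B' \<le> E * \<nu> (P i \<inter> T -` B') * prob B" for i
  proof (cases "P (q 0) \<subseteq> T ` P i")
    case False
    then have "P (q 0) \<inter> T ` P i = {}" using Markov by blast
    then have "P i \<inter> T -` B = {}" "P i \<inter> T -` B' = {}" using C BC by blast+
    then show ?thesis by (simp add: reg_empty[OF assms])
  next
    case True
    have sub: "B \<subseteq> Cyl q n \<inter> T ` P i" "B' \<subseteq> Cyl q n \<inter> T ` P i" using True C BC by auto
    define b b' where "b = P i \<inter> T -` B" and "b' = P i \<inter> T -` B'"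
    have [measurable]: "b \<in> sets M" "b' \<in> sets M" by (auto simp: b_def b'_def)
    have d: "prob b * prob B' \<le> exp (D * r ^ (n + 1)) * prob b' * prob B"
      unfolding b_def b'_def by (rule dist[OF B sub])
    have "P i \<inter> T -` Cyl q n \<subseteq> Cyl (case_nat i q) (Suc n)"
    proof
      fix x assume x: "x \<in> P i \<inter> T -` Cyl q n"
      have "(T ^^ k) x \<in> P (case_nat i q k)" if "k < Suc n" for k
      proof (cases k)
        case 0 with x show ?thesis by simp
      next
        case (Suc k')
        with x that show ?thesis by (simp add: funpow_swap1 cyl_def del: funpow.simps(2) add: funpow_Suc_right)
      qed
      then show "x \<in> Cyl (case_nat i q) (Suc n)" using x P_sub_X by (auto simp: cyl_def)
    qed
    then have "b \<subseteq> Cyl (case_nat i q) (Suc n)" "b' \<subseteq> Cyl (case_nat i q) (Suc n)"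
      using BC by (auto simp: b_def b'_def)
    then have v: "\<nu> b * prob b' \<le> exp (c * r ^ Suc n) * \<nu> b' * prob b"
      using n by (intro reg_ratio[OF assms]) auto
    have nn: "0 \<le> \<nu> b" "0 \<le> \<nu> b'" by (auto intro: reg_nonneg[OF assms])
    \<comment> \<open>The bounds \<open>v\<close> and \<open>d\<close> are chained by multiplying
      them and cancelling \<open>prob b * prob b'\<close>. If a factor vanishes, absolute continuity
      of \<open>\<nu>\<close> or nonsingularity of the branch makes the left side zero.\<close>
    consider "prob b = 0" | "prob b' = 0" | "prob b > 0" "prob b' > 0"
      using zero_less_measure_iff by blast
    then have "\<nu> b * prob B' \<le> E * \<nu> b' * prob B"
    proof cases
      case 1 then show ?thesis using reg_null[OF assms, of b] nn by (simp add: E_def)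
    next
      case 2
      have "T ` b' = B'" using sub by (auto simp: b'_def)
      moreover have "prob (T ` b') = 0" using img_null[of b' i] 2 by (auto simp: b'_def)
      ultimately show ?thesis using nn by (simp add: E_def)
    next
      case 3
      have "(\<nu> b * prob b') * (prob b * prob B') \<le>
          (exp (c * r ^ Suc n) * \<nu> b' * prob b) * (exp (D * r ^ (n + 1)) * prob b' * prob B)"
        by (intro mult_mono v d) (use nn in auto)
      also have "\<dots> = (prob b * prob b') * ((exp (c * r ^ Suc n) * exp (D * r ^ (n + 1))) * \<nu> b' * prob B)"
        by (simp only: ac_simps)
      also have "exp (c * r ^ Suc n) * exp (D * r ^ (n + 1)) = E"
        by (simp add: E_def exp_add[symmetric] algebra_simps)
      finally have "(prob b * prob b') * (\<nu> b * prob B') \<le> (prob b * prob b') * (E * \<nu> b' * prob B)"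
        by (simp only: ac_simps)
      then show ?thesis using 3 by (simp add: mult_le_cancel_left_pos)
    qed
    then show ?thesis by (simp add: b_def b'_def)
  qed
  moreover have "(\<lambda>i. \<nu> (P i \<inter> T -` B) * prob B') sums (push \<nu> B * prob B')"
    by (intro sums_mult2 sums B)
  moreover have "(\<lambda>i. E * \<nu> (P i \<inter> T -` B') * prob B) sums (E * push \<nu> B' * prob B)"
    by (intro sums_mult2 sums_mult sums B)
  ultimately show "push \<nu> B * prob B' \<le> E * push \<nu> B' * prob B"
    by (rule sums_le)
qed

text \<open>The map \<open>c \<mapsto> r * (c + D)\<close> has the fixed point
  \<open>r * D / (1 - r)\<close>; this larger number is simpler and is mapped below itself.\<close>

definition Dsum :: real where "Dsum = D / (1 - r)"

lemma Dsum_nonneg: "0 \<le> Dsum"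
  using D_nonneg r_less by (simp add: Dsum_def)

lemma Dsum_fix: "r * (Dsum + D) \<le> Dsum"
proof -
  have "r * (Dsum + D) = Dsum - D * (1 - r)" using r_less by (simp add: Dsum_def field_simps)
  then show ?thesis using D_nonneg r_less by simp
qed

text \<open>The initial constant is forgotten at rate \<open>r ^ n\<close>, while the distortion
  accumulated on the way stays below \<open>Dsum\<close>.\<close>

lemma reg_push_iter: "reg (p + n) c \<nu> \<Longrightarrow> reg p (r ^ n * c + Dsum) ((push ^^ n) \<nu>)"
proof (induction n arbitrary: p)
  case 0
  then show ?case using Dsum_nonneg by (auto intro: reg_weaken)
next
  case (Suc n)
  then have "reg (Suc p) (r ^ n * c + Dsum) ((push ^^ n) \<nu>)" by simp
  from reg_push[OF this] have "reg p (r * (r ^ n * c + Dsum + D)) ((push ^^ Suc n) \<nu>)" by simp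
  then show ?case
    by (rule reg_weaken) (use Dsum_fix in \<open>auto simp: algebra_simps\<close>)
qed

lemma reg_push_iter0: "reg 0 c \<nu> \<Longrightarrow> reg 0 (r ^ n * c + Dsum) ((push ^^ n) \<nu>)"
  by (rule reg_push_iter) (auto intro: reg_weaken)

end

section \<open>Exponential convergence to the invariant measure\<close>

context markov_system
begin

section \<open>Comparison of a regular measure with the invariant one along a single branch\<close>

lemma dist0: assumes "B \<in> sets M" "B' \<in> sets M" "B \<subseteq> T ` P i" "B' \<subseteq> T ` P i"
  shows "prob (P i \<inter> T -` B) * prob B' \<le> exp D * prob (P i \<inter> T -` B') * prob B"
proof -
  have "prob (P i \<inter> T -` B) * prob B' \<le> exp (D * r ^ (0 + 1)) * prob (P i \<inter> T -` B') * prob B"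
    by (rule dist[where q="\<lambda>_. 0"]) (use assms TP_sub_X[of i] Cyl_0 in auto)
  also have "\<dots> \<le> exp D * prob (P i \<inter> T -` B') * prob B"
    using D_nonneg r_less by (intro mult_right_mono) (auto intro: mult_left_le)
  finally show ?thesis .
qed

text \<open>On an atom \<open>\<nu>\<close> is proportional to \<open>prob\<close> up to
  \<open>exp (c * r)\<close>, and the branch has distortion at most \<open>exp D\<close>. Hence the
  mass \<open>\<nu> (P i)\<close> is spread almost evenly over the image, whose measure is at least
  \<open>\<delta>\<close>.\<close>

lemma reg_upper_term: assumes "reg 0 c \<nu>" and B [measurable]: "B \<in> sets M"
  shows "\<nu> (P i \<inter> T -` B) \<le> exp (c * r + D) / \<delta> * \<nu> (P i) * prob B"
proof (cases "P i = {}")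
  case True then show ?thesis using reg_empty[OF assms(1)] by simp
next
  case False
  let ?B = "B \<inter> T ` P i"
  have eq: "P i \<inter> T -` B = P i \<inter> T -` ?B" "P i \<inter> T -` (T ` P i) = P i" by auto
  have [measurable]: "?B \<in> sets M" by simp
  have 1: "\<nu> (P i \<inter> T -` B) * prob (P i) \<le> exp (c * r ^ 1) * \<nu> (P i) * prob (P i \<inter> T -` B)"
    by (rule reg_ratio[OF assms(1)]) (use Cyl_1[of i] in auto)
  have 2: "prob (P i \<inter> T -` B) * prob (T ` P i) \<le> exp D * prob (P i) * prob ?B"
    using dist0[of ?B "T ` P i" i] unfolding eq(1)[symmetric] eq(2) by auto
  have \<nu>: "0 \<le> \<nu> (P i)" by (rule reg_nonneg[OF assms(1)]) simp
  have "\<delta> * (\<nu> (P i \<inter> T -` B) * prob (P i)) \<le> \<delta> * (exp (c * r ^ 1) * \<nu> (P i) * prob (P i \<inter> T -` B))"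
    using 1 \<delta>_pos by (intro mult_left_mono) auto
  also have "\<dots> \<le> exp (c * r) * \<nu> (P i) * (prob (P i \<inter> T -` B) * prob (T ` P i))"
  proof -
    have "exp (c * r) * \<nu> (P i) * prob (P i \<inter> T -` B) * \<delta> \<le> exp (c * r) * \<nu> (P i) * prob (P i \<inter> T -` B) * prob (T ` P i)"
      using big[OF False] \<nu> by (intro mult_left_mono) auto
    then show ?thesis by (simp add: mult_ac)
  qed
  also have "\<dots> \<le> exp (c * r) * \<nu> (P i) * (exp D * prob (P i) * prob B)"
  proof (intro mult_left_mono)
    have "prob ?B \<le> prob B" by (intro finite_measure_mono) auto
    then have "exp D * prob (P i) * prob ?B \<le> exp D * prob (P i) * prob B"
      by (intro mult_left_mono) auto
    with 2 show "prob (P i \<inter> T -` B) * prob (T ` P i) \<le> exp D * prob (P i) * prob B" by linarith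
  qed (use \<nu> in auto)
  finally have "prob (P i) * (\<delta> * \<nu> (P i \<inter> T -` B)) \<le> prob (P i) * (exp (c * r + D) * \<nu> (P i) * prob B)"
    by (simp add: mult_ac exp_add)
  then have "\<delta> * \<nu> (P i \<inter> T -` B) \<le> exp (c * r + D) * \<nu> (P i) * prob B"
    using prob_P_pos[OF False] by simp
  then show ?thesis using \<delta>_pos by (simp add: field_simps)
qed

text \<open>The same two distortion factors bound the mass from below; here the image has measure at
  most 1, so \<open>\<delta>\<close> does not appear.\<close>

lemma reg_lower_term: assumes "reg 0 c \<nu>" and B [measurable]: "B \<in> sets M"
  shows "exp (- (c * r + D)) * \<nu> (P i) * prob (B \<inter> T ` P i) \<le> \<nu> (P i \<inter> T -` B)"
proof (cases "P i = {}")
  case True then show ?thesis using reg_empty[OF assms(1)] by simp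
next
  case False
  let ?B = "B \<inter> T ` P i"
  have eq: "P i \<inter> T -` B = P i \<inter> T -` ?B" "P i \<inter> T -` (T ` P i) = P i" by auto
  have [measurable]: "?B \<in> sets M" by simp
  have 1: "\<nu> (P i) * prob (P i \<inter> T -` B) \<le> exp (c * r ^ 1) * \<nu> (P i \<inter> T -` B) * prob (P i)"
    by (rule reg_ratio[OF assms(1)]) (use Cyl_1[of i] in auto)
  have 2: "prob (P i) * prob ?B \<le> exp D * prob (P i \<inter> T -` B) * prob (T ` P i)"
    using dist0[of "T ` P i" ?B i] unfolding eq(1)[symmetric] eq(2) by auto
  have \<nu>: "0 \<le> \<nu> (P i)" by (rule reg_nonneg[OF assms(1)]) simp
  have "prob (P i) * (\<nu> (P i) * prob ?B) = \<nu> (P i) * (prob (P i) * prob ?B)" by simp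
  also have "\<dots> \<le> \<nu> (P i) * (exp D * prob (P i \<inter> T -` B) * 1)"
    by (intro mult_left_mono order_trans[OF 2] \<nu>) auto
  also have "\<dots> = exp D * (\<nu> (P i) * prob (P i \<inter> T -` B))" by simp
  also have "\<dots> \<le> exp D * (exp (c * r ^ 1) * \<nu> (P i \<inter> T -` B) * prob (P i))"
    by (intro mult_left_mono 1) auto
  finally have "prob (P i) * (\<nu> (P i) * prob ?B) \<le> prob (P i) * (exp (c * r + D) * \<nu> (P i \<inter> T -` B))"
    by (simp add: mult_ac exp_add)
  then have "\<nu> (P i) * prob ?B \<le> exp (c * r + D) * \<nu> (P i \<inter> T -` B)"
    using prob_P_pos[OF False] by simp
  then have "exp (- (c * r + D)) * (\<nu> (P i) * prob ?B) \<le>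
      exp (- (c * r + D)) * (exp (c * r + D) * \<nu> (P i \<inter> T -` B))"
    by (intro mult_left_mono) auto
  also have "\<dots> = \<nu> (P i \<inter> T -` B)" by (simp add: mult.assoc[symmetric] exp_add[symmetric])
  finally show ?thesis by (simp add: mult.assoc)
qed

lemma push_decomp: assumes "reg p c \<nu>" and [measurable]: "B \<in> sets M"
  shows "(\<lambda>i. \<nu> (P i \<inter> T -` B)) sums push \<nu> B"
proof -
  have "P i \<inter> (T -` B \<inter> space M) = P i \<inter> T -` B" for i
    using sets.sets_into_space[OF P_sets] by auto
  then show ?thesis using reg_decomp[OF assms(1), of "T -` B \<inter> space M"] by (simp add: push_def)
qed

lemma reg_sums_P: "reg p c \<nu> \<Longrightarrow> (\<lambda>i. \<nu> (P i)) sums \<nu> (space M)"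
  using reg_decomp[of p c \<nu> "space M"] by (simp add: Int_absorb2 sets.sets_into_space)

text \<open>One application of \<open>push\<close> makes a possibly unbounded density bounded. This
  extra step is the reason for \<open>m \<ge> 1\<close> in \<open>decay\<close>.\<close>

lemma reg_upper: assumes "reg 0 c \<nu>" "B \<in> sets M"
  shows "push \<nu> B \<le> exp (c * r + D) / \<delta> * \<nu> (space M) * prob B"
proof (rule sums_le)
  show "\<nu> (P i \<inter> T -` B) \<le> exp (c * r + D) / \<delta> * \<nu> (P i) * prob B" for i
    by (rule reg_upper_term[OF assms])
  show "(\<lambda>i. \<nu> (P i \<inter> T -` B)) sums push \<nu> B" by (rule push_decomp[OF assms])
  show "(\<lambda>i. exp (c * r + D) / \<delta> * \<nu> (P i) * prob B) sums (exp (c * r + D) / \<delta> * \<nu> (space M) * prob B)"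
    by (intro sums_mult2 sums_mult reg_sums_P[OF assms(1)])
qed

text \<open>\<open>img_null\<close> speaks of subsets of one atom, so the null set is cut along the
  countably many atoms at each iteration.\<close>

lemma null_forward: assumes "E \<in> sets M" "E \<subseteq> X" "prob E = 0"
  shows "(T ^^ n) ` E \<in> sets M \<and> (T ^^ n) ` E \<subseteq> X \<and> prob ((T ^^ n) ` E) = 0"
proof (induction n)
  case 0 then show ?case using assms by simp
next
  case (Suc n)
  define F where "F = (T ^^ n) ` E"
  have F [measurable]: "F \<in> sets M" and FX: "F \<subseteq> X" "prob F = 0" using Suc by (auto simp: F_def)
  have eq: "(T ^^ Suc n) ` E = (\<Union>i. T ` (P i \<inter> F))"
  proof -
    have "F = (\<Union>i. P i \<inter> F)" using FX P_Un by auto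
    then have "T ` F = (\<Union>i. T ` (P i \<inter> F))" by (metis image_UN)
    then show ?thesis by (simp add: F_def image_comp)
  qed
  have TPF: "T ` (P i \<inter> F) \<in> sets M" for i by (rule img_sets[of _ i]) auto
  have "prob (P i \<inter> F) = 0" for i
    using finite_measure_mono[of "P i \<inter> F" F] FX by (simp add: measure_le_0_iff)
  then have z: "prob (T ` (P i \<inter> F)) = 0" for i
    using img_null[of "P i \<inter> F" i] by simp
  have "(\<Union>i. T ` (P i \<inter> F)) \<in> null_sets M"
    by (intro null_sets_UN) (use TPF z in \<open>auto simp: null_sets_def emeasure_eq_measure\<close>)
  moreover have "(T ^^ Suc n) ` E \<subseteq> X" using assms(2) Tn_X by blast
  ultimately show ?case unfolding eq by (auto simp: null_sets_def emeasure_eq_measure)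
qed

text \<open>Topological mixing concerns points. If the set were null, so would be its forward image
  by \<open>null_forward\<close>, which contains the atom \<open>P j\<close> of positive
  measure.\<close>

lemma mixing_prob: assumes "P i \<noteq> {}" "P j \<noteq> {}"
  shows "\<exists>m. \<forall>n>m. 0 < prob (P i \<inter> (T ^^ n) -` P j)"
proof -
  obtain m where m: "\<And>n. n > m \<Longrightarrow> P j \<subseteq> (T ^^ n) ` P i" using mixing[OF assms] by blast
  have "0 < prob (P i \<inter> (T ^^ n) -` P j)" if "n > m" for n
  proof (rule ccontr)
    let ?E = "P i \<inter> (T ^^ n) -` P j"
    assume "\<not> 0 < prob ?E"
    then have 0: "prob ?E = 0" using zero_less_measure_iff by blast
    have "?E = P i \<inter> ((T ^^ n) -` P j \<inter> space M)" using sets.sets_into_space[OF P_sets] by auto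
    then have [measurable]: "?E \<in> sets M" by simp
    have *: "(T ^^ n) ` ?E \<in> sets M" "prob ((T ^^ n) ` ?E) = 0"
      using null_forward[of ?E n] 0 P_sub_X by auto
    have "P j \<subseteq> (T ^^ n) ` ?E" using m[OF that] by fastforce
    then have "prob (P j) \<le> 0" using finite_measure_mono[OF _ *(1)] *(2) by metis
    then show False using prob_P_pos[OF assms(2)] by simp
  qed
  then show ?thesis by blast
qed

lemma tail_small: assumes "0 < e"
  shows "\<exists>m. prob (X - (\<Union>i<m. P i)) < e"
proof -
  have "(\<lambda>m. prob (\<Union>i<m. P i)) \<longlonglongrightarrow> prob (\<Union>m. \<Union>i<m. P i)"
    by (rule finite_Lim_measure_incseq) (auto simp: incseq_def intro: less_le_trans)
  also have "(\<Union>m. \<Union>i<m. P i) = X" using P_Un by auto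
  finally have "(\<lambda>m. prob (\<Union>i<m. P i)) \<longlonglongrightarrow> 1" by (simp add: X_full)
  then have "\<forall>\<^sub>F m in sequentially. 1 - e < prob (\<Union>i<m. P i)"
    by (rule order_tendstoD) (use assms in simp)
  then obtain m where m: "1 - e < prob (\<Union>i<m. P i)" by (auto simp: eventually_sequentially)
  have "prob (X - (\<Union>i<m. P i)) = prob X - prob (\<Union>i<m. P i)"
    by (rule finite_measure_Diff) (use P_sub_X in auto)
  with m X_full have "prob (X - (\<Union>i<m. P i)) < e" by simp
  then show ?thesis ..
qed

lemma push_iter_space: "(push ^^ n) \<nu> (space M) = \<nu> (space M)"
proof -
  have "(T ^^ n) -` space M \<inter> space M = space M" using Tn_space by auto
  then show ?thesis by (simp add: push_iter)
qed

text \<open>The uniform lower bound: all images \<open>T ` P i\<close> contain an atom of a finite family \<open>P j\<close>,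
  \<open>j < m\<close>, these atoms mix among each other, and, by invariance of the measure, their images
  cover the space with at least half of its mass.\<close>

lemma doeblin: "\<exists>N\<ge>1. \<exists>\<epsilon>>0. \<epsilon> < 1 \<and> (\<forall>\<nu>. reg 0 c \<nu> \<longrightarrow> \<nu> (space M) = 1 \<longrightarrow>
   (\<forall>B\<in>sets M. 2 * \<epsilon> * prob B \<le> (push ^^ N) \<nu> B))"
proof -
  \<comment> \<open>The constant of \<open>reg_upper_term\<close> for \<open>prob\<close> itself,
    whose regularity constant is 0.\<close>
  define C1 where "C1 = exp D / \<delta>"
  have C1: "C1 > 0" using \<delta>_pos by (simp add: C1_def)
  \<comment> \<open>A tail below \<open>\<delta>\<close> forces every image to meet an atom of
    \<open>F\<close>; a tail below \<open>1 / (2 * C1)\<close> gives \<open>half\<close>.\<close>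
  obtain m where m: "prob (X - (\<Union>i<m. P i)) < min \<delta> (1 / (2 * C1))"
    using tail_small[of "min \<delta> (1 / (2 * C1))"] \<delta>_pos C1 by auto
  define F where "F = {j. j < m \<and> P j \<noteq> {}}"
  define U where "U = (\<Union>i<m. P i)"
  have [simp]: "finite F" by (simp add: F_def)
  have U [measurable]: "U \<in> sets M" by (simp add: U_def)
  have UF: "U = (\<Union>j\<in>F. P j)" by (auto simp: U_def F_def)
  have ex: "\<exists>j\<in>F. P j \<subseteq> T ` P i" if "P i \<noteq> {}" for i
  proof (rule ccontr)
    assume "\<not> ?thesis"
    then have "U \<inter> T ` P i = {}" using Markov[of _ i] UF by blast
    then have "T ` P i \<subseteq> X - U" using TP_sub_X by blast
    then have "prob (T ` P i) \<le> prob (X - U)" by (intro finite_measure_mono) auto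
    then show False using m big[OF that] by (simp add: U_def)
  qed
  have "\<forall>j k. \<exists>m. j \<in> F \<longrightarrow> k \<in> F \<longrightarrow> (\<forall>n>m. 0 < prob (P j \<inter> (T ^^ n) -` P k))"
    using mixing_prob by (auto simp: F_def)
  then obtain mm :: "nat \<Rightarrow> nat \<Rightarrow> nat" where
    mm: "\<And>j k n. j \<in> F \<Longrightarrow> k \<in> F \<Longrightarrow> n > mm j k \<Longrightarrow> 0 < prob (P j \<inter> (T ^^ n) -` P k)" by metis
  \<comment> \<open>One time beyond all mixing times of the finitely many pairs.\<close>
  define n where "n = Suc (\<Sum>j\<in>F. \<Sum>k\<in>F. mm j k)"
  define q where "q j k = prob (P j \<inter> (T ^^ n) -` P k)" for j k
  have q: "0 < q j k" if "j \<in> F" "k \<in> F" for j k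
  proof -
    have "mm j k \<le> (\<Sum>k\<in>F. mm j k)" using that by (intro member_le_sum) auto
    also have "\<dots> \<le> (\<Sum>j\<in>F. \<Sum>k\<in>F. mm j k)"
      using that by (intro member_le_sum[where f="\<lambda>j. \<Sum>k\<in>F. mm j k"]) auto
    finally show ?thesis unfolding q_def by (intro mm that) (simp add: n_def)
  qed
  define e0 where "e0 = Min (insert 1 ((\<lambda>(j,k). q j k) ` (F \<times> F)))"
  have e0: "0 < e0" unfolding e0_def by (subst Min_gr_iff) (auto intro: q)
  have e0_le: "e0 \<le> q j k" if "j \<in> F" "k \<in> F" for j k
    unfolding e0_def by (rule Min_le) (use that in auto)
  have e0_1: "e0 \<le> 1" unfolding e0_def by (rule Min_le) auto
  \<comment> \<open>After \<open>n\<close> steps the mass on each atom of \<open>F\<close> is at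
    least \<open>e0\<close>; the factor \<open>exp (- Dsum)\<close> passes from the atom to its
    subsets.\<close>
  define e1 where "e1 = exp (- Dsum) * e0"
  have e1: "0 < e1" "e1 \<le> 1" using e0 e0_1 Dsum_nonneg by (auto simp: e1_def intro!: mult_le_one)
  have mixF: "e1 * prob (B \<inter> U) \<le> (push ^^ n) (\<lambda>B. prob (P j \<inter> B)) B" if j: "j \<in> F" and B: "B \<in> sets M" for j B
  proof -
    define \<nu> where "\<nu> = (push ^^ n) (\<lambda>B. prob (P j \<inter> B))"
    have reg: "reg 0 (r ^ n * 0 + Dsum) \<nu>" unfolding \<nu>_def by (intro reg_push_iter0 reg_prob_P)
    have 1: "e1 * prob (B \<inter> P k) \<le> \<nu> (B \<inter> P k)" if k: "k \<in> F" for k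
    proof -
      have "(T ^^ n) -` P k \<inter> space M \<inter> P j = P j \<inter> (T ^^ n) -` P k"
        using sets.sets_into_space[OF P_sets] by auto
      then have \<nu>k: "\<nu> (P k) = q j k" unfolding \<nu>_def q_def by (simp add: push_iter Int_commute)
      have "\<nu> (P k) * prob (B \<inter> P k) \<le> exp ((r ^ n * 0 + Dsum) * r ^ 1) * \<nu> (B \<inter> P k) * prob (P k)"
        by (rule reg_ratio[OF reg]) (use Cyl_1[of k] B in auto)
      also have "\<dots> \<le> exp Dsum * \<nu> (B \<inter> P k) * 1"
        using B r_less r_pos Dsum_nonneg reg_nonneg[OF reg, of "B \<inter> P k"]
        by (intro mult_mono) (auto intro: mult_left_le)
      finally have "exp (- Dsum) * (q j k * prob (B \<inter> P k)) \<le> exp (- Dsum) * (exp Dsum * \<nu> (B \<inter> P k))"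
        unfolding \<nu>k by (intro mult_left_mono) auto
      then have "exp (- Dsum) * (q j k * prob (B \<inter> P k)) \<le> \<nu> (B \<inter> P k)"
        by (simp add: mult.assoc[symmetric] exp_add[symmetric])
      moreover have "e1 * prob (B \<inter> P k) \<le> exp (- Dsum) * (q j k * prob (B \<inter> P k))"
        using e0_le[OF j k] by (simp add: e1_def mult_right_mono)
      ultimately show ?thesis by linarith
    qed
    have "(\<lambda>i. prob (P i \<inter> (B \<inter> U))) sums prob (B \<inter> U)"
      by (rule reg_decomp[OF reg_prob]) (use B in auto)
    then have s1: "(\<lambda>i. e1 * prob (P i \<inter> (B \<inter> U))) sums (e1 * prob (B \<inter> U))" by (rule sums_mult)
    have s2: "(\<lambda>i. \<nu> (P i \<inter> B)) sums \<nu> B"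
      by (rule reg_decomp[OF reg]) (use B in auto)
    have "e1 * prob (P i \<inter> (B \<inter> U)) \<le> \<nu> (P i \<inter> B)" for i
    proof (cases "i \<in> F")
      case True
      then have "P i \<inter> (B \<inter> U) = B \<inter> P i" "P i \<inter> B = B \<inter> P i" using UF by auto
      then show ?thesis using 1[OF True] by simp
    next
      case False
      have "P i \<inter> P j = {}" if "j \<in> F" for j
        using that False P_disj by (metis UNIV_I disjoint_family_on_def)
      then have "P i \<inter> (B \<inter> U) = {}" using UF by auto
      then show ?thesis using reg_nonneg[OF reg, of "P i \<inter> B"] B by auto
    qed
    then show ?thesis using sums_le[OF _ s1 s2] by (auto simp: \<nu>_def)
  qed
  \<comment> \<open>By invariance the full mass \<open>prob B\<close> flows into \<open>B\<close> in
    one step, and by the choice of \<open>m\<close> at most half of it comes from outside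
    \<open>U\<close>.\<close>
  have half: "prob B / 2 \<le> prob (U \<inter> T -` B)" if B [measurable]: "B \<in> sets M" for B
  proof -
    have "prob (P i \<inter> T -` B - U) \<le> C1 * prob (P i - U) * prob B" for i
    proof (cases "i \<in> F \<or> P i = {}")
      case True
      then have e: "P i - U = {}" "P i \<inter> T -` B - U = {}" using UF by auto
      show ?thesis unfolding e by simp
    next
      case False
      then have "i \<notin> F" by simp
      then have "P i \<inter> P j = {}" if "j \<in> F" for j
        using that P_disj \<open>i \<notin> F\<close> by (metis UNIV_I disjoint_family_on_def)
      then have "P i - U = P i" "P i \<inter> T -` B - U = P i \<inter> T -` B" using UF by auto
      then show ?thesis using reg_upper_term[OF reg_prob, of B i] B by (simp add: C1_def)
    qed
    moreover have "P i \<inter> T -` B - U = P i \<inter> (T -` B \<inter> space M - U)" "P i - U = P i \<inter> (X - U)" for i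
      using sets.sets_into_space[OF P_sets] P_sub_X by auto
    ultimately have t1: "prob (P i \<inter> (T -` B \<inter> space M - U)) \<le> C1 * prob (P i \<inter> (X - U)) * prob B" for i
      by (simp only:)
    have t2: "(\<lambda>i. prob (P i \<inter> (T -` B \<inter> space M - U))) sums prob (T -` B \<inter> space M - U)"
      by (rule reg_decomp[OF reg_prob]) simp
    have t3: "(\<lambda>i. C1 * prob (P i \<inter> (X - U)) * prob B) sums (C1 * prob (X - U) * prob B)"
      by (intro sums_mult2 sums_mult reg_decomp[OF reg_prob]) simp
    have "prob (T -` B \<inter> space M - U) \<le> C1 * prob (X - U) * prob B"
      by (rule sums_le[OF t1 t2 t3])
    also have "\<dots> \<le> C1 * (1 / (2 * C1)) * prob B"
      using m C1 by (intro mult_right_mono mult_left_mono) (auto simp: U_def)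
    also have "\<dots> = prob B / 2" using C1 by simp
    finally have t: "prob (T -` B \<inter> space M - U) \<le> prob B / 2" .
    have "prob B = prob (T -` B \<inter> space M)" using T_pres_prob[OF B] by simp
    also have "T -` B \<inter> space M = (U \<inter> T -` B) \<union> (T -` B \<inter> space M - U)"
      using sets.sets_into_space[OF U] by auto
    also have "prob \<dots> = prob (U \<inter> T -` B) + prob (T -` B \<inter> space M - U)"
      by (rule finite_measure_Union) auto
    finally show ?thesis using t by linarith
  qed
  \<comment> \<open>The lower constant of \<open>reg_lower_term\<close>; the absolute value ensures
    \<open>\<kappa> \<le> 1\<close> for \<open>c\<close> of either sign.\<close>
  define \<kappa> where "\<kappa> = exp (- (\<bar>c\<bar> * r + D))"
  have "0 \<le> \<bar>c\<bar> * r" using r_pos by simp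
  then have \<kappa>: "0 < \<kappa>" "\<kappa> \<le> 1" using D_nonneg by (simp_all add: \<kappa>_def)
  \<comment> \<open>One factor 2 is lost in \<open>half\<close>, the other is the 2 in the claim,
    which \<open>reg_subtract\<close> will need.\<close>
  define \<epsilon> where "\<epsilon> = \<kappa> * e1 / 4"
  have "\<kappa> * e1 \<le> 1" using \<kappa> e1 by (intro mult_le_one) auto
  then have \<epsilon>: "0 < \<epsilon>" "\<epsilon> < 1" using \<kappa> e1 by (auto simp: \<epsilon>_def)
  \<comment> \<open>Of the \<open>n + 2\<close> steps, the first carries each atom onto some atom of
    \<open>F\<close>, the next \<open>n\<close> spread the mass over \<open>U\<close>, and the last
    spreads it from \<open>U\<close> over the whole space.\<close>
  have "2 * \<epsilon> * prob B \<le> (push ^^ (n + 2)) \<nu> B"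
    if reg: "reg 0 c \<nu>" and 1: "\<nu> (space M) = 1" and B: "B \<in> sets M" for \<nu> B
  proof -
    have reg': "reg 0 \<bar>c\<bar> \<nu>" using reg by (rule reg_weaken) auto
    have *: "\<kappa> * e1 * prob (B \<inter> U) \<le> (push ^^ (n + 1)) \<nu> B" if B: "B \<in> sets M" for B
    proof -
      let ?B = "(T ^^ n) -` B \<inter> space M"
      have [measurable]: "?B \<in> sets M" using B by simp
      have "\<nu> (P i) * (\<kappa> * e1 * prob (B \<inter> U)) \<le> \<nu> (P i \<inter> T -` ?B)" for i
      proof (cases "P i = {}")
        case True then show ?thesis using reg_empty[OF reg] by simp
      next
        case False
        then obtain j where j: "j \<in> F" "P j \<subseteq> T ` P i" using ex by blast
        have "e1 * prob (B \<inter> U) \<le> prob (P j \<inter> ?B)"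
          using mixF[OF j(1) B] B by (simp add: push_iter)
        also have "\<dots> \<le> prob (?B \<inter> T ` P i)"
          using j by (intro finite_measure_mono) auto
        finally have "\<kappa> * \<nu> (P i) * (e1 * prob (B \<inter> U)) \<le> \<kappa> * \<nu> (P i) * prob (?B \<inter> T ` P i)"
          using \<kappa> reg_nonneg[OF reg, of "P i"] by (intro mult_left_mono) auto
        also have "\<dots> \<le> \<nu> (P i \<inter> T -` ?B)"
          unfolding \<kappa>_def by (rule reg_lower_term[OF reg']) simp
        finally show ?thesis by (simp add: mult_ac)
      qed
      moreover have "(\<lambda>i. \<nu> (P i) * (\<kappa> * e1 * prob (B \<inter> U))) sums (\<nu> (space M) * (\<kappa> * e1 * prob (B \<inter> U)))"
        by (intro sums_mult2 reg_sums_P[OF reg])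
      moreover have "(\<lambda>i. \<nu> (P i \<inter> T -` ?B)) sums push \<nu> ?B"
        by (intro push_decomp[OF reg]) simp
      ultimately have "\<nu> (space M) * (\<kappa> * e1 * prob (B \<inter> U)) \<le> push \<nu> ?B"
        by (rule sums_le)
      also have "push \<nu> ?B = (push ^^ n) (push \<nu>) B" using B by (simp add: push_iter)
      finally show ?thesis using 1 by (simp add: funpow_swap1)
    qed
    have TB: "T -` B \<inter> space M \<in> sets M" using B by simp
    have "2 * \<epsilon> * prob B = \<kappa> * e1 * (prob B / 2)" by (simp add: \<epsilon>_def)
    also have "\<dots> \<le> \<kappa> * e1 * prob (U \<inter> T -` B)"
      using half[OF B] \<kappa> e1 by (intro mult_left_mono) auto
    also have "U \<inter> T -` B = (T -` B \<inter> space M) \<inter> U" using sets.sets_into_space[OF U] by auto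
    also have "\<kappa> * e1 * prob ((T -` B \<inter> space M) \<inter> U) \<le> (push ^^ (n + 1)) \<nu> (T -` B \<inter> space M)"
      by (rule *[OF TB])
    also have "\<dots> = (push ^^ (n + 2)) \<nu> B" by (simp add: push_def)
    finally show ?thesis .
  qed
  then show ?thesis using \<epsilon> by (intro exI[of _ "n + 2"]) auto
qed

text \<open>Since \<open>\<nu>\<close> is at least twice what is subtracted, at least half of it
  remains, so the relative oscillation at most doubles.\<close>

lemma reg_subtract: assumes reg: "reg 0 c \<nu>" and c: "0 \<le> c" and \<epsilon>: "0 < \<epsilon>" "\<epsilon> < 1"
    and ge: "\<And>B. B \<in> sets M \<Longrightarrow> 2 * \<epsilon> * prob B \<le> \<nu> B"
  shows "reg 0 (2 * c) (\<lambda>B. (\<nu> B - \<epsilon> * prob B) / (1 - \<epsilon>))"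
  unfolding reg_def
proof (intro conjI allI impI ballI)
  fix B assume B: "B \<in> sets M"
  have "\<epsilon> * prob B \<le> 2 * \<epsilon> * prob B" using \<epsilon> by simp
  then have "\<epsilon> * prob B \<le> \<nu> B" using ge[OF B] by linarith
  then show "0 \<le> (\<nu> B - \<epsilon> * prob B) / (1 - \<epsilon>)" using \<epsilon> by simp
next
  fix A :: "nat \<Rightarrow> 'a set" assume A: "range A \<subseteq> sets M" "disjoint_family A"
  show "(\<lambda>i. (\<nu> (A i) - \<epsilon> * prob (A i)) / (1 - \<epsilon>)) sums ((\<nu> (\<Union>i. A i) - \<epsilon> * prob (\<Union>i. A i)) / (1 - \<epsilon>))"
    using A by (intro sums_divide sums_diff sums_mult reg_sums[OF reg] finite_measure_UNION)
next
  fix B assume "B \<in> sets M" "prob B = 0"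
  then show "(\<nu> B - \<epsilon> * prob B) / (1 - \<epsilon>) = 0" using reg_null[OF reg] by simp
next
  fix n q B B' assume n: "(0::nat) < n" and B: "B \<in> sets M" "B' \<in> sets M" "B \<subseteq> Cyl q n" "B' \<subseteq> Cyl q n"
  define E where "E = exp (c * r ^ n)"
  have E: "1 \<le> E" using c r_pos by (simp add: E_def)
  have E2: "exp (2 * c * r ^ n) = E * E" by (simp add: E_def exp_add[symmetric])
  have "\<nu> B * prob B' \<le> E * \<nu> B' * prob B"
    unfolding E_def by (rule reg_ratio[OF reg n B])
  \<comment> \<open>For densities \<open>u\<close> at one point and \<open>u'\<close> at another the
    claim follows from \<open>E * u' - \<epsilon> \<le> E^2 * (u' - \<epsilon>)\<close>, that is
    \<open>\<epsilon> * (E + 1) \<le> E * u'\<close> after division by \<open>E - 1\<close>. This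
    holds as \<open>u' \<ge> 2 * \<epsilon>\<close> and \<open>E + 1 \<le> 2 * E\<close>.\<close>
  moreover have "0 \<le> prob B * ((E * E - E) * \<nu> B' - \<epsilon> * prob B' * (E * E - 1))"
  proof (rule mult_nonneg_nonneg)
    have "\<epsilon> * prob B' * (E * E - 1) = (E - 1) * (E + 1) * (\<epsilon> * prob B')" by (simp add: algebra_simps)
    also have "\<dots> \<le> (E - 1) * (2 * E) * (\<epsilon> * prob B')"
      using E \<epsilon> by (intro mult_right_mono mult_left_mono) auto
    also have "\<dots> = (E - 1) * E * (2 * \<epsilon> * prob B')" by simp
    also have "\<dots> \<le> (E - 1) * E * \<nu> B'"
      using E ge[OF B(2)] by (intro mult_left_mono) auto
    finally show "0 \<le> (E * E - E) * \<nu> B' - \<epsilon> * prob B' * (E * E - 1)" by (simp add: algebra_simps)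
  qed simp
  ultimately have "(\<nu> B - \<epsilon> * prob B) * prob B' \<le> E * E * (\<nu> B' - \<epsilon> * prob B') * prob B"
    by (simp add: algebra_simps)
  then have "(\<nu> B - \<epsilon> * prob B) * prob B' / (1 - \<epsilon>) \<le> E * E * (\<nu> B' - \<epsilon> * prob B') * prob B / (1 - \<epsilon>)"
    using \<epsilon> by (intro divide_right_mono) auto
  then show "(\<nu> B - \<epsilon> * prob B) / (1 - \<epsilon>) * prob B' \<le>
      exp (2 * c * r ^ n) * ((\<nu> B' - \<epsilon> * prob B') / (1 - \<epsilon>)) * prob B"
    unfolding E2 by simp
qed

text \<open>After \<open>N\<close> steps a multiple of \<open>prob\<close> is split off. The
  remainder is less regular, but \<open>j\<close> further steps restore the constant
  \<open>c\<close>, so the splitting can be repeated; \<open>c\<close> must exceed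
  \<open>Dsum\<close> to leave room for this.\<close>

lemma contraction_step: assumes c: "Dsum + 1 \<le> c"
  shows "\<exists>L\<ge>1. \<exists>\<epsilon>>0. \<epsilon> < 1 \<and> (\<forall>\<nu>. reg 0 c \<nu> \<longrightarrow> \<nu> (space M) = 1 \<longrightarrow>
    (\<exists>\<nu>'. reg 0 c \<nu>' \<and> \<nu>' (space M) = 1 \<and>
      (\<forall>B\<in>sets M. (push ^^ L) \<nu> B = \<epsilon> * prob B + (1 - \<epsilon>) * \<nu>' B)))"
proof -
  have c0: "0 \<le> c" using c Dsum_nonneg by simp
  obtain N \<epsilon> where N: "N \<ge> 1" and \<epsilon>: "\<epsilon> > 0" "\<epsilon> < 1"
    and doe: "\<And>\<nu> B. reg 0 c \<nu> \<Longrightarrow> \<nu> (space M) = 1 \<Longrightarrow> B \<in> sets M \<Longrightarrow> 2 * \<epsilon> * prob B \<le> (push ^^ N) \<nu> B"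
    using doeblin[of c] by blast
  \<comment> \<open>A bound for the regularity constant after any number of steps; subtraction
    doubles it, and \<open>j\<close> is chosen to bring \<open>2 * c1\<close> below 1.\<close>
  define c1 where "c1 = c + Dsum"
  have c1: "c1 > 0" using c Dsum_nonneg by (simp add: c1_def)
  obtain j where j: "r ^ j < 1 / (2 * c1)"
    using real_arch_pow_inv[of "1 / (2 * c1)" r] r_less c1 by auto
  have "\<exists>\<nu>'. reg 0 c \<nu>' \<and> \<nu>' (space M) = 1 \<and>
      (\<forall>B\<in>sets M. (push ^^ (j + N)) \<nu> B = \<epsilon> * prob B + (1 - \<epsilon>) * \<nu>' B)"
    if reg: "reg 0 c \<nu>" and 1: "\<nu> (space M) = 1" for \<nu>
  proof -
    define \<nu>1 where "\<nu>1 = (push ^^ N) \<nu>"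
    define \<nu>2 where "\<nu>2 = (\<lambda>B. (\<nu>1 B - \<epsilon> * prob B) / (1 - \<epsilon>))"
    have "reg 0 (r ^ N * c + Dsum) \<nu>1" unfolding \<nu>1_def by (rule reg_push_iter0[OF reg])
    then have "reg 0 c1 \<nu>1"
      by (rule reg_weaken) (use c0 r_pos r_less in \<open>auto simp: c1_def intro!: mult_left_le_one_le power_le_one\<close>)
    then have "reg 0 (2 * c1) \<nu>2" unfolding \<nu>2_def
      by (rule reg_subtract) (use c1 \<epsilon> doe[OF reg 1] in \<open>auto simp: \<nu>1_def\<close>)
    then have "reg 0 (r ^ j * (2 * c1) + Dsum) ((push ^^ j) \<nu>2)" by (rule reg_push_iter0)
    moreover have "r ^ j * (2 * c1) \<le> 1" using j c1 by (simp add: field_simps)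
    ultimately have "reg 0 c ((push ^^ j) \<nu>2)"
      by (elim reg_weaken) (use c in auto)
    moreover have "(push ^^ j) \<nu>2 (space M) = 1"
    proof -
      have "\<nu>1 (space M) = 1" unfolding \<nu>1_def push_iter_space by (rule 1)
      then show ?thesis unfolding push_iter_space using \<epsilon> by (simp add: \<nu>2_def prob_space)
    qed
    moreover have "(push ^^ (j + N)) \<nu> B = \<epsilon> * prob B + (1 - \<epsilon>) * (push ^^ j) \<nu>2 B" if B: "B \<in> sets M" for B
    proof -
      have "(push ^^ (j + N)) \<nu> B = (push ^^ j) \<nu>1 B" by (simp add: funpow_add \<nu>1_def)
      also have "\<dots> = \<nu>1 ((T ^^ j) -` B \<inter> space M)" by (rule push_iter[OF B])
      also have "\<dots> = \<epsilon> * prob ((T ^^ j) -` B \<inter> space M) + (1 - \<epsilon>) * \<nu>2 ((T ^^ j) -` B \<inter> space M)"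
        using \<epsilon> by (simp add: \<nu>2_def)
      finally show ?thesis by (simp add: push_iter[OF B] Tn_pres_prob[OF B])
    qed
    ultimately show ?thesis by blast
  qed
  then show ?thesis using N \<epsilon> by (intro exI[of _ "j + N"]) auto
qed

text \<open>Each splitting multiplies the deviation from \<open>prob\<close> by
  \<open>1 - \<epsilon>\<close>. The error is relative to \<open>prob B\<close>, not absolute, which
  later allows arbitrary integrable functions in place of sets.\<close>

lemma decay: "\<exists>C\<ge>0. \<exists>\<theta>>0. \<theta> < 1 \<and> (\<forall>\<nu>. reg 0 c \<nu> \<longrightarrow> \<nu> (space M) = 1 \<longrightarrow>
    (\<forall>m\<ge>1. \<forall>B\<in>sets M. \<bar>(push ^^ m) \<nu> B - prob B\<bar> \<le> C * \<theta> ^ m * prob B))"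
proof -
  define c' where "c' = max c (Dsum + 1)"
  obtain L \<epsilon> where L: "L \<ge> 1" and \<epsilon>: "\<epsilon> > 0" "\<epsilon> < 1"
    and step: "\<And>\<nu>. reg 0 c' \<nu> \<Longrightarrow> \<nu> (space M) = 1 \<Longrightarrow> \<exists>\<nu>'. reg 0 c' \<nu>' \<and> \<nu>' (space M) = 1 \<and>
      (\<forall>B\<in>sets M. (push ^^ L) \<nu> B = \<epsilon> * prob B + (1 - \<epsilon>) * \<nu>' B)"
    using contraction_step[of c'] unfolding c'_def by auto
  define K where "K = exp (c' * r + D) / \<delta> + 1"
  have K: "K \<ge> 1" using \<delta>_pos by (simp add: K_def)
  \<comment> \<open>The contraction by \<open>1 - \<epsilon>\<close> every \<open>L\<close> steps,
    expressed as a rate per step.\<close>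
  define \<theta> where "\<theta> = root L (1 - \<epsilon>)"
  have \<theta>: "0 < \<theta>" "\<theta> < 1" "\<theta> ^ L = 1 - \<epsilon>" using L \<epsilon> by (auto simp: \<theta>_def real_root_lt_1_iff)
  have iter: "\<exists>\<nu>'. reg 0 c' \<nu>' \<and> \<nu>' (space M) = 1 \<and>
      (\<forall>B\<in>sets M. (push ^^ (k * L)) \<nu> B - prob B = (1 - \<epsilon>) ^ k * (\<nu>' B - prob B))"
    if "reg 0 c' \<nu>" "\<nu> (space M) = 1" for k \<nu>
  proof (induction k)
    case 0
    show ?case using that by (intro exI[of _ \<nu>]) auto
  next
    case (Suc k)
    then obtain \<nu>1 where \<nu>1: "reg 0 c' \<nu>1" "\<nu>1 (space M) = 1"
      "\<And>B. B \<in> sets M \<Longrightarrow> (push ^^ (k * L)) \<nu> B - prob B = (1 - \<epsilon>) ^ k * (\<nu>1 B - prob B)" by blast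
    obtain \<nu>2 where \<nu>2: "reg 0 c' \<nu>2" "\<nu>2 (space M) = 1"
      "\<And>B. B \<in> sets M \<Longrightarrow> (push ^^ L) \<nu>1 B = \<epsilon> * prob B + (1 - \<epsilon>) * \<nu>2 B" using step[OF \<nu>1(1,2)] by blast
    have "(push ^^ (Suc k * L)) \<nu> B - prob B = (1 - \<epsilon>) ^ Suc k * (\<nu>2 B - prob B)" if B: "B \<in> sets M" for B
    proof -
      let ?B = "(T ^^ L) -` B \<inter> space M"
      have "(push ^^ (Suc k * L)) \<nu> B - prob B = (push ^^ (k * L)) \<nu> ?B - prob ?B"
        by (simp add: funpow_add push_iter[OF B] Tn_pres_prob[OF B])
      also have "\<dots> = (1 - \<epsilon>) ^ k * (\<nu>1 ?B - prob ?B)" by (rule \<nu>1(3)) (use B in simp)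
      also have "\<nu>1 ?B - prob ?B = (1 - \<epsilon>) * (\<nu>2 B - prob B)"
        using \<nu>2(3)[OF B] by (simp add: push_iter[OF B] Tn_pres_prob[OF B] algebra_simps)
      finally show ?thesis by simp
    qed
    then show ?case using \<nu>2 by blast
  qed
  have "\<bar>(push ^^ m) \<nu> B - prob B\<bar> \<le> (K / (1 - \<epsilon>)) * \<theta> ^ m * prob B"
    if reg: "reg 0 c \<nu>" and 1: "\<nu> (space M) = 1" and m: "1 \<le> m" and B: "B \<in> sets M" for \<nu> m B
  proof -
    have reg': "reg 0 c' \<nu>" using reg by (rule reg_weaken) (auto simp: c'_def)
    \<comment> \<open>One step is set aside for \<open>reg_upper\<close>, which bounds the remainder
      by a multiple of \<open>prob\<close>. The incomplete round of \<open>L\<close> steps costs the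
      factor \<open>1 / (1 - \<epsilon>)\<close>.\<close>
    define k l where "k = (m - 1) div L" and "l = (m - 1) mod L"
    have kl: "m = k * L + (l + 1)" "l < L" using m L by (auto simp: k_def l_def)
    obtain \<nu>1 where \<nu>1: "reg 0 c' \<nu>1" "\<nu>1 (space M) = 1"
      "\<And>B. B \<in> sets M \<Longrightarrow> (push ^^ (k * L)) \<nu> B - prob B = (1 - \<epsilon>) ^ k * (\<nu>1 B - prob B)"
      using iter[OF reg' 1] by blast
    let ?B1 = "(T ^^ l) -` B \<inter> space M" and ?B = "(T ^^ (l + 1)) -` B \<inter> space M"
    have "(push ^^ m) \<nu> B = (push ^^ (k * L)) \<nu> ?B"
    proof -
      have "(push ^^ m) \<nu> = (push ^^ (l + 1)) ((push ^^ (k * L)) \<nu>)"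
        unfolding kl(1) by (simp only: add.commute[of "k * L"] funpow_add o_apply)
      then show ?thesis using push_iter[OF B, of "l + 1"] by simp
    qed
    then have "(push ^^ m) \<nu> B - prob B = (push ^^ (k * L)) \<nu> ?B - prob ?B"
      using Tn_pres_prob[OF B, of "l + 1"] by simp
    also have "\<dots> = (1 - \<epsilon>) ^ k * (\<nu>1 ?B - prob B)"
      using \<nu>1(3)[OF measurable_sets[OF Tn_meas[of "l + 1"] B]] Tn_pres_prob[OF B, of "l + 1"] by (simp only:)
    finally have eq: "(push ^^ m) \<nu> B - prob B = (1 - \<epsilon>) ^ k * (\<nu>1 ?B - prob B)" .
    have "\<nu>1 ?B = (push ^^ (l + 1)) \<nu>1 B" using push_iter[OF B, of "l + 1" \<nu>1] by simp
    also have "\<dots> = (push ^^ l) (push \<nu>1) B" by (simp add: funpow_swap1)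
    also have "\<dots> = push \<nu>1 ?B1" by (rule push_iter[OF B])
    also have "\<dots> \<le> exp (c' * r + D) / \<delta> * \<nu>1 (space M) * prob ?B1"
      by (rule reg_upper[OF \<nu>1(1)]) (use B in simp)
    also have "\<dots> = (K - 1) * prob B" by (simp add: K_def \<nu>1(2) Tn_pres_prob[OF B])
    finally have up: "\<nu>1 ?B \<le> (K - 1) * prob B" .
    have "0 \<le> \<nu>1 ?B" by (rule reg_nonneg[OF \<nu>1(1) measurable_sets[OF Tn_meas B]])
    moreover have "prob B \<le> K * prob B" using K by (simp add: mult_le_cancel_right1)
    moreover have "(K - 1) * prob B = K * prob B - prob B" "0 \<le> prob B" by (simp_all add: left_diff_distrib)
    ultimately have "\<bar>\<nu>1 ?B - prob B\<bar> \<le> K * prob B" using up by linarith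
    then have "\<bar>(push ^^ m) \<nu> B - prob B\<bar> \<le> (1 - \<epsilon>) ^ k * (K * prob B)"
      unfolding eq abs_mult using \<epsilon> by (simp add: mult_left_mono)
    moreover have "(1 - \<epsilon>) ^ k \<le> \<theta> ^ m / (1 - \<epsilon>)"
    proof -
      have "(1 - \<epsilon>) ^ Suc k = \<theta> ^ (Suc k * L)" unfolding \<theta>(3)[symmetric] power_mult[symmetric] by (simp only: mult.commute)
      also have "\<dots> \<le> \<theta> ^ m" by (rule power_decreasing) (use kl \<theta> in auto)
      finally show ?thesis using \<epsilon> by (simp add: field_simps)
    qed
    then have "(1 - \<epsilon>) ^ k * (K * prob B) \<le> \<theta> ^ m / (1 - \<epsilon>) * (K * prob B)"
      using K by (intro mult_right_mono) auto
    ultimately show ?thesis by (simp add: mult_ac)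
  qed
  moreover have "0 \<le> K / (1 - \<epsilon>)" using K \<epsilon> by simp
  ultimately show ?thesis using \<theta> by blast
qed

end

section \<open>Decay of correlations\<close>

text \<open>The pointwise inequality is integrated over \<open>x\<close> in \<open>B\<close> with
  \<open>y\<close> fixed, and then over \<open>y\<close> in \<open>B'\<close>.\<close>

lemma density_ratio:
  fixes w :: "'a \<Rightarrow> ennreal"
  assumes [measurable]: "w \<in> borel_measurable M" "B \<in> sets M" "B' \<in> sets M" and N: "N \<in> null_sets M"
    and le: "\<And>x y. x \<in> B - N \<Longrightarrow> y \<in> B' - N \<Longrightarrow> w x \<le> E * w y"
  shows "(\<integral>\<^sup>+x. w x * indicator B x \<partial>M) * emeasure M B' \<le> E * (\<integral>\<^sup>+x. w x * indicator B' x \<partial>M) * emeasure M B"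
proof -
  have 1: "(\<integral>\<^sup>+x. w x * indicator B x \<partial>M) \<le> E * w y * emeasure M B" if y: "y \<in> B' - N" for y
  proof -
    have "(\<integral>\<^sup>+x. w x * indicator B x \<partial>M) \<le> (\<integral>\<^sup>+x. (E * w y) * indicator B x \<partial>M)"
      using AE_not_in[OF N] by (intro nn_integral_mono_AE) (auto elim!: eventually_mono intro: le[OF _ y] split: split_indicator)
    then show ?thesis by (simp add: nn_integral_cmult_indicator)
  qed
  let ?I = "\<integral>\<^sup>+x. w x * indicator B x \<partial>M"
  have "?I * emeasure M B' = (\<integral>\<^sup>+y. ?I * indicator B' y \<partial>M)" by (simp add: nn_integral_cmult_indicator)
  also have "\<dots> \<le> (\<integral>\<^sup>+y. (E * emeasure M B) * (w y * indicator B' y) \<partial>M)"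
  proof (rule nn_integral_mono_AE)
    show "AE y in M. ?I * indicator B' y \<le> (E * emeasure M B) * (w y * indicator B' y)"
      using AE_not_in[OF N] by eventually_elim (use 1 in \<open>auto simp: mult_ac split: split_indicator\<close>)
  qed
  also have "\<dots> = (E * emeasure M B) * (\<integral>\<^sup>+y. w y * indicator B' y \<partial>M)"
    by (rule nn_integral_cmult) simp
  finally show ?thesis by (simp add: mult_ac)
qed

lemma (in finite_measure) bounded_integrable:
  fixes f :: "'a \<Rightarrow> 'b :: {banach, second_countable_topology}"
  shows "f \<in> borel_measurable M \<Longrightarrow> (\<And>x. x \<in> space M \<Longrightarrow> norm (f x) \<le> B) \<Longrightarrow> integrable M f"
  by (rule integrable_const_bound[where B=B]) auto

context markov_system
begin

section \<open>Bounded densities as regular set functions\<close>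

lemma integrable_bounded_mult: fixes w G :: "'a \<Rightarrow> real"
  assumes [measurable]: "w \<in> borel_measurable M" and w: "\<And>x. \<bar>w x\<bar> \<le> W" and G: "integrable M G"
  shows "integrable M (\<lambda>x. w x * G x)"
proof (rule Bochner_Integration.integrable_bound[OF integrable_mult_right[OF G, of W]])
  have [measurable]: "G \<in> borel_measurable M" using G by simp
  show "(\<lambda>x. w x * G x) \<in> borel_measurable M" by measurable
  have "\<bar>w x\<bar> \<le> \<bar>W\<bar>" for x using w[of x] by linarith
  then show "AE x in M. norm (w x * G x) \<le> norm (W * G x)"
    by (auto simp: abs_mult intro!: mult_right_mono)
qed

lemma integral_Tn: fixes f :: "'a \<Rightarrow> 'b :: {banach, second_countable_topology}"
  shows "f \<in> borel_measurable M \<Longrightarrow> (\<integral>x. f ((T ^^ n) x) \<partial>M) = (\<integral>x. f x \<partial>M)"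
  using integral_distr[OF Tn_meas, of f n] by (simp add: Tn_pres)

lemma integrable_Tn: fixes f :: "'a \<Rightarrow> 'b :: {banach, second_countable_topology}"
  shows "integrable M f \<Longrightarrow> integrable M (\<lambda>x. f ((T ^^ n) x))"
  using integrable_distr_eq[OF Tn_meas, of f n] by (simp add: Tn_pres)

lemma reg_density:
  assumes w [measurable]: "w \<in> borel_measurable M" and w0: "\<And>x. 0 \<le> w x" and int: "integrable M w"
    and N: "N \<in> null_sets M"
    and ratio: "\<And>n q x y. p < n \<Longrightarrow> x \<in> Cyl q n - N \<Longrightarrow> y \<in> Cyl q n - N \<Longrightarrow> w x \<le> exp (c * r ^ n) * w y"
  shows "reg p c (measure (density M (\<lambda>x. ennreal (w x))))"
proof -
  let ?D = "density M (\<lambda>x. ennreal (w x))"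
  have em: "emeasure ?D B = (\<integral>\<^sup>+x. ennreal (w x) * indicator B x \<partial>M)" if "B \<in> sets M" for B
    by (rule emeasure_density) (use that in auto)
  have "emeasure ?D (space M) = (\<integral>\<^sup>+x. ennreal (w x) \<partial>M)"
    by (subst em) (auto intro!: nn_integral_cong)
  also have "\<dots> < \<infinity>" using int w0 by (simp add: integrable_iff_bounded)
  finally interpret D: finite_measure ?D by (intro finite_measureI) auto
  show ?thesis
    unfolding reg_def
  proof (intro conjI allI impI ballI)
    fix A :: "nat \<Rightarrow> 'a set" assume A: "range A \<subseteq> sets M" "disjoint_family A"
    then show "(\<lambda>i. measure ?D (A i)) sums measure ?D (\<Union>i. A i)"
      by (intro D.finite_measure_UNION) auto
  next
    fix B assume B: "B \<in> sets M" "prob B = 0"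
    then have "B \<in> null_sets M" by (simp add: null_sets_def emeasure_eq_measure)
    then have "AE x in M. ennreal (w x) * indicator B x = 0"
      by (rule AE_not_in[THEN eventually_mono]) auto
    then have "emeasure ?D B = 0" using B by (simp add: em nn_integral_0_iff_AE)
    then show "measure ?D B = 0" by (simp add: measure_def)
  next
    fix n q B B' assume n: "p < n" and B: "B \<in> sets M" "B' \<in> sets M" "B \<subseteq> Cyl q n" "B' \<subseteq> Cyl q n"
    have "emeasure ?D B * emeasure M B' \<le> ennreal (exp (c * r ^ n)) * emeasure ?D B' * emeasure M B"
      unfolding em[OF B(1)] em[OF B(2)]
    proof (rule density_ratio[OF _ B(1,2) N])
      fix x y assume "x \<in> B - N" "y \<in> B' - N"
      then have "w x \<le> exp (c * r ^ n) * w y" using B by (intro ratio[OF n, of x q]) auto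
      then show "ennreal (w x) \<le> ennreal (exp (c * r ^ n)) * ennreal (w y)"
        using w0 by (simp add: ennreal_mult[symmetric] ennreal_leI)
    qed simp
    then show "measure ?D B * prob B' \<le> exp (c * r ^ n) * measure ?D B' * prob B"
      by (simp add: D.emeasure_eq_measure emeasure_eq_measure ennreal_mult[symmetric])
  qed simp
qed

text \<open>A bound for sets passes to functions since the two measures are compared up to a factor.\<close>

lemma sets_to_functions_nonneg:
  assumes w [measurable]: "w \<in> borel_measurable M" and w0: "\<And>x. 0 \<le> w x" and wW: "\<And>x. w x \<le> W"
    and \<kappa>: "0 \<le> \<kappa>"
    and b: "\<And>B. B \<in> sets M \<Longrightarrow> \<bar>measure (density M (\<lambda>x. ennreal (w x))) ((T ^^ m) -` B \<inter> space M) - prob B\<bar> \<le> \<kappa> * prob B"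
    and G: "integrable M G" and G0: "\<And>x. 0 \<le> G x"
  shows "\<bar>(\<integral>x. w x * G ((T ^^ m) x) \<partial>M) - (\<integral>x. G x \<partial>M)\<bar> \<le> \<kappa> * (\<integral>x. G x \<partial>M)"
proof -
  let ?D = "density M (\<lambda>x. ennreal (w x))"
  have [measurable]: "G \<in> borel_measurable M" using G by simp
  have int: "integrable M (\<lambda>x. w x * G ((T ^^ m) x))"
    by (rule integrable_bounded_mult[OF w _ integrable_Tn[OF G], of W]) (use w0 wW in auto)
  have "emeasure ?D (space M) = (\<integral>\<^sup>+x. ennreal (w x) \<partial>M)"
    by (subst emeasure_density) (auto intro!: nn_integral_cong)
  also have "\<dots> \<le> (\<integral>\<^sup>+x. ennreal W \<partial>M)" by (intro nn_integral_mono) (use wW in \<open>auto intro: ennreal_leI\<close>)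
  also have "\<dots> < \<infinity>" by (simp add: emeasure_space_1)
  finally interpret D: finite_measure ?D by (intro finite_measureI) auto
  define \<nu> where "\<nu> = distr ?D M (T ^^ m)"
  have [simp]: "sets \<nu> = sets M" by (simp add: \<nu>_def)
  have \<nu>: "emeasure \<nu> B = ennreal (measure ?D ((T ^^ m) -` B \<inter> space M))" if "B \<in> sets M" for B
    unfolding \<nu>_def by (subst emeasure_distr) (use that in \<open>auto simp: D.emeasure_eq_measure\<close>)
  have I: "(\<integral>\<^sup>+x. ennreal (G x) \<partial>\<nu>) = ennreal (\<integral>x. w x * G ((T ^^ m) x) \<partial>M)"
  proof -
    have "(\<integral>\<^sup>+x. ennreal (G x) \<partial>\<nu>) = (\<integral>\<^sup>+x. ennreal (w x) * ennreal (G ((T ^^ m) x)) \<partial>M)"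
      unfolding \<nu>_def by (simp add: nn_integral_distr nn_integral_density)
    also have "\<dots> = (\<integral>\<^sup>+x. ennreal (w x * G ((T ^^ m) x)) \<partial>M)"
      using w0 G0 by (simp add: ennreal_mult)
    also have "\<dots> = ennreal (\<integral>x. w x * G ((T ^^ m) x) \<partial>M)"
      by (rule nn_integral_eq_integral[OF int]) (use w0 G0 in auto)
    finally show ?thesis .
  qed
  have J: "(\<integral>\<^sup>+x. ennreal (G x) \<partial>M) = ennreal (\<integral>x. G x \<partial>M)"
    by (rule nn_integral_eq_integral[OF G]) (use G0 in auto)
  have Gn: "0 \<le> (\<integral>x. G x \<partial>M)" using G0 by simp
  have wGn: "0 \<le> (\<integral>x. w x * G ((T ^^ m) x) \<partial>M)" using G0 w0 by simp
  have "\<nu> \<le> scale_measure (ennreal (1 + \<kappa>)) M"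
    using b \<kappa> by (subst le_measure)
      (auto simp: \<nu> emeasure_eq_measure ennreal_mult[symmetric] abs_le_iff algebra_simps simp del: ennreal_plus intro!: ennreal_leI)
  then have "(\<integral>\<^sup>+x. ennreal (G x) \<partial>\<nu>) \<le> (\<integral>\<^sup>+x. ennreal (G x) \<partial>scale_measure (ennreal (1 + \<kappa>)) M)"
    by (intro nn_integral_mono_measure) auto
  then have up: "(\<integral>x. w x * G ((T ^^ m) x) \<partial>M) \<le> (1 + \<kappa>) * (\<integral>x. G x \<partial>M)"
    using \<kappa> Gn by (simp add: I J nn_integral_scale_measure ennreal_mult[symmetric] del: ennreal_plus)
  have lo: "(1 - \<kappa>) * (\<integral>x. G x \<partial>M) \<le> (\<integral>x. w x * G ((T ^^ m) x) \<partial>M)"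
  \<comment> \<open>For \<open>\<kappa> > 1\<close> the factor \<open>1 - \<kappa>\<close> is
    negative and no measure can be scaled by it; then the bound is trivial because
    \<open>G \<ge> 0\<close>.\<close>
  proof (cases "\<kappa> \<le> 1")
    case False
    then have "(1 - \<kappa>) * (\<integral>x. G x \<partial>M) \<le> 0" using Gn by (intro mult_nonpos_nonneg) auto
    then show ?thesis using wGn by linarith
  next
    case True
    have "scale_measure (ennreal (1 - \<kappa>)) M \<le> \<nu>"
      using b True by (subst le_measure)
        (auto simp: \<nu> emeasure_eq_measure ennreal_mult[symmetric] abs_le_iff algebra_simps intro!: ennreal_leI)
    then have "(\<integral>\<^sup>+x. ennreal (G x) \<partial>scale_measure (ennreal (1 - \<kappa>)) M) \<le> (\<integral>\<^sup>+x. ennreal (G x) \<partial>\<nu>)"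
      by (intro nn_integral_mono_measure) auto
    then show ?thesis
      using True Gn wGn by (simp add: I J nn_integral_scale_measure ennreal_mult[symmetric])
  qed
  show ?thesis using up lo by (simp add: abs_le_iff algebra_simps)
qed

lemma sets_to_functions:
  assumes w [measurable]: "w \<in> borel_measurable M" and w0: "\<And>x. 0 \<le> w x" and wW: "\<And>x. w x \<le> W"
    and \<kappa>: "0 \<le> \<kappa>"
    and b: "\<And>B. B \<in> sets M \<Longrightarrow> \<bar>measure (density M (\<lambda>x. ennreal (w x))) ((T ^^ m) -` B \<inter> space M) - prob B\<bar> \<le> \<kappa> * prob B"
    and G: "integrable M G"
  shows "\<bar>(\<integral>x. w x * G ((T ^^ m) x) \<partial>M) - (\<integral>x. G x \<partial>M)\<bar> \<le> \<kappa> * (\<integral>x. \<bar>G x\<bar> \<partial>M)"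
proof -
  define G1 G2 where "G1 x = max 0 (G x)" and "G2 x = max 0 (- G x)" for x
  have i: "integrable M G1" "integrable M G2" unfolding G1_def[abs_def] G2_def[abs_def] using G by auto
  have eq: "G x = G1 x - G2 x" "\<bar>G x\<bar> = G1 x + G2 x" for x by (auto simp: G1_def G2_def)
  have wi: "integrable M (\<lambda>x. w x * g ((T ^^ m) x))" if "integrable M g" for g
    by (rule integrable_bounded_mult[OF w _ integrable_Tn[OF that], of W]) (use w0 wW in auto)
  have 1: "\<bar>(\<integral>x. w x * G1 ((T ^^ m) x) \<partial>M) - (\<integral>x. G1 x \<partial>M)\<bar> \<le> \<kappa> * (\<integral>x. G1 x \<partial>M)"
    by (rule sets_to_functions_nonneg[OF w w0 wW \<kappa> b i(1)]) (auto simp: G1_def)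
  have 2: "\<bar>(\<integral>x. w x * G2 ((T ^^ m) x) \<partial>M) - (\<integral>x. G2 x \<partial>M)\<bar> \<le> \<kappa> * (\<integral>x. G2 x \<partial>M)"
    by (rule sets_to_functions_nonneg[OF w w0 wW \<kappa> b i(2)]) (auto simp: G2_def)
  have "(\<integral>x. w x * G ((T ^^ m) x) \<partial>M) = (\<integral>x. w x * G1 ((T ^^ m) x) \<partial>M) - (\<integral>x. w x * G2 ((T ^^ m) x) \<partial>M)"
    unfolding eq right_diff_distrib by (intro Bochner_Integration.integral_diff wi i)
  moreover have "(\<integral>x. G x \<partial>M) = (\<integral>x. G1 x \<partial>M) - (\<integral>x. G2 x \<partial>M)"
    unfolding eq by (intro Bochner_Integration.integral_diff i)
  moreover have "(\<integral>x. \<bar>G x\<bar> \<partial>M) = (\<integral>x. G1 x \<partial>M) + (\<integral>x. G2 x \<partial>M)"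
    unfolding eq(2) by (intro Bochner_Integration.integral_add i)
  ultimately show ?thesis using 1 2 by (simp add: abs_le_iff algebra_simps)
qed

text \<open>The quotient by \<open>r ^ p\<close> fits functions of the first \<open>p\<close>
  symbols: the constant \<open>b / r ^ p\<close> becomes at most \<open>b + Dsum\<close> after
  \<open>p\<close> steps, so \<open>C\<close> and \<open>\<theta>\<close> depend on neither
  \<open>p\<close> nor the density.\<close>

lemma decay_density: assumes "0 \<le> b"
  shows "\<exists>C\<ge>0. \<exists>\<theta>>0. \<theta> < 1 \<and> (\<forall>p w W N G m. w \<in> borel_measurable M \<longrightarrow> (\<forall>x. 0 \<le> w x) \<longrightarrow> (\<forall>x. w x \<le> W) \<longrightarrow>
    (\<integral>x. w x \<partial>M) = 1 \<longrightarrow> N \<in> null_sets M \<longrightarrow>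
    (\<forall>n>p. \<forall>q. \<forall>x\<in>Cyl q n - N. \<forall>y\<in>Cyl q n - N. w x \<le> exp (b * r ^ n / r ^ p) * w y) \<longrightarrow>
    1 \<le> m \<longrightarrow> integrable M G \<longrightarrow>
    \<bar>(\<integral>x. w x * G ((T ^^ (p + m)) x) \<partial>M) - (\<integral>x. G x \<partial>M)\<bar> \<le> C * \<theta> ^ m * (\<integral>x. \<bar>G x\<bar> \<partial>M))"
proof -
  obtain C \<theta> where C: "C \<ge> 0" "\<theta> > 0" "\<theta> < 1"
    and dec: "\<And>\<nu> m B. reg 0 (b + Dsum) \<nu> \<Longrightarrow> \<nu> (space M) = 1 \<Longrightarrow> m \<ge> 1 \<Longrightarrow> B \<in> sets M \<Longrightarrow>
      \<bar>(push ^^ m) \<nu> B - prob B\<bar> \<le> C * \<theta> ^ m * prob B" using decay[of "b + Dsum"] by blast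
  have "\<bar>(\<integral>x. w x * G ((T ^^ (p + m)) x) \<partial>M) - (\<integral>x. G x \<partial>M)\<bar> \<le> C * \<theta> ^ m * (\<integral>x. \<bar>G x\<bar> \<partial>M)"
    if w [measurable]: "w \<in> borel_measurable M" and w0: "\<And>x. 0 \<le> w x" and wW: "\<And>x. w x \<le> W"
      and w1: "(\<integral>x. w x \<partial>M) = 1" and N: "N \<in> null_sets M"
      and ratio: "\<forall>n>p. \<forall>q. \<forall>x\<in>Cyl q n - N. \<forall>y\<in>Cyl q n - N. w x \<le> exp (b * r ^ n / r ^ p) * w y"
      and m: "1 \<le> m" and G: "integrable M G" for p w W N G m
  proof (rule sets_to_functions[OF w w0 wW _ _ G])
    let ?\<nu> = "measure (density M (\<lambda>x. ennreal (w x)))"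
    have int: "integrable M w"
      by (rule bounded_integrable[where B=W]) (use w0 wW in auto)
    have "reg p (b / r ^ p) ?\<nu>"
      by (rule reg_density[OF w w0 int N]) (use ratio in auto)
    then have "reg 0 (r ^ p * (b / r ^ p) + Dsum) ((push ^^ p) ?\<nu>)"
      by (intro reg_push_iter) (simp only: add_0)
    moreover have "r ^ p * (b / r ^ p) = b" using r_pos by simp
    ultimately have reg: "reg 0 (b + Dsum) ((push ^^ p) ?\<nu>)" by simp
    have "emeasure (density M (\<lambda>x. ennreal (w x))) (space M) = (\<integral>\<^sup>+x. ennreal (w x) \<partial>M)"
      by (subst emeasure_density) (auto intro!: nn_integral_cong)
    also have "\<dots> = 1" using nn_integral_eq_integral[OF int] w0 w1 by simp
    finally have 1: "(push ^^ p) ?\<nu> (space M) = 1" by (simp add: push_iter_space measure_def)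
    show "0 \<le> C * \<theta> ^ m" using C by simp
    fix B assume B: "B \<in> sets M"
    have "(push ^^ m) ((push ^^ p) ?\<nu>) B = (push ^^ (p + m)) ?\<nu> B"
      by (simp only: add.commute[of p m] funpow_add o_apply)
    also have "\<dots> = ?\<nu> ((T ^^ (p + m)) -` B \<inter> space M)" by (rule push_iter[OF B])
    finally show "\<bar>?\<nu> ((T ^^ (p + m)) -` B \<inter> space M) - prob B\<bar> \<le> C * \<theta> ^ m * prob B"
      using dec[OF reg 1 m B] by simp
  qed
  then show ?thesis using C by blast
qed

text \<open>The essential form of the norm of \<open>L\<close> in terms of cylinders, with one
  number for both parts. Points are compared within one atom only, so no relation between different
  atoms is imposed.\<close>

definition lip :: "real \<Rightarrow> ('a \<Rightarrow> real) \<Rightarrow> bool" where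
  "lip H h \<longleftrightarrow> h \<in> borel_measurable M \<and>
     (\<exists>N\<in>null_sets M. (\<forall>x\<in>space M - N. \<bar>h x\<bar> \<le> H) \<and>
       (\<forall>n\<ge>1. \<forall>q. \<forall>x\<in>Cyl q n - N. \<forall>y\<in>Cyl q n - N. \<bar>h x - h y\<bar> \<le> H * r ^ n))"

lemma lip_meas: "lip H h \<Longrightarrow> h \<in> borel_measurable M"
  by (simp add: lip_def)

lemma lip_AE: "lip H h \<Longrightarrow> AE x in M. \<bar>h x\<bar> \<le> H"
proof -
  assume "lip H h"
  then obtain N where N: "N \<in> null_sets M" "\<And>x. x \<in> space M - N \<Longrightarrow> \<bar>h x\<bar> \<le> H"
    unfolding lip_def by blast
  show ?thesis using AE_not_in[OF N(1)] AE_space by eventually_elim (use N(2) in auto)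
qed

lemma lip_nonneg: assumes "lip H h" shows "0 \<le> H"
proof -
  have "AE x in M. 0 \<le> H" using lip_AE[OF assms] by (rule eventually_mono) auto
  then show ?thesis by simp
qed

lemma lip_integrable: "lip H h \<Longrightarrow> integrable M h"
  by (rule integrable_const_bound[where B=H]) (use lip_AE lip_meas in auto)

lemma lip_scale: assumes "lip H h" shows "lip (\<bar>a\<bar> * H) (\<lambda>x. a * h x)"
proof -
  obtain N where N: "N \<in> null_sets M" "\<And>x. x \<in> space M - N \<Longrightarrow> \<bar>h x\<bar> \<le> H"
    "\<And>n q x y. n \<ge> 1 \<Longrightarrow> x \<in> Cyl q n - N \<Longrightarrow> y \<in> Cyl q n - N \<Longrightarrow> \<bar>h x - h y\<bar> \<le> H * r ^ n"
    and [measurable]: "h \<in> borel_measurable M"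
    using assms unfolding lip_def by blast
  show ?thesis unfolding lip_def
    by (intro conjI bexI[OF _ N(1)])
       (auto simp: abs_mult right_diff_distrib[symmetric] mult.assoc intro!: mult_left_mono N)
qed

lemma lip_add: assumes "lip H h" "lip H' h'" shows "lip (H + H') (\<lambda>x. h x + h' x)"
proof -
  obtain N where N: "N \<in> null_sets M" "\<And>x. x \<in> space M - N \<Longrightarrow> \<bar>h x\<bar> \<le> H"
    "\<And>n q x y. n \<ge> 1 \<Longrightarrow> x \<in> Cyl q n - N \<Longrightarrow> y \<in> Cyl q n - N \<Longrightarrow> \<bar>h x - h y\<bar> \<le> H * r ^ n"
    and [measurable]: "h \<in> borel_measurable M"
    using assms(1) unfolding lip_def by blast
  obtain N' where N': "N' \<in> null_sets M" "\<And>x. x \<in> space M - N' \<Longrightarrow> \<bar>h' x\<bar> \<le> H'"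
    "\<And>n q x y. n \<ge> 1 \<Longrightarrow> x \<in> Cyl q n - N' \<Longrightarrow> y \<in> Cyl q n - N' \<Longrightarrow> \<bar>h' x - h' y\<bar> \<le> H' * r ^ n"
    and [measurable]: "h' \<in> borel_measurable M"
    using assms(2) unfolding lip_def by blast
  have "\<bar>h x + h' x - (h y + h' y)\<bar> \<le> (H + H') * r ^ n"
    if "n \<ge> 1" "x \<in> Cyl q n - (N \<union> N')" "y \<in> Cyl q n - (N \<union> N')" for n q x y
    using N(3)[of n x q y] N'(3)[of n x q y] that by (auto simp: algebra_simps)
  moreover have "\<bar>h x + h' x\<bar> \<le> H + H'" if "x \<in> space M - (N \<union> N')" for x
    using N(2)[of x] N'(2)[of x] that by auto
  ultimately show ?thesis unfolding lip_def
    using null_sets.Un[OF N(1) N'(1)] by (intro conjI bexI[of _ "N \<union> N'"]) (auto simp del: Un_iff)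
qed

lemma lip_zero: "lip 0 (\<lambda>x. 0)"
  unfolding lip_def by (auto intro!: bexI[of _ "{}"])

lemma lip_sum: "finite A \<Longrightarrow> (\<And>k. k \<in> A \<Longrightarrow> lip (H k) (h k)) \<Longrightarrow> lip (\<Sum>k\<in>A. H k) (\<lambda>x. \<Sum>k\<in>A. h k x)"
  by (induction A rule: finite_induct) (auto intro: lip_add lip_zero)

lemma lip_mono: assumes "lip H h" "H \<le> H'" shows "lip H' h"
proof -
  have "lip (H' - H) (\<lambda>x. 0)" unfolding lip_def using assms(2) r_pos by (auto intro!: bexI[of _ "{}"])
  from lip_add[OF assms(1) this] show ?thesis by simp
qed

text \<open>Since \<open>h\<close> has mean zero, \<open>1 + h / (2 * H)\<close> is a regular probability density.\<close>

lemma decay_lip: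
  "\<exists>C\<ge>0. \<exists>\<theta>>0. \<theta> < 1 \<and> (\<forall>H h G m. lip H h \<longrightarrow> 0 < H \<longrightarrow> (\<integral>x. h x \<partial>M) = 0 \<longrightarrow> integrable M G \<longrightarrow>
    \<bar>\<integral>x. h x * G ((T ^^ m) x) \<partial>M\<bar> \<le> C * H * \<theta> ^ m * (\<integral>x. \<bar>G x\<bar> \<partial>M))"
proof -
  obtain C \<theta> where C: "C \<ge> 0" "\<theta> > 0" "\<theta> < 1"
    and dec: "\<And>p w W N G m. w \<in> borel_measurable M \<Longrightarrow> (\<forall>x. 0 \<le> w x) \<Longrightarrow> (\<forall>x. w x \<le> W) \<Longrightarrow>
    (\<integral>x. w x \<partial>M) = 1 \<Longrightarrow> N \<in> null_sets M \<Longrightarrow>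
    (\<forall>n>p. \<forall>q. \<forall>x\<in>Cyl q n - N. \<forall>y\<in>Cyl q n - N. w x \<le> exp (1 * r ^ n / r ^ p) * w y) \<Longrightarrow>
    1 \<le> m \<Longrightarrow> integrable M G \<Longrightarrow>
    \<bar>(\<integral>x. w x * G ((T ^^ (p + m)) x) \<partial>M) - (\<integral>x. G x \<partial>M)\<bar> \<le> C * \<theta> ^ m * (\<integral>x. \<bar>G x\<bar> \<partial>M)"
    using decay_density[OF zero_le_one] by blast
  have "\<bar>\<integral>x. h x * G ((T ^^ m) x) \<partial>M\<bar> \<le> (2 * C + 1) * H * \<theta> ^ m * (\<integral>x. \<bar>G x\<bar> \<partial>M)"
    if lip: "lip H h" and H: "0 < H" and h0: "(\<integral>x. h x \<partial>M) = 0" and G: "integrable M G" for H h G m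
  proof -
    obtain N where N: "N \<in> null_sets M" "\<And>x. x \<in> space M - N \<Longrightarrow> \<bar>h x\<bar> \<le> H"
      "\<And>n q x y. n \<ge> 1 \<Longrightarrow> x \<in> Cyl q n - N \<Longrightarrow> y \<in> Cyl q n - N \<Longrightarrow> \<bar>h x - h y\<bar> \<le> H * r ^ n"
      and [measurable]: "h \<in> borel_measurable M"
      using lip unfolding lip_def by blast
    have [measurable]: "G \<in> borel_measurable M" using G by simp
    \<comment> \<open>\<open>decay_density\<close> asks for a density that is nonnegative and
      bounded everywhere, while \<open>h\<close> is bounded off a null set only; truncation changes
      nothing almost everywhere.\<close>
    define h' where "h' x = max (- H) (min H (h x))" for x
    have [measurable]: "h' \<in> borel_measurable M" unfolding h'_def[abs_def] by measurable
    have b: "\<bar>h' x\<bar> \<le> H" for x using H by (auto simp: h'_def)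
    have eqN: "h' x = h x" if "x \<in> space M - N" for x using N(2)[OF that] by (auto simp: h'_def)
    have AE: "AE x in M. h' x = h x" using AE_not_in[OF N(1)] AE_space by eventually_elim (use eqN in auto)
    have ih': "integrable M h'" by (rule bounded_integrable[where B=H]) (use b in auto)
    have h'0: "(\<integral>x. h' x \<partial>M) = 0"
      unfolding h0[symmetric] by (rule integral_cong_AE) (use AE in auto)
    have ih'G: "integrable M (\<lambda>x. h' x * G ((T ^^ m) x))"
      by (rule integrable_bounded_mult[OF _ b integrable_Tn[OF G]]) simp
    have eq: "(\<integral>x. h x * G ((T ^^ m) x) \<partial>M) = (\<integral>x. h' x * G ((T ^^ m) x) \<partial>M)"
      by (rule integral_cong_AE) (use AE in \<open>auto elim!: eventually_mono\<close>)
    have nn: "0 \<le> (\<integral>x. \<bar>G x\<bar> \<partial>M)" by simp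
    show ?thesis
    \<comment> \<open>The decay of densities starts at one step; for \<open>m = 0\<close> the
      supremum bound suffices and accounts for the \<open>+ 1\<close> in the constant.\<close>
    proof (cases "m = 0")
      case True
      have "integrable M (\<lambda>x. \<bar>h' x\<bar> * \<bar>G x\<bar>)"
        using integrable_abs[OF ih'G] True by (simp add: abs_mult)
      then have "\<bar>\<integral>x. h' x * G x \<partial>M\<bar> \<le> (\<integral>x. H * \<bar>G x\<bar> \<partial>M)"
        by (intro order_trans[OF integral_abs_bound] integral_mono)
           (use G b in \<open>auto simp: abs_mult intro!: mult_right_mono\<close>)
      also have "\<dots> = H * (\<integral>x. \<bar>G x\<bar> \<partial>M)" by simp
      also have "\<dots> \<le> (2 * C + 1) * H * (\<integral>x. \<bar>G x\<bar> \<partial>M)" using C H nn by (intro mult_right_mono) auto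
      finally show ?thesis unfolding eq using True by simp
    next
      case False
      define w where "w x = 1 + h' x / (2 * H)" for x
      have w: "1 / 2 \<le> w x" "w x \<le> 3 / 2" for x
        using b[of x] H by (auto simp: w_def field_simps abs_le_iff)
      have wm: "w \<in> borel_measurable M" unfolding w_def[abs_def] by measurable
      have w0: "\<forall>x. 0 \<le> w x" using w(1) by (auto intro: order_trans[of 0 "1 / 2"])
      have w1: "(\<integral>x. w x \<partial>M) = 1" using ih' h'0 by (simp add: w_def prob_space)
      have "w x \<le> exp (1 * r ^ n / r ^ 0) * w y"
        if "n > 0" "x \<in> Cyl q n - N" "y \<in> Cyl q n - N" for n q x y
      proof -
        have "x \<in> space M - N" "y \<in> space M - N" using that sets.sets_into_space[OF Cyl_sets] by auto
        then have "\<bar>h' x - h' y\<bar> \<le> H * r ^ n" using eqN N(3)[of n x q y] that by simp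
        then have "(h' x - h' y) / (2 * H) \<le> (H * r ^ n) / (2 * H)" using H by (intro divide_right_mono) auto
        then have "w x - w y \<le> r ^ n / 2" using H by (simp add: w_def diff_divide_distrib)
        also have "\<dots> \<le> r ^ n * w y" using w(1)[of y] r_pos by (simp add: field_simps)
        finally have "w x \<le> (1 + r ^ n) * w y" by (simp add: algebra_simps)
        also have "\<dots> \<le> exp (r ^ n) * w y"
          using w(1)[of y] by (intro mult_right_mono exp_ge_add_one_self) auto
        finally show ?thesis by simp
      qed
      then have d: "\<bar>(\<integral>x. w x * G ((T ^^ (0 + m)) x) \<partial>M) - (\<integral>x. G x \<partial>M)\<bar> \<le> C * \<theta> ^ m * (\<integral>x. \<bar>G x\<bar> \<partial>M)"
        using w False w1 G N(1)
        by (intro dec[of w "3/2" N 0] w0 wm) auto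
      have "(\<integral>x. w x * G ((T ^^ (0 + m)) x) \<partial>M) = (\<integral>x. G ((T ^^ m) x) + (h' x * G ((T ^^ m) x)) / (2 * H) \<partial>M)"
        by (intro Bochner_Integration.integral_cong) (auto simp: w_def algebra_simps)
      also have "\<dots> = (\<integral>x. G ((T ^^ m) x) \<partial>M) + (\<integral>x. h' x * G ((T ^^ m) x) \<partial>M) / (2 * H)"
        using ih'G integrable_Tn[OF G, of m] by simp
      also have "(\<integral>x. G ((T ^^ m) x) \<partial>M) = (\<integral>x. G x \<partial>M)" by (rule integral_Tn) simp
      finally have "\<bar>(\<integral>x. h' x * G ((T ^^ m) x) \<partial>M) / (2 * H)\<bar> \<le> C * \<theta> ^ m * (\<integral>x. \<bar>G x\<bar> \<partial>M)" using d by simp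
      then have "\<bar>\<integral>x. h' x * G ((T ^^ m) x) \<partial>M\<bar> \<le> 2 * C * H * \<theta> ^ m * (\<integral>x. \<bar>G x\<bar> \<partial>M)"
        using H by (simp add: field_simps)
      also have "\<dots> \<le> (2 * C + 1) * H * \<theta> ^ m * (\<integral>x. \<bar>G x\<bar> \<partial>M)"
        using C H nn by (intro mult_right_mono) auto
      finally show ?thesis unfolding eq .
    qed
  qed
  then show ?thesis using C by (intro exI[of _ "2 * C + 1"]) auto
qed

section \<open>Decorrelation of oscillating functions of Birkhoff sums\<close>

definition bsum :: "('a \<Rightarrow> real) \<Rightarrow> nat \<Rightarrow> 'a \<Rightarrow> real" where
  "bsum h n x = (\<Sum>j<n. h ((T ^^ j) x))"

lemma bsum_meas [measurable]: "h \<in> borel_measurable M \<Longrightarrow> bsum h n \<in> borel_measurable M"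
  unfolding bsum_def[abs_def] by (intro borel_measurable_sum measurable_compose[OF Tn_meas])

text \<open>At time \<open>j\<close> the two orbits still share \<open>n - j\<close> symbols, so the
  differences form a geometric series dominated by its last terms. The bound does not grow with
  \<open>p\<close> apart from the factor \<open>1 / r ^ p\<close> that \<open>decay_density\<close>
  allows.\<close>

lemma bsum_lip: assumes "lip H h"
  shows "\<exists>N\<in>null_sets M. \<forall>n>p. \<forall>q. \<forall>x\<in>Cyl q n - N. \<forall>y\<in>Cyl q n - N.
    \<bar>bsum h p x - bsum h p y\<bar> \<le> H / (1 - r) * (r ^ n / r ^ p)"
proof -
  obtain N where N: "N \<in> null_sets M" 
      "\<And>n q x y. n \<ge> 1 \<Longrightarrow> x \<in> Cyl q n - N \<Longrightarrow> y \<in> Cyl q n - N \<Longrightarrow> \<bar>h x - h y\<bar> \<le> H * r ^ n"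
      and [measurable]: "h \<in> borel_measurable M"
      using assms unfolding lip_def by blast
  have H: "0 \<le> H" by (rule lip_nonneg[OF assms])
  \<comment> \<open>The Lipschitz bound is used at all points \<open>(T ^^ j) x\<close>, so every
    preimage of the exceptional set is removed; invariance keeps the union null.\<close>
  define N' where "N' = (\<Union>j. (T ^^ j) -` N \<inter> space M)"
  have "(T ^^ j) -` N \<inter> space M \<in> null_sets M" for j
  proof -
    have "N \<in> sets M" using N(1) by auto
    moreover have "prob N = 0" using N(1) by (simp add: null_sets_def measure_def)
    ultimately show ?thesis by (simp add: null_sets_def emeasure_eq_measure Tn_pres_prob)
  qed
  then have N': "N' \<in> null_sets M" unfolding N'_def by (rule null_sets_UN)
  have "\<bar>bsum h p x - bsum h p y\<bar> \<le> H / (1 - r) * (r ^ n / r ^ p)"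
    if n: "p < n" and x: "x \<in> Cyl q n - N'" and y: "y \<in> Cyl q n - N'" for n q x y
  proof -
    have "\<bar>h ((T ^^ j) x) - h ((T ^^ j) y)\<bar> \<le> H * r ^ (n - j)" if j: "j < p" for j
    proof (rule N(2))
      have *: "(T ^^ j) z \<in> Cyl (\<lambda>k. q (k + j)) (n - j) - N" if "z \<in> Cyl q n - N'" for z
      proof -
        have zX: "z \<in> X" and zk: "\<And>k. k < n \<Longrightarrow> (T ^^ k) z \<in> P (q k)" and zN: "z \<notin> N'"
          using that by (auto simp: cyl_def)
        have "(T ^^ k) ((T ^^ j) z) \<in> P (q (k + j))" if "k < n - j" for k
          using zk[of "k + j"] that by (simp add: funpow_add)
        moreover have "(T ^^ j) z \<notin> N"
          using zN zX sets.sets_into_space[OF X_sets] by (auto simp: N'_def)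
        ultimately show ?thesis using Tn_X[OF zX] by (auto simp: cyl_def)
      qed
      show "(T ^^ j) x \<in> Cyl (\<lambda>k. q (k + j)) (n - j) - N" "(T ^^ j) y \<in> Cyl (\<lambda>k. q (k + j)) (n - j) - N"
        using * x y by auto
    qed (use n j in auto)
    then have "\<bar>bsum h p x - bsum h p y\<bar> \<le> (\<Sum>j<p. H * r ^ (n - j))"
      unfolding bsum_def sum_subtractf[symmetric] by (intro order_trans[OF sum_abs] sum_mono) auto
    also have "\<dots> \<le> (\<Sum>j<p. H * (r ^ (n - p) * r ^ (p - Suc j)))"
    proof (intro sum_mono mult_left_mono H)
      fix j assume "j \<in> {..<p}"
      then have "n - j = Suc ((n - p) + (p - Suc j))" using n by auto
      then have "r ^ (n - j) = r * (r ^ (n - p) * r ^ (p - Suc j))" by (simp only: power_Suc power_add)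
      also have "\<dots> \<le> 1 * (r ^ (n - p) * r ^ (p - Suc j))"
        using r_pos r_less by (intro mult_right_mono) auto
      finally show "r ^ (n - j) \<le> r ^ (n - p) * r ^ (p - Suc j)" by simp
    qed
    also have "\<dots> = H * r ^ (n - p) * (\<Sum>j<p. r ^ (p - Suc j))" by (simp add: sum_distrib_left mult.assoc)
    also have "(\<Sum>j<p. r ^ (p - Suc j)) = (\<Sum>j<p. r ^ j)" by (rule sum.nat_diff_reindex)
    also have "\<dots> = (1 - r ^ p) / (1 - r)" using r_less by (simp add: sum_gp_strict)
    also have "H * r ^ (n - p) * ((1 - r ^ p) / (1 - r)) \<le> H * r ^ (n - p) * (1 / (1 - r))"
      using H r_pos r_less by (intro mult_left_mono divide_right_mono) auto
    also have "r ^ (n - p) = r ^ n / r ^ p" using n r_pos by (simp add: power_diff)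
    finally show ?thesis by (simp add: field_simps)
  qed
  then show ?thesis using N' by blast
qed

text \<open>\<open>\<psi>\<close> will be the sine or the cosine.\<close>

lemma decorrelation_real: assumes lip: "lip H h" and b: "0 \<le> b"
  shows "\<exists>C\<ge>0. \<exists>\<theta>>0. \<theta> < 1 \<and> (\<forall>p s \<psi> G m. \<bar>s\<bar> * H / (1 - r) \<le> b \<longrightarrow> \<psi> \<in> borel_measurable borel \<longrightarrow>
    (\<forall>x. \<bar>\<psi> x\<bar> \<le> 1) \<longrightarrow> (\<forall>x y. \<bar>\<psi> x - \<psi> y\<bar> \<le> \<bar>x - y\<bar>) \<longrightarrow> 1 \<le> m \<longrightarrow>
    G \<in> borel_measurable M \<longrightarrow> (\<forall>x. \<bar>G x\<bar> \<le> 1) \<longrightarrow>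
    \<bar>(\<integral>x. \<psi> (s * bsum h p x) * G ((T ^^ (p + m)) x) \<partial>M) - (\<integral>x. \<psi> (s * bsum h p x) \<partial>M) * (\<integral>x. G x \<partial>M)\<bar> \<le> C * \<theta> ^ m)"
proof -
  have [measurable]: "h \<in> borel_measurable M" by (rule lip_meas[OF lip])
  obtain C \<theta> where C: "C \<ge> 0" "\<theta> > 0" "\<theta> < 1"
    and dec: "\<And>p w W N G m. w \<in> borel_measurable M \<Longrightarrow> (\<forall>x. 0 \<le> w x) \<Longrightarrow> (\<forall>x. w x \<le> W) \<Longrightarrow>
    (\<integral>x. w x \<partial>M) = 1 \<Longrightarrow> N \<in> null_sets M \<Longrightarrow>
    (\<forall>n>p. \<forall>q. \<forall>x\<in>Cyl q n - N. \<forall>y\<in>Cyl q n - N. w x \<le> exp (b * r ^ n / r ^ p) * w y) \<Longrightarrow>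
    1 \<le> m \<Longrightarrow> integrable M G \<Longrightarrow>
    \<bar>(\<integral>x. w x * G ((T ^^ (p + m)) x) \<partial>M) - (\<integral>x. G x \<partial>M)\<bar> \<le> C * \<theta> ^ m * (\<integral>x. \<bar>G x\<bar> \<partial>M)"
    using decay_density[OF b] by blast
  have "\<bar>(\<integral>x. \<psi> (s * bsum h p x) * G ((T ^^ (p + m)) x) \<partial>M) - (\<integral>x. \<psi> (s * bsum h p x) \<partial>M) * (\<integral>x. G x \<partial>M)\<bar> \<le> 3 * C * \<theta> ^ m"
    if s: "\<bar>s\<bar> * H / (1 - r) \<le> b" and \<psi>m [measurable]: "\<psi> \<in> borel_measurable borel"
      and \<psi>1: "\<And>x. \<bar>\<psi> x\<bar> \<le> 1" and \<psi>l: "\<And>x y. \<bar>\<psi> x - \<psi> y\<bar> \<le> \<bar>x - y\<bar>" and m: "1 \<le> m"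
      and G [measurable]: "G \<in> borel_measurable M" and G1: "\<And>x. \<bar>G x\<bar> \<le> 1" for p s \<psi> G m
  proof -
    define u where "u x = \<psi> (s * bsum h p x)" for x
    have [measurable]: "u \<in> borel_measurable M" unfolding u_def[abs_def] by measurable
    have u1: "\<bar>u x\<bar> \<le> 1" for x by (simp add: u_def \<psi>1)
    \<comment> \<open>Since \<open>u\<close> takes values between -1 and 1, the function
      \<open>2 + u\<close> lies between 1 and 3: dividing by its integral \<open>Z\<close> gives a
      probability density whose oscillation relative to itself is controlled by that of
      \<open>u\<close>.\<close>
    define Z where "Z = 2 + (\<integral>x. u x \<partial>M)"
    have iu: "integrable M u" by (rule bounded_integrable[where B=1]) (use u1 in auto)
    have "\<bar>\<integral>x. u x \<partial>M\<bar> \<le> (\<integral>x. 1 \<partial>M)"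
      by (intro order_trans[OF integral_abs_bound] integral_mono) (use iu u1 in auto)
    then have Z: "1 \<le> Z" "Z \<le> 3" by (auto simp: Z_def prob_space abs_le_iff)
    define w where "w x = (2 + u x) / Z" for x
    have [measurable]: "w \<in> borel_measurable M" unfolding w_def[abs_def] by measurable
    have w1: "(\<integral>x. w x \<partial>M) = 1" using iu Z by (simp add: w_def prob_space Z_def[symmetric])
    have u2: "1 \<le> 2 + u x" "2 + u x \<le> 3" for x using u1[of x] by auto
    obtain N where N: "N \<in> null_sets M" "\<And>n q x y. n > p \<Longrightarrow> x \<in> Cyl q n - N \<Longrightarrow> y \<in> Cyl q n - N \<Longrightarrow>
      \<bar>bsum h p x - bsum h p y\<bar> \<le> H / (1 - r) * (r ^ n / r ^ p)" using bsum_lip[OF lip, of p] by blast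
    have ratio: "w x \<le> exp (b * r ^ n / r ^ p) * w y"
      if "n > p" "x \<in> Cyl q n - N" "y \<in> Cyl q n - N" for n q x y
    proof -
      have rr: "0 \<le> r ^ n / r ^ p" using r_pos by simp
      have "u x - u y \<le> \<bar>s * bsum h p x - s * bsum h p y\<bar>"
        using \<psi>l[of "s * bsum h p x" "s * bsum h p y"] by (simp add: u_def)
      also have "\<dots> = \<bar>s\<bar> * \<bar>bsum h p x - bsum h p y\<bar>" by (simp add: abs_mult right_diff_distrib[symmetric])
      also have "\<dots> \<le> \<bar>s\<bar> * (H / (1 - r) * (r ^ n / r ^ p))"
        by (intro mult_left_mono N(2)[OF that]) auto
      also have "\<dots> = (\<bar>s\<bar> * H / (1 - r)) * (r ^ n / r ^ p)" by simp
      also have "\<dots> \<le> b * (r ^ n / r ^ p)" by (intro mult_right_mono s rr)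
      also have "\<dots> \<le> b * (r ^ n / r ^ p) * (2 + u y)"
        using mult_left_mono[OF u2(1)[of y] mult_nonneg_nonneg[OF b rr]] by (simp only: mult_1_right)
      finally have "2 + u x \<le> (1 + b * (r ^ n / r ^ p)) * (2 + u y)" by (simp add: algebra_simps)
      also have "\<dots> \<le> exp (b * (r ^ n / r ^ p)) * (2 + u y)"
        using u2(1)[of y] by (intro mult_right_mono exp_ge_add_one_self) auto
      finally show ?thesis using Z by (simp add: w_def divide_right_mono)
    qed
    have iG: "integrable M G" by (rule bounded_integrable[where B=1]) (use G1 in auto)
    have iuG: "integrable M (\<lambda>x. u x * G ((T ^^ (p + m)) x))"
      by (rule bounded_integrable[where B=1]) (use G1 u1 in \<open>auto simp: abs_mult intro!: mult_le_one\<close>)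
    have "\<bar>(\<integral>x. w x * G ((T ^^ (p + m)) x) \<partial>M) - (\<integral>x. G x \<partial>M)\<bar> \<le> C * \<theta> ^ m * (\<integral>x. \<bar>G x\<bar> \<partial>M)"
    proof (rule dec[of w "3 / Z" N])
      show "\<forall>x. 0 \<le> w x" using u2(1) Z by (auto simp: w_def intro!: divide_nonneg_pos order_trans[OF _ u2(1)])
      show "\<forall>x. w x \<le> 3 / Z" using u2(2) Z by (auto simp: w_def intro!: divide_right_mono)
    qed (use w1 N(1) ratio m iG in auto)
    also have "\<dots> \<le> C * \<theta> ^ m * (\<integral>x. 1 \<partial>M)"
      by (intro mult_left_mono integral_mono) (use C iG G1 in auto)
    finally have d: "\<bar>(\<integral>x. w x * G ((T ^^ (p + m)) x) \<partial>M) - (\<integral>x. G x \<partial>M)\<bar> \<le> C * \<theta> ^ m" by (simp add: prob_space)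
    have "(\<integral>x. w x * G ((T ^^ (p + m)) x) \<partial>M) = (\<integral>x. (2 * G ((T ^^ (p + m)) x) + u x * G ((T ^^ (p + m)) x)) / Z \<partial>M)"
      by (intro Bochner_Integration.integral_cong) (auto simp: w_def algebra_simps)
    also have "\<dots> = (2 * (\<integral>x. G ((T ^^ (p + m)) x) \<partial>M) + (\<integral>x. u x * G ((T ^^ (p + m)) x) \<partial>M)) / Z"
      using iuG integrable_Tn[OF iG, of "p + m"] by simp
    also have "(\<integral>x. G ((T ^^ (p + m)) x) \<partial>M) = (\<integral>x. G x \<partial>M)" by (rule integral_Tn) simp
    finally have "(\<integral>x. u x * G ((T ^^ (p + m)) x) \<partial>M) - (\<integral>x. u x \<partial>M) * (\<integral>x. G x \<partial>M) =
        Z * ((\<integral>x. w x * G ((T ^^ (p + m)) x) \<partial>M) - (\<integral>x. G x \<partial>M))"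
      using Z by (simp add: field_simps) (simp add: Z_def algebra_simps)
    also have "\<bar>\<dots>\<bar> \<le> 3 * (C * \<theta> ^ m)"
      unfolding abs_mult using Z d by (intro mult_mono) auto
    finally show ?thesis by (simp add: u_def)
  qed
  then show ?thesis using C by (intro exI[of _ "3 * C"]) auto
qed

end

section \<open>Variances of Birkhoff sums\<close>

lemma cesaro_real:
  fixes d :: "nat \<Rightarrow> real"
  assumes "d \<longlonglongrightarrow> L"
  shows "(\<lambda>N. (\<Sum>n<N. d n) / real N) \<longlonglongrightarrow> L"
proof (rule LIMSEQ_I)
  fix e :: real assume e: "0 < e"
  obtain N0 where N0: "\<And>n. n \<ge> N0 \<Longrightarrow> \<bar>d n - L\<bar> < e / 2"
    using LIMSEQ_D[OF assms, of "e / 2"] e by auto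
  define A where "A = (\<Sum>n<N0. \<bar>d n - L\<bar>)"
  have A: "0 \<le> A" by (simp add: A_def sum_nonneg)
  obtain N1 :: nat where N1: "2 * A / e < real N1" using reals_Archimedean2 by blast
  have "\<bar>(\<Sum>n<N. d n) / real N - L\<bar> < e" if N: "N \<ge> Suc (max N0 N1)" for N
  proof -
    have N': "real N > 0" "N0 \<le> N" using N by auto
    have "(\<Sum>n<N. \<bar>d n - L\<bar>) = A + (\<Sum>n=N0..<N. \<bar>d n - L\<bar>)"
      unfolding A_def lessThan_atLeast0 using N' by (intro sum.atLeastLessThan_concat[symmetric]) auto
    also have "(\<Sum>n=N0..<N. \<bar>d n - L\<bar>) \<le> (\<Sum>n=N0..<N. e / 2)"
      by (intro sum_mono) (use N0 in \<open>auto intro: less_imp_le\<close>)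
    also have "\<dots> \<le> real N * (e / 2)" using e by simp
    finally have "(\<Sum>n<N. \<bar>d n - L\<bar>) \<le> A + real N * (e / 2)" by simp
    moreover have "A < real N * (e / 2)"
    proof -
      have "2 * A / e < real N" using N1 N by auto
      then show ?thesis using e by (simp add: field_simps)
    qed
    ultimately have "(\<Sum>n<N. \<bar>d n - L\<bar>) < real N * e" by simp
    then have "\<bar>\<Sum>n<N. d n - L\<bar> < e * real N" by (intro le_less_trans[OF sum_abs]) (simp add: mult.commute)
    then have "\<bar>\<Sum>n<N. d n - L\<bar> / real N < e" using N' by (simp add: pos_divide_less_eq)
    moreover have "(\<Sum>n<N. d n) / real N - L = (\<Sum>n<N. d n - L) / real N"
      using N' by (simp add: sum_subtractf field_simps)
    ultimately show ?thesis by simp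
  qed
  then show "\<exists>no. \<forall>n\<ge>no. norm ((\<Sum>n<n. d n) / real n - L) < e" by (metis real_norm_def)
qed

text \<open>The indices on either side of \<open>i\<close> contribute at most a full geometric
  series each, whatever the finite set \<open>J\<close> is.\<close>

lemma sum_power_dist_le:
  fixes \<theta> :: real
  assumes "0 < \<theta>" "\<theta> < 1" "finite J"
  shows "(\<Sum>j\<in>J. \<theta> ^ (if i \<le> j then j - i else i - j)) \<le> 2 / (1 - \<theta>)"
proof -
  have geo: "(\<Sum>k\<in>S. \<theta> ^ k) \<le> 1 / (1 - \<theta>)" if "finite S" for S :: "nat set"
  proof -
    have "(\<Sum>k\<in>S. \<theta> ^ k) \<le> (\<Sum>k. \<theta> ^ k)"
      by (rule sum_le_suminf) (use assms that in \<open>auto intro: summable_geometric\<close>)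
    then show ?thesis using assms by (simp add: suminf_geometric)
  qed
  let ?A = "{j\<in>J. i \<le> j}" and ?B = "{j\<in>J. \<not> i \<le> j}"
  have "(\<Sum>j\<in>J. \<theta> ^ (if i \<le> j then j - i else i - j)) = (\<Sum>j\<in>?A. \<theta> ^ (j - i)) + (\<Sum>j\<in>?B. \<theta> ^ (i - j))"
    using sum.If_cases[OF assms(3), of "\<lambda>j. i \<le> j" "\<lambda>j. \<theta> ^ (j - i)" "\<lambda>j. \<theta> ^ (i - j)"]
    by (simp add: if_distrib[of "\<lambda>k. \<theta> ^ k"] Int_def Collect_neg_eq[symmetric])
  also have "(\<Sum>j\<in>?A. \<theta> ^ (j - i)) = (\<Sum>k\<in>(\<lambda>j. j - i) ` ?A. \<theta> ^ k)"
    by (subst sum.reindex) (auto intro!: inj_onI)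
  also have "(\<Sum>j\<in>?B. \<theta> ^ (i - j)) = (\<Sum>k\<in>(\<lambda>j. i - j) ` ?B. \<theta> ^ k)"
    by (subst sum.reindex) (auto intro!: inj_onI)
  also have "(\<Sum>k\<in>(\<lambda>j. j - i) ` ?A. \<theta> ^ k) + (\<Sum>k\<in>(\<lambda>j. i - j) ` ?B. \<theta> ^ k) \<le> 1 / (1 - \<theta>) + 1 / (1 - \<theta>)"
    by (intro add_mono geo) (use assms in auto)
  finally show ?thesis by simp
qed

lemma cmod_iexp_diff_le: "cmod (iexp a - iexp b) \<le> \<bar>a - b\<bar>"
proof -
  have "iexp a - iexp b = iexp b * (iexp (a - b) - 1)"
    by (simp add: algebra_simps exp_diff)
  then have "cmod (iexp a - iexp b) = cmod (iexp (a - b) - 1)" by (simp add: norm_mult)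
  also have "\<dots> \<le> \<bar>a - b\<bar>" using iexp_approx1[of "a - b" 0] by simp
  finally show ?thesis .
qed

lemma (in prob_space) cmod_expectation_iexp_diff:
  assumes [measurable]: "f \<in> borel_measurable M" "g \<in> borel_measurable M" and "integrable M (\<lambda>x. f x - g x)"
  shows "cmod ((\<integral>x. iexp (s * f x) \<partial>M) - (\<integral>x. iexp (s * g x) \<partial>M)) \<le> \<bar>s\<bar> * (\<integral>x. \<bar>f x - g x\<bar> \<partial>M)"
proof -
  have i: "integrable M (\<lambda>x. iexp (s * u x))" if [measurable]: "u \<in> borel_measurable M" for u
    by (rule bounded_integrable[where B=1]) auto
  have "(\<integral>x. iexp (s * f x) \<partial>M) - (\<integral>x. iexp (s * g x) \<partial>M) = (\<integral>x. iexp (s * f x) - iexp (s * g x) \<partial>M)"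
    by (rule Bochner_Integration.integral_diff[symmetric]; rule i; fact)
  also have "cmod \<dots> \<le> (\<integral>x. cmod (iexp (s * f x) - iexp (s * g x)) \<partial>M)" by (rule integral_norm_bound)
  also have "\<dots> \<le> (\<integral>x. \<bar>s\<bar> * \<bar>f x - g x\<bar> \<partial>M)"
  proof (rule integral_mono)
    show "integrable M (\<lambda>x. cmod (iexp (s * f x) - iexp (s * g x)))"
      by (intro integrable_norm Bochner_Integration.integrable_diff i) fact+
    show "cmod (iexp (s * f x) - iexp (s * g x)) \<le> \<bar>s\<bar> * \<bar>f x - g x\<bar>" for x
      using cmod_iexp_diff_le[of "s * f x" "s * g x"] by (simp add: right_diff_distrib[symmetric] abs_mult)
  qed (use assms in auto)
  finally show ?thesis by simp
qed

text \<open>Cauchy-Schwarz against the constant 1, obtained from the nonnegativity of the variance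
  of \<open>\<bar>f\<bar>\<close>.\<close>

lemma (in prob_space) abs_expectation_le_sqrt:
  fixes f :: "'a \<Rightarrow> real"
  assumes [measurable]: "f \<in> borel_measurable M" and f2: "integrable M (\<lambda>x. (f x)\<^sup>2)"
  shows "integrable M f" "(\<integral>x. \<bar>f x\<bar> \<partial>M) \<le> sqrt (\<integral>x. (f x)\<^sup>2 \<partial>M)"
proof -
  show i: "integrable M f"
    by (rule square_integrable_imp_integrable) (use f2 in auto)
  have "0 \<le> variance (\<lambda>x. \<bar>f x\<bar>)" by (rule variance_positive)
  also have "\<dots> = (\<integral>x. (f x)\<^sup>2 \<partial>M) - (\<integral>x. \<bar>f x\<bar> \<partial>M)\<^sup>2"
    using i f2 by (subst variance_eq) auto
  finally show "(\<integral>x. \<bar>f x\<bar> \<partial>M) \<le> sqrt (\<integral>x. (f x)\<^sup>2 \<partial>M)"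
    by (intro real_le_rsqrt) auto
qed

context markov_system
begin

section \<open>Covariances and variances of stationary sums\<close>

lemma AE_Tn: "AE x in M. Q x \<Longrightarrow> AE x in M. Q ((T ^^ n) x)"
  using AE_distrD[OF Tn_meas[of n], of Q] unfolding Tn_pres .

lemma compose_Tn_meas [measurable]: "h \<in> borel_measurable M \<Longrightarrow> (\<lambda>x. h ((T ^^ n) x)) \<in> borel_measurable M"
  by (rule measurable_compose[OF Tn_meas])

lemma lip_mult_integrable: assumes "lip H h"
  shows "integrable M (\<lambda>x. h ((T ^^ i) x) * h ((T ^^ j) x))"
proof (rule integrable_const_bound[where B="H * H"])
  have [measurable]: "h \<in> borel_measurable M" by (rule lip_meas[OF assms])
  have "AE x in M. \<bar>h ((T ^^ i) x)\<bar> \<le> H" "AE x in M. \<bar>h ((T ^^ j) x)\<bar> \<le> H"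
    by (auto intro: AE_Tn lip_AE[OF assms])
  then show "AE x in M. norm (h ((T ^^ i) x) * h ((T ^^ j) x)) \<le> H * H"
    by eventually_elim (use lip_nonneg[OF assms] in \<open>auto simp: abs_mult intro!: mult_mono\<close>)
  show "(\<lambda>x. h ((T ^^ i) x) * h ((T ^^ j) x)) \<in> borel_measurable M" by measurable
qed

definition cov :: "('a \<Rightarrow> real) \<Rightarrow> nat \<Rightarrow> real" where
  "cov h k = (\<integral>x. h x * h ((T ^^ k) x) \<partial>M)"

lemma integral_pair: assumes [measurable]: "h \<in> borel_measurable M"
  shows "(\<integral>x. h ((T ^^ i) x) * h ((T ^^ j) x) \<partial>M) = cov h (if i \<le> j then j - i else i - j)"
proof -
  have *: "(\<integral>x. h ((T ^^ i) x) * h ((T ^^ (i + k)) x) \<partial>M) = cov h k" for i k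
  proof -
    have "(\<lambda>x. h ((T ^^ i) x) * h ((T ^^ (i + k)) x)) = (\<lambda>x. (\<lambda>y. h y * h ((T ^^ k) y)) ((T ^^ i) x))"
      by (auto simp: funpow_add add.commute[of i])
    then show ?thesis using integral_Tn[of "\<lambda>y. h y * h ((T ^^ k) y)" i] by (simp add: cov_def)
  qed
  show ?thesis
  proof (cases "i \<le> j")
    case True then show ?thesis using *[of i "j - i"] by simp
  next
    case False
    then have "i = j + (i - j)" by simp
    then show ?thesis using *[of j "i - j"] False by (simp add: mult.commute)
  qed
qed

lemma integral_sum_square: assumes lip: "lip H h" and J: "finite J"
  shows "integrable M (\<lambda>x. (\<Sum>j\<in>J. h ((T ^^ j) x))\<^sup>2)"
    and "(\<integral>x. (\<Sum>j\<in>J. h ((T ^^ j) x))\<^sup>2 \<partial>M) = (\<Sum>i\<in>J. \<Sum>j\<in>J. cov h (if i \<le> j then j - i else i - j))"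
proof -
  have eq: "(\<lambda>x. (\<Sum>j\<in>J. h ((T ^^ j) x))\<^sup>2) = (\<lambda>x. \<Sum>i\<in>J. \<Sum>j\<in>J. h ((T ^^ i) x) * h ((T ^^ j) x))"
    by (simp add: power2_eq_square sum_product)
  show "integrable M (\<lambda>x. (\<Sum>j\<in>J. h ((T ^^ j) x))\<^sup>2)"
    unfolding eq by (intro Bochner_Integration.integrable_sum lip_mult_integrable[OF lip])
  show "(\<integral>x. (\<Sum>j\<in>J. h ((T ^^ j) x))\<^sup>2 \<partial>M) = (\<Sum>i\<in>J. \<Sum>j\<in>J. cov h (if i \<le> j then j - i else i - j))"
    unfolding eq integral_pair[OF lip_meas[OF lip], symmetric]
    by (simp add: Bochner_Integration.integral_sum lip_mult_integrable[OF lip] Bochner_Integration.integrable_sum)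
qed

text \<open>Decay of correlations with \<open>G = h\<close>. The Lipschitz constant enters once and
  the \<open>L^1\<close> norm once; the latter is the factor that becomes small along the
  series.\<close>

lemma cov_bound:
  "\<exists>C\<ge>0. \<exists>\<theta>>0. \<theta> < 1 \<and> (\<forall>H h k. lip H h \<longrightarrow> 0 < H \<longrightarrow> (\<integral>x. h x \<partial>M) = 0 \<longrightarrow>
     \<bar>cov h k\<bar> \<le> C * H * (\<integral>x. \<bar>h x\<bar> \<partial>M) * \<theta> ^ k)"
proof -
  obtain C \<theta> where C: "C \<ge> 0" "\<theta> > 0" "\<theta> < 1"
    and dec: "\<And>H h G m. lip H h \<Longrightarrow> 0 < H \<Longrightarrow> (\<integral>x. h x \<partial>M) = 0 \<Longrightarrow> integrable M G \<Longrightarrow>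
    \<bar>\<integral>x. h x * G ((T ^^ m) x) \<partial>M\<bar> \<le> C * H * \<theta> ^ m * (\<integral>x. \<bar>G x\<bar> \<partial>M)"
    using decay_lip by blast
  have "\<bar>cov h k\<bar> \<le> C * H * (\<integral>x. \<bar>h x\<bar> \<partial>M) * \<theta> ^ k" if "lip H h" "0 < H" "(\<integral>x. h x \<partial>M) = 0" for H h k
    using dec[OF that lip_integrable[OF that(1)], of k] by (simp add: cov_def mult_ac)
  then show ?thesis using C by blast
qed

text \<open>Exponentially small covariances make each row sum bounded. General finite
  \<open>J\<close> covers both full Birkhoff sums and the times left over between blocks.\<close>

lemma variance_bound:
  "\<exists>C\<ge>0. \<forall>H h J. lip H h \<longrightarrow> 0 < H \<longrightarrow> (\<integral>x. h x \<partial>M) = 0 \<longrightarrow> finite J \<longrightarrow>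
     (\<integral>x. (\<Sum>j\<in>J. h ((T ^^ j) x))\<^sup>2 \<partial>M) \<le> C * H * (\<integral>x. \<bar>h x\<bar> \<partial>M) * card J"
proof -
  obtain C \<theta> where C: "C \<ge> 0" "\<theta> > 0" "\<theta> < 1"
    and cov: "\<And>H h k. lip H h \<Longrightarrow> 0 < H \<Longrightarrow> (\<integral>x. h x \<partial>M) = 0 \<Longrightarrow>
     \<bar>cov h k\<bar> \<le> C * H * (\<integral>x. \<bar>h x\<bar> \<partial>M) * \<theta> ^ k"
    using cov_bound by blast
  have "(\<integral>x. (\<Sum>j\<in>J. h ((T ^^ j) x))\<^sup>2 \<partial>M) \<le> C * (2 / (1 - \<theta>)) * H * (\<integral>x. \<bar>h x\<bar> \<partial>M) * card J"
    if h: "lip H h" "0 < H" "(\<integral>x. h x \<partial>M) = 0" and J: "finite J" for H h J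
  proof -
    define A where "A = C * H * (\<integral>x. \<bar>h x\<bar> \<partial>M)"
    have A: "0 \<le> A" using C h by (simp add: A_def)
    have "(\<integral>x. (\<Sum>j\<in>J. h ((T ^^ j) x))\<^sup>2 \<partial>M) \<le> (\<Sum>i\<in>J. \<Sum>j\<in>J. A * \<theta> ^ (if i \<le> j then j - i else i - j))"
      unfolding integral_sum_square(2)[OF h(1) J] A_def
      by (intro sum_mono order_trans[OF abs_ge_self cov] h)
    also have "\<dots> \<le> (\<Sum>i\<in>J. A * (2 / (1 - \<theta>)))"
      unfolding sum_distrib_left[symmetric] by (intro sum_mono mult_left_mono sum_power_dist_le C J A)
    also have "\<dots> = A * (2 / (1 - \<theta>)) * card J" by simp
    finally show ?thesis by (simp add: A_def mult_ac)
  qed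
  moreover have "0 \<le> C * (2 / (1 - \<theta>))" using C by simp
  ultimately show ?thesis by blast
qed

lemma bsum_square: assumes lip: "lip H h"
  shows "integrable M (\<lambda>x. (bsum h n x)\<^sup>2)"
    "(\<integral>x. (bsum h n x)\<^sup>2 \<partial>M) = (\<Sum>i<n. \<Sum>j<n. cov h (if i \<le> j then j - i else i - j))"
  unfolding bsum_def by (rule integral_sum_square[OF lip finite_lessThan])+

text \<open>The increment \<open>V (n + 1) - V n\<close> is the partial sum \<open>d n\<close> of
  the Green-Kubo series, which converges; \<open>V N / N\<close> is the Cesaro mean of these
  increments.\<close>

lemma variance_converges: assumes lip: "lip H h" and H: "0 < H" and h0: "(\<integral>x. h x \<partial>M) = 0"
  shows "\<exists>v. (\<lambda>N. (\<integral>x. (bsum h N x)\<^sup>2 \<partial>M) / real N) \<longlonglongrightarrow> v"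
proof -
  obtain C \<theta> where C: "C \<ge> 0" "\<theta> > 0" "\<theta> < 1"
    and cov: "\<And>k. \<bar>cov h k\<bar> \<le> C * H * (\<integral>x. \<bar>h x\<bar> \<partial>M) * \<theta> ^ k"
    using cov_bound lip H h0 by metis
  define V where "V n = (\<integral>x. (bsum h n x)\<^sup>2 \<partial>M)" for n
  define d where "d n = cov h 0 + 2 * (\<Sum>k<n. cov h (Suc k))" for n
  have "V n = (\<Sum>k<n. d k)" for n
  proof (induction n)
    case 0 then show ?case by (simp add: V_def bsum_def)
  next
    case (Suc n)
    let ?c = "\<lambda>i j. cov h (if i \<le> j then j - i else i - j)"
    have "V (Suc n) = (\<Sum>i<n. (\<Sum>j<n. ?c i j) + ?c i n) + ((\<Sum>j<n. ?c n j) + ?c n n)"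
      unfolding V_def bsum_square(2)[OF lip] by simp
    also have "\<dots> = V n + (\<Sum>i<n. cov h (n - i)) + (\<Sum>j<n. cov h (n - j)) + cov h 0"
    proof -
      have "(\<Sum>j<n. ?c n j) = (\<Sum>j<n. cov h (n - j))" "(\<Sum>i<n. ?c i n) = (\<Sum>i<n. cov h (n - i))"
        by (auto intro!: sum.cong)
      then show ?thesis unfolding V_def bsum_square(2)[OF lip] sum.distrib by simp
    qed
    also have "(\<Sum>i<n. cov h (n - i)) = (\<Sum>i<n. cov h (Suc (n - Suc i)))"
      by (intro sum.cong) (auto simp: Suc_diff_Suc)
    also have "\<dots> = (\<Sum>k<n. cov h (Suc k))" by (rule sum.nat_diff_reindex)
    finally show ?case using Suc by (simp add: d_def)
  qed
  then have V: "(\<lambda>N. V N / real N) = (\<lambda>N. (\<Sum>k<N. d k) / real N)" by auto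
  have "summable (\<lambda>k. cov h (Suc k))"
  proof (rule summable_comparison_test')
    show "summable (\<lambda>k. C * H * (\<integral>x. \<bar>h x\<bar> \<partial>M) * \<theta> * \<theta> ^ k)"
      using C by (intro summable_mult summable_geometric) auto
    show "norm (cov h (Suc k)) \<le> C * H * (\<integral>x. \<bar>h x\<bar> \<partial>M) * \<theta> * \<theta> ^ k" for k
      using cov[of "Suc k"] by (simp add: mult_ac)
  qed
  then have "(\<lambda>n. \<Sum>k<n. cov h (Suc k)) \<longlonglongrightarrow> (\<Sum>k. cov h (Suc k))" by (rule summable_LIMSEQ)
  then have "d \<longlonglongrightarrow> cov h 0 + 2 * (\<Sum>k. cov h (Suc k))"
    unfolding d_def[abs_def] by (intro tendsto_intros)
  then show ?thesis using cesaro_real unfolding V_def[symmetric] V by blast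
qed

text \<open>The complex covariance consists of four real ones, with cosine or sine on one side and
  real or imaginary part on the other; this gives the factor 4.\<close>

lemma decorrelation_complex: assumes lip: "lip H h" and b: "0 \<le> b"
  shows "\<exists>C\<ge>0. \<exists>\<theta>>0. \<theta> < 1 \<and> (\<forall>p s G m. \<bar>s\<bar> * H / (1 - r) \<le> b \<longrightarrow> 1 \<le> m \<longrightarrow>
    G \<in> borel_measurable M \<longrightarrow> (\<forall>x. cmod (G x) \<le> 1) \<longrightarrow>
    cmod ((\<integral>x. iexp (s * bsum h p x) * G ((T ^^ (p + m)) x) \<partial>M) -
      (\<integral>x. iexp (s * bsum h p x) \<partial>M) * (\<integral>x. G x \<partial>M)) \<le> C * \<theta> ^ m)"
proof -
  obtain C \<theta> where C: "C \<ge> 0" "\<theta> > 0" "\<theta> < 1"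
    and dec: "\<And>p s \<psi> G m. \<bar>s\<bar> * H / (1 - r) \<le> b \<Longrightarrow> \<psi> \<in> borel_measurable borel \<Longrightarrow>
    (\<forall>x. \<bar>\<psi> x\<bar> \<le> 1) \<Longrightarrow> (\<forall>x y. \<bar>\<psi> x - \<psi> y\<bar> \<le> \<bar>x - y\<bar>) \<Longrightarrow> 1 \<le> m \<Longrightarrow>
    G \<in> borel_measurable M \<Longrightarrow> (\<forall>x. \<bar>G x\<bar> \<le> 1) \<Longrightarrow>
    \<bar>(\<integral>x. \<psi> (s * bsum h p x) * G ((T ^^ (p + m)) x) \<partial>M) - (\<integral>x. \<psi> (s * bsum h p x) \<partial>M) * (\<integral>x. G x \<partial>M)\<bar> \<le> C * \<theta> ^ m"
    using decorrelation_real[OF lip b] by blast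
  have hm [measurable]: "h \<in> borel_measurable M" by (rule lip_meas[OF lip])
  have cosl: "\<bar>cos x - cos y\<bar> \<le> \<bar>x - y\<bar>" for x y :: real
  proof -
    have "Re (iexp x - iexp y) = cos x - cos y" by (simp add: Re_exp)
    then show ?thesis using abs_Re_le_cmod[of "iexp x - iexp y"] cmod_iexp_diff_le[of x y] by simp
  qed
  have sinl: "\<bar>sin x - sin y\<bar> \<le> \<bar>x - y\<bar>" for x y :: real
  proof -
    have "Im (iexp x - iexp y) = sin x - sin y" by (simp add: Im_exp)
    then show ?thesis using abs_Im_le_cmod[of "iexp x - iexp y"] cmod_iexp_diff_le[of x y] by simp
  qed
  have "cmod ((\<integral>x. iexp (s * bsum h p x) * G ((T ^^ (p + m)) x) \<partial>M) -
      (\<integral>x. iexp (s * bsum h p x) \<partial>M) * (\<integral>x. G x \<partial>M)) \<le> 4 * C * \<theta> ^ m"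
    if s: "\<bar>s\<bar> * H / (1 - r) \<le> b" and m: "1 \<le> m" and G [measurable]: "G \<in> borel_measurable M"
      and G1: "\<And>x. cmod (G x) \<le> 1" for p s G m
  proof -
    define S where "S x = s * bsum h p x" for x
    have [measurable]: "S \<in> borel_measurable M" unfolding S_def[abs_def] by measurable
    define G' where "G' x = G ((T ^^ (p + m)) x)" for x
    have [measurable]: "G' \<in> borel_measurable M" unfolding G'_def[abs_def] by (rule measurable_compose[OF Tn_meas G])
    have G'1: "cmod (G' x) \<le> 1" for x by (simp add: G'_def G1)
    have re: "\<bar>Re (G x)\<bar> \<le> 1" "\<bar>Im (G x)\<bar> \<le> 1" "\<bar>Re (G' x)\<bar> \<le> 1" "\<bar>Im (G' x)\<bar> \<le> 1" for x
      using abs_Re_le_cmod[of "G x"] abs_Im_le_cmod[of "G x"] abs_Re_le_cmod[of "G' x"] abs_Im_le_cmod[of "G' x"]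
        G1[of x] G'1[of x] by auto
    define cv where "cv \<psi> g = (\<integral>x. \<psi> (S x) * g (G' x) \<partial>M) - (\<integral>x. \<psi> (S x) \<partial>M) * (\<integral>x. g (G x) \<partial>M)"
      for \<psi> :: "real \<Rightarrow> real" and g :: "complex \<Rightarrow> real"
    have c: "\<bar>cv cos Re\<bar> \<le> C * \<theta> ^ m" "\<bar>cv cos Im\<bar> \<le> C * \<theta> ^ m" "\<bar>cv sin Re\<bar> \<le> C * \<theta> ^ m" "\<bar>cv sin Im\<bar> \<le> C * \<theta> ^ m"
      unfolding cv_def S_def G'_def
      by (rule dec[OF s _ _ _ m]; use re cosl sinl in auto)+
    have i1: "integrable M (\<lambda>x. iexp (S x))" by (rule bounded_integrable[where B=1]) auto
    have i2: "integrable M G" by (rule bounded_integrable[where B=1]) (use G1 in auto)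
    have i3: "integrable M (\<lambda>x. iexp (S x) * G' x)"
      by (rule bounded_integrable[where B=1]) (use G'1 in \<open>auto simp: norm_mult\<close>)
    have j0: "integrable M (\<lambda>x. Re (G' x))" "integrable M (\<lambda>x. Im (G' x))"
      by (rule bounded_integrable[where B=1]; use re in simp)+
    have j: "integrable M (\<lambda>x. cos (S x) * Re (G' x))" "integrable M (\<lambda>x. cos (S x) * Im (G' x))"
      "integrable M (\<lambda>x. sin (S x) * Re (G' x))" "integrable M (\<lambda>x. sin (S x) * Im (G' x))"
      by (intro integrable_bounded_mult[where W=1] j0; simp)+
    define Z where "Z = (\<integral>x. iexp (S x) * G' x \<partial>M) - (\<integral>x. iexp (S x) \<partial>M) * (\<integral>x. G x \<partial>M)"
    have RI: "Re (\<integral>x. iexp (S x) * G' x \<partial>M) = (\<integral>x. cos (S x) * Re (G' x) \<partial>M) - (\<integral>x. sin (S x) * Im (G' x) \<partial>M)"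
      "Im (\<integral>x. iexp (S x) * G' x \<partial>M) = (\<integral>x. cos (S x) * Im (G' x) \<partial>M) + (\<integral>x. sin (S x) * Re (G' x) \<partial>M)"
      unfolding integral_Re[OF i3, symmetric] integral_Im[OF i3, symmetric]
        Bochner_Integration.integral_diff[OF j(1) j(4), symmetric] Bochner_Integration.integral_add[OF j(2) j(3), symmetric]
      by (intro Bochner_Integration.integral_cong refl; simp add: Re_exp Im_exp)+
    have RI': "Re (\<integral>x. iexp (S x) \<partial>M) = (\<integral>x. cos (S x) \<partial>M)" "Im (\<integral>x. iexp (S x) \<partial>M) = (\<integral>x. sin (S x) \<partial>M)"
      unfolding integral_Re[OF i1, symmetric] integral_Im[OF i1, symmetric]
      by (intro Bochner_Integration.integral_cong refl; simp add: Re_exp Im_exp)+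
    have "Re Z = cv cos Re - cv sin Im"
      unfolding Z_def cv_def minus_complex.sel times_complex.sel RI RI' integral_Re[OF i2] integral_Im[OF i2] by simp
    moreover have "Im Z = cv cos Im + cv sin Re"
      unfolding Z_def cv_def minus_complex.sel times_complex.sel RI RI' integral_Re[OF i2] integral_Im[OF i2] by simp
    ultimately have "cmod Z \<le> 4 * C * \<theta> ^ m"
      using cmod_le[of Z] c by (auto simp: abs_le_iff)
    then show ?thesis by (simp add: Z_def S_def G'_def)
  qed
  then show ?thesis using C by (intro exI[of _ "4 * C"]) auto
qed

end

section \<open>The central limit theorem for Lipschitz functions\<close>

context markov_system
begin

lemma bsum_AE_bound: assumes "lip H h" shows "AE x in M. \<bar>bsum h n x\<bar> \<le> real n * H"
proof -
  have "AE x in M. \<forall>j\<in>{..<n}. \<bar>h ((T ^^ j) x)\<bar> \<le> H"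
    by (intro AE_ball_countable[THEN iffD2] ballI AE_Tn lip_AE[OF assms]) auto
  then show ?thesis
  proof (rule eventually_mono)
    fix x assume x: "\<forall>j\<in>{..<n}. \<bar>h ((T ^^ j) x)\<bar> \<le> H"
    have "\<bar>bsum h n x\<bar> \<le> (\<Sum>j<n. \<bar>h ((T ^^ j) x)\<bar>)" unfolding bsum_def by (rule sum_abs)
    also have "\<dots> \<le> (\<Sum>j<n. H)" by (intro sum_mono) (use x in auto)
    finally show "\<bar>bsum h n x\<bar> \<le> real n * H" by simp
  qed
qed

lemma integrable_iexp: "u \<in> borel_measurable M \<Longrightarrow> integrable M (\<lambda>x. iexp (s * u x))"
  by (rule bounded_integrable[where B=1]) auto

text \<open>Second-order Taylor expansion on one side and \<open>exp (- y)\<close> against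
  \<open>1 - y\<close> on the other. The cubic remainder uses only the crude bound
  \<open>p * H\<close> for the sum, affordable because blocks will be short compared with
  \<open>n\<close>.\<close>

lemma char_bsum_approx: assumes lip: "lip H h" and h0: "(\<integral>x. h x \<partial>M) = 0"
  shows "cmod ((\<integral>x. iexp (s * bsum h p x) \<partial>M) - exp (- complex_of_real (s\<^sup>2 * (\<integral>x. (bsum h p x)\<^sup>2 \<partial>M) / 2)))
    \<le> \<bar>s\<bar> ^ 3 * (real p * H) ^ 3 + (s\<^sup>2 * (\<integral>x. (bsum h p x)\<^sup>2 \<partial>M))\<^sup>2"
proof -
  have [measurable]: "h \<in> borel_measurable M" by (rule lip_meas[OF lip])
  define V where "V = (\<integral>x. (bsum h p x)\<^sup>2 \<partial>M)"
  have V: "0 \<le> V" by (simp add: V_def)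
  have i2: "integrable M (\<lambda>x. (bsum h p x)\<^sup>2)" by (rule bsum_square[OF lip])
  have i1: "integrable M (bsum h p)"
    unfolding bsum_def[abs_def] by (intro Bochner_Integration.integrable_sum integrable_Tn lip_integrable[OF lip])
  have b0: "(\<integral>x. bsum h p x \<partial>M) = 0"
    unfolding bsum_def by (simp add: Bochner_Integration.integral_sum integrable_Tn lip_integrable[OF lip] integral_Tn h0)
  define R where "R x = (1 + \<i> * complex_of_real (s * bsum h p x)) - complex_of_real ((s * bsum h p x)\<^sup>2 / 2)" for x
  have iR: "integrable M R" unfolding R_def[abs_def]
    by (intro Bochner_Integration.integrable_diff Bochner_Integration.integrable_add integrable_mult_right
        integrable_of_real Bochner_Integration.integrable_divide) (use i1 i2 in \<open>auto simp: power_mult_distrib\<close>)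
  have R: "(\<integral>x. R x \<partial>M) = complex_of_real (1 - s\<^sup>2 * V / 2)"
  proof -
    have "(\<integral>x. R x \<partial>M) = (\<integral>x. 1 + \<i> * complex_of_real (s * bsum h p x) \<partial>M) - (\<integral>x. complex_of_real ((s * bsum h p x)\<^sup>2 / 2) \<partial>M)"
      unfolding R_def by (intro Bochner_Integration.integral_diff Bochner_Integration.integrable_add integrable_mult_right
        integrable_of_real Bochner_Integration.integrable_divide) (use i1 i2 in \<open>auto simp: power_mult_distrib\<close>)
    also have "(\<integral>x. 1 + \<i> * complex_of_real (s * bsum h p x) \<partial>M) = 1"
      using i1 b0 by (simp add: prob_space)
    also have "(\<integral>x. complex_of_real ((s * bsum h p x)\<^sup>2 / 2) \<partial>M) = complex_of_real (s\<^sup>2 * V / 2)"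
      by (simp only: integral_complex_of_real) (simp add: power_mult_distrib V_def)
    finally show ?thesis by simp
  qed
  have "cmod ((\<integral>x. iexp (s * bsum h p x) \<partial>M) - (\<integral>x. R x \<partial>M)) = cmod (\<integral>x. iexp (s * bsum h p x) - R x \<partial>M)"
    using Bochner_Integration.integral_diff[OF integrable_iexp iR, of "bsum h p" s] by simp
  also have "\<dots> \<le> (\<integral>x. cmod (iexp (s * bsum h p x) - R x) \<partial>M)" by (rule integral_norm_bound)
  also have "\<dots> \<le> (\<integral>x. \<bar>s\<bar> ^ 3 * (real p * H) ^ 3 \<partial>M)"
  proof (rule integral_mono_AE)
    show "integrable M (\<lambda>x. cmod (iexp (s * bsum h p x) - R x))"
      by (intro integrable_norm Bochner_Integration.integrable_diff integrable_iexp iR) simp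
    show "AE x in M. cmod (iexp (s * bsum h p x) - R x) \<le> \<bar>s\<bar> ^ 3 * (real p * H) ^ 3"
      using bsum_AE_bound[OF lip, of p]
    proof eventually_elim
      case (elim x)
      have "(\<Sum>k\<le>2. (\<i> * complex_of_real (s * bsum h p x)) ^ k / fact k) = R x"
        by (simp add: R_def eval_nat_numeral algebra_simps)
      then have "cmod (iexp (s * bsum h p x) - R x) \<le> \<bar>s * bsum h p x\<bar> ^ 3 / fact 3"
        using iexp_approx1[of "s * bsum h p x" 2] by (simp add: eval_nat_numeral)
      also have "\<dots> \<le> \<bar>s * bsum h p x\<bar> ^ 3" by (simp add: fact_numeral)
      also have "\<dots> = \<bar>s\<bar> ^ 3 * \<bar>bsum h p x\<bar> ^ 3" by (simp add: abs_mult power_mult_distrib)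
      also have "\<dots> \<le> \<bar>s\<bar> ^ 3 * (real p * H) ^ 3"
        by (intro mult_left_mono power_mono elim) auto
      finally show ?case .
    qed
  qed simp
  finally have 1: "cmod ((\<integral>x. iexp (s * bsum h p x) \<partial>M) - complex_of_real (1 - s\<^sup>2 * V / 2)) \<le> \<bar>s\<bar> ^ 3 * (real p * H) ^ 3"
    by (simp add: R prob_space)
  have e: "\<bar>exp (- y) - (1 - y)\<bar> \<le> (2 * y)\<^sup>2" if "0 \<le> y" for y :: real
  proof -
    have "exp (- y) \<le> 1 - y + y\<^sup>2" 
    proof -
      have "1 + y \<le> exp y" by (rule exp_ge_add_one_self)
      then have "exp (- y) \<le> 1 / (1 + y)" using that by (simp add: exp_minus field_simps)
      also have "\<dots> \<le> 1 - y + y\<^sup>2"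
        using that by (simp add: field_simps power2_eq_square)
      finally show ?thesis .
    qed
    moreover have "1 - y \<le> exp (- y)" using exp_ge_add_one_self[of "- y"] by simp
    moreover have "y\<^sup>2 \<le> (2 * y)\<^sup>2" using that by (intro power_mono) auto
    ultimately show ?thesis by linarith
  qed
  have "cmod (complex_of_real (1 - s\<^sup>2 * V / 2) - exp (- complex_of_real (s\<^sup>2 * V / 2))) =
      \<bar>exp (- (s\<^sup>2 * V / 2)) - (1 - s\<^sup>2 * V / 2)\<bar>"
    by (simp only: of_real_minus[symmetric] exp_of_real of_real_diff[symmetric] norm_of_real abs_minus_commute)
  also have "\<dots> \<le> (s\<^sup>2 * V)\<^sup>2" using e[of "s\<^sup>2 * V / 2"] V by simp
  finally show ?thesis
    using 1 norm_triangle_ineq[of "(\<integral>x. iexp (s * bsum h p x) \<partial>M) - complex_of_real (1 - s\<^sup>2 * V / 2)"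
      "complex_of_real (1 - s\<^sup>2 * V / 2) - exp (- complex_of_real (s\<^sup>2 * V / 2))"]
    by (simp add: V_def)
qed

text \<open>Bernstein's method: \<open>k\<close> blocks of length \<open>p\<close> separated by gaps of length \<open>q\<close>.\<close>

lemma block_estimate: assumes lip: "lip H h" and H: "0 < H" and h0: "(\<integral>x. h x \<partial>M) = 0" and t0: "0 \<le> t0"
  shows "\<exists>C\<ge>0. \<exists>\<theta>>0. \<theta> < 1 \<and> (\<forall>s n k p q. \<bar>s\<bar> \<le> t0 \<longrightarrow> 1 \<le> q \<longrightarrow> k * (p + q) \<le> n \<longrightarrow>
    cmod ((\<integral>x. iexp (s * bsum h n x) \<partial>M) - exp (- complex_of_real (k * (s\<^sup>2 * (\<integral>x. (bsum h p x)\<^sup>2 \<partial>M) / 2))))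
    \<le> \<bar>s\<bar> * sqrt (C * real (n - k * p)) + k * (C * \<theta> ^ q) + k * (C * \<bar>s\<bar> ^ 3 * real p ^ 3 + C * (s\<^sup>2 * p)\<^sup>2))"
proof -
  have [measurable]: "h \<in> borel_measurable M" by (rule lip_meas[OF lip])
  \<comment> \<open>This number dominates the oscillation constant of
    \<open>iexp (s * bsum h p x)\<close> for all \<open>\<bar>s\<bar> \<le> t0\<close>, so the
    decorrelation constants can be chosen before \<open>s\<close>.\<close>
  have "0 \<le> t0 * H / (1 - r)" using t0 H r_less by simp
  obtain C1 \<theta> where C1: "C1 \<ge> 0" "\<theta> > 0" "\<theta> < 1"
    and dec: "\<And>p s G m. \<bar>s\<bar> * H / (1 - r) \<le> t0 * H / (1 - r) \<Longrightarrow> 1 \<le> m \<Longrightarrow>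
    G \<in> borel_measurable M \<Longrightarrow> (\<forall>x. cmod (G x) \<le> 1) \<Longrightarrow>
    cmod ((\<integral>x. iexp (s * bsum h p x) * G ((T ^^ (p + m)) x) \<partial>M) -
      (\<integral>x. iexp (s * bsum h p x) \<partial>M) * (\<integral>x. G x \<partial>M)) \<le> C1 * \<theta> ^ m"
    using decorrelation_complex[OF lip \<open>0 \<le> t0 * H / (1 - r)\<close>] by blast
  obtain C2' where C2': "C2' \<ge> 0" and var: "\<And>H h J. lip H h \<Longrightarrow> 0 < H \<Longrightarrow> (\<integral>x. h x \<partial>M) = 0 \<Longrightarrow> finite J \<Longrightarrow>
     (\<integral>x. (\<Sum>j\<in>J. h ((T ^^ j) x))\<^sup>2 \<partial>M) \<le> C2' * H * (\<integral>x. \<bar>h x\<bar> \<partial>M) * card J"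
    using variance_bound by blast
  define C2 where "C2 = C2' * H * (\<integral>x. \<bar>h x\<bar> \<partial>M)"
  have C2: "C2 \<ge> 0" "\<And>J. finite J \<Longrightarrow> (\<integral>x. (\<Sum>j\<in>J. h ((T ^^ j) x))\<^sup>2 \<partial>M) \<le> C2 * card J"
    using C2' H var[OF lip H h0] by (simp_all add: C2_def)
  define C where "C = C1 + C2 + H ^ 3 + C2\<^sup>2"
  have H3: "0 \<le> H ^ 3" using H by simp
  have C: "0 \<le> C" "C1 \<le> C" "C2 \<le> C" "H ^ 3 \<le> C" "C2\<^sup>2 \<le> C"
    using C1 C2 H3 zero_le_power2[of C2] unfolding C_def by linarith+
  have "cmod ((\<integral>x. iexp (s * bsum h n x) \<partial>M) - exp (- complex_of_real (k * (s\<^sup>2 * (\<integral>x. (bsum h p x)\<^sup>2 \<partial>M) / 2))))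
    \<le> \<bar>s\<bar> * sqrt (C * real (n - k * p)) + k * (C * \<theta> ^ q) + k * (C * \<bar>s\<bar> ^ 3 * real p ^ 3 + C * (s\<^sup>2 * p)\<^sup>2)"
    if s: "\<bar>s\<bar> \<le> t0" and q: "1 \<le> q" and n: "k * (p + q) \<le> n" for s n k p q
  proof -
    define l where "l = p + q"
    have l: "l > 0" using q by (simp add: l_def)
    define B where "B k x = (\<Sum>i<k. bsum h p ((T ^^ (i * l)) x))" for k x
    have [measurable]: "B k \<in> borel_measurable M" for k
      unfolding B_def[abs_def] by (intro borel_measurable_sum measurable_compose[OF Tn_meas]) simp
    have B_Suc: "B (Suc k) x = bsum h p x + B k ((T ^^ l) x)" for k x
    proof -
      have "(T ^^ (Suc i * l)) x = (T ^^ (i * l)) ((T ^^ l) x)" for i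
        by (simp only: mult_Suc add.commute[of l] funpow_add o_apply)
      then show ?thesis unfolding B_def sum.lessThan_Suc_shift by simp
    qed
    define \<psi> where "\<psi> = (\<integral>x. iexp (s * bsum h p x) \<partial>M)"
    define \<Psi> where "\<Psi> k = (\<integral>x. iexp (s * B k x) \<partial>M)" for k
    have norm1: "cmod (\<integral>x. iexp (s * u x) \<partial>M) \<le> 1" for u
    proof -
      have "cmod (\<integral>x. iexp (s * u x) \<partial>M) \<le> (\<integral>x. cmod (iexp (s * u x)) \<partial>M)" by (rule integral_norm_bound)
      also have "\<dots> = 1" by (simp add: prob_space)
      finally show ?thesis .
    qed
    have \<psi>1: "cmod \<psi> \<le> 1" unfolding \<psi>_def by (rule norm1)
    \<comment> \<open>The first block is decorrelated from all later ones across a gap of length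
      \<open>q\<close>; by invariance the later ones again form \<open>B k\<close>. Induction then
      replaces the blocks by independent copies.\<close>
    have step: "cmod (\<Psi> (Suc k) - \<psi> * \<Psi> k) \<le> C1 * \<theta> ^ q" for k
    proof -
      have "iexp (s * B (Suc k) x) = iexp (s * bsum h p x) * iexp (s * B k ((T ^^ (p + q)) x))" for x
        unfolding B_Suc l_def by (simp add: distrib_left exp_add)
      then have "\<Psi> (Suc k) = (\<integral>x. iexp (s * bsum h p x) * iexp (s * B k ((T ^^ (p + q)) x)) \<partial>M)"
        by (simp add: \<Psi>_def)
      moreover have "\<bar>s\<bar> * H / (1 - r) \<le> t0 * H / (1 - r)"
        using s H r_less by (intro divide_right_mono mult_right_mono) auto
      then have "cmod ((\<integral>x. iexp (s * bsum h p x) * iexp (s * B k ((T ^^ (p + q)) x)) \<partial>M) - \<psi> * \<Psi> k) \<le> C1 * \<theta> ^ q"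
        unfolding \<psi>_def \<Psi>_def by (rule dec[OF _ q]) auto
      ultimately show ?thesis by (simp only:)
    qed
    have iter: "cmod (\<Psi> k - \<psi> ^ k) \<le> k * (C1 * \<theta> ^ q)" for k
    proof (induction k)
      case 0 then show ?case by (simp add: \<Psi>_def B_def prob_space)
    next
      case (Suc k)
      have "\<Psi> (Suc k) - \<psi> ^ Suc k = (\<Psi> (Suc k) - \<psi> * \<Psi> k) + \<psi> * (\<Psi> k - \<psi> ^ k)" by (simp add: algebra_simps)
      also have "cmod \<dots> \<le> cmod (\<Psi> (Suc k) - \<psi> * \<Psi> k) + cmod (\<psi> * (\<Psi> k - \<psi> ^ k))" by (rule norm_triangle_ineq)
      also have "cmod (\<psi> * (\<Psi> k - \<psi> ^ k)) \<le> 1 * (k * (C1 * \<theta> ^ q))"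
        unfolding norm_mult by (intro mult_mono \<psi>1 Suc) auto
      also have "cmod (\<Psi> (Suc k) - \<psi> * \<Psi> k) \<le> C1 * \<theta> ^ q" by (rule step)
      finally show ?case by (simp add: algebra_simps)
    qed
    \<comment> \<open>The times covered by blocks. Their complement contains the gaps and the
      incomplete end; \<open>variance_bound\<close> applied to it gives the square-root
      term.\<close>
    define J where "J = (\<lambda>(i, j). i * l + j) ` ({..<k} \<times> {..<p})"
    have inj: "inj_on (\<lambda>(i, j). i * l + j) ({..<k} \<times> {..<p})"
    proof (rule inj_onI, clarify)
      fix i j i' j' assume "j < p" "j' < p" and eq: "i * l + j = i' * l + j'"
      then have jl: "j < l" "j' < l" by (auto simp: l_def)
      have "(i * l + j) div l = i" "(i' * l + j') div l = i'" using jl by auto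
      then have "i = i'" using eq by simp
      then show "i = i' \<and> j = j'" using eq by simp
    qed
    have cJ: "card J = k * p" unfolding J_def by (subst card_image[OF inj]) simp
    have Jn: "J \<subseteq> {..<n}"
    proof -
      have "i * l + j < n" if "i < k" "j < p" for i j
      proof -
        have "i * l + j < Suc i * l" using that by (simp add: l_def)
        also have "\<dots> \<le> k * l" using that by (intro mult_right_mono) auto
        finally show ?thesis using n by (simp add: l_def)
      qed
      then show ?thesis by (auto simp: J_def)
    qed
    have finJ: "finite J" using Jn finite_subset by blast
    have BJ: "B k x = (\<Sum>j\<in>J. h ((T ^^ j) x))" for x
    proof -
      have "(T ^^ (i * l + j)) x = (T ^^ j) ((T ^^ (i * l)) x)" for i j
        by (simp only: add.commute[of "i * l"] funpow_add o_apply)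
      then show ?thesis
        unfolding J_def by (subst sum.reindex[OF inj]) (simp add: B_def bsum_def sum.cartesian_product case_prod_unfold)
    qed
    have diff: "bsum h n x - B k x = (\<Sum>j\<in>{..<n} - J. h ((T ^^ j) x))" for x
      unfolding BJ bsum_def using sum_diff[OF finite_lessThan Jn] by (metis (no_types, lifting))
    have cJ': "card ({..<n} - J) = n - k * p" using card_Diff_subset[OF finJ Jn] cJ by simp
    have "cmod ((\<integral>x. iexp (s * bsum h n x) \<partial>M) - \<Psi> k) \<le> \<bar>s\<bar> * (\<integral>x. \<bar>bsum h n x - B k x\<bar> \<partial>M)"
      unfolding \<Psi>_def
    proof (rule cmod_expectation_iexp_diff)
      show "integrable M (\<lambda>x. bsum h n x - B k x)"
        unfolding diff by (intro Bochner_Integration.integrable_sum integrable_Tn lip_integrable[OF lip])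
    qed simp_all
    also have "\<dots> \<le> \<bar>s\<bar> * sqrt (C2 * real (n - k * p))"
    proof (intro mult_left_mono)
      have "(\<integral>x. \<bar>bsum h n x - B k x\<bar> \<partial>M) \<le> sqrt (\<integral>x. (bsum h n x - B k x)\<^sup>2 \<partial>M)"
        by (rule abs_expectation_le_sqrt(2)) (simp_all add: diff integral_sum_square(1)[OF lip])
      also have "\<dots> \<le> sqrt (C2 * real (n - k * p))"
        using C2(2)[of "{..<n} - J"] unfolding diff cJ' by simp
      finally show "(\<integral>x. \<bar>bsum h n x - B k x\<bar> \<partial>M) \<le> sqrt (C2 * real (n - k * p))" .
    qed simp
    also have "\<dots> \<le> \<bar>s\<bar> * sqrt (C * real (n - k * p))"
      using C by (intro mult_left_mono real_sqrt_le_mono mult_right_mono) auto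
    finally have E1: "cmod ((\<integral>x. iexp (s * bsum h n x) \<partial>M) - \<Psi> k) \<le> \<bar>s\<bar> * sqrt (C * real (n - k * p))" .
    have "k * (C1 * \<theta> ^ q) \<le> k * (C * \<theta> ^ q)" using C C1 by (intro mult_left_mono mult_right_mono) auto
    then have E2: "cmod (\<Psi> k - \<psi> ^ k) \<le> k * (C * \<theta> ^ q)" using iter[of k] by linarith
    \<comment> \<open>The characteristic function of one block is now replaced by the Gaussian one;
      as both have modulus at most 1, taking \<open>k\<close>-th powers multiplies the error by at
      most \<open>k\<close>.\<close>
    define V where "V = (\<integral>x. (bsum h p x)\<^sup>2 \<partial>M)"
    define z where "z = exp (- complex_of_real (s\<^sup>2 * V / 2))"
    have V: "0 \<le> V" "V \<le> C2 * p" using C2(2)[of "{..<p}"] by (auto simp: V_def bsum_def)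
    have zk: "exp (- complex_of_real (k * (s\<^sup>2 * V / 2))) = z ^ k"
      unfolding z_def by (simp add: exp_of_nat_mult[symmetric])
    have z1: "cmod z \<le> 1"
      unfolding z_def of_real_minus[symmetric] exp_of_real norm_of_real using V by simp
    have "cmod (\<psi> ^ k - z ^ k) \<le> k * cmod (\<psi> - z)" by (rule norm_power_diff[OF \<psi>1 z1])
    also have "\<dots> \<le> k * (\<bar>s\<bar> ^ 3 * (real p * H) ^ 3 + (s\<^sup>2 * V)\<^sup>2)"
      using char_bsum_approx[OF lip h0, of s p] by (intro mult_left_mono) (auto simp: \<psi>_def z_def V_def)
    also have "\<dots> \<le> k * (C * \<bar>s\<bar> ^ 3 * real p ^ 3 + C * (s\<^sup>2 * p)\<^sup>2)"
    proof (intro mult_left_mono add_mono)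
      have "\<bar>s\<bar> ^ 3 * (real p * H) ^ 3 = H ^ 3 * (\<bar>s\<bar> ^ 3 * real p ^ 3)" by (simp add: power_mult_distrib)
      also have "\<dots> \<le> C * (\<bar>s\<bar> ^ 3 * real p ^ 3)" by (intro mult_right_mono C) auto
      finally show "\<bar>s\<bar> ^ 3 * (real p * H) ^ 3 \<le> C * \<bar>s\<bar> ^ 3 * real p ^ 3" by simp
      have "(s\<^sup>2 * V)\<^sup>2 \<le> (s\<^sup>2 * (C2 * p))\<^sup>2" using V by (intro power_mono mult_left_mono) auto
      also have "\<dots> = C2\<^sup>2 * (s\<^sup>2 * p)\<^sup>2" by (simp add: power_mult_distrib)
      also have "\<dots> \<le> C * (s\<^sup>2 * p)\<^sup>2" by (intro mult_right_mono C) auto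
      finally show "(s\<^sup>2 * V)\<^sup>2 \<le> C * (s\<^sup>2 * p)\<^sup>2" .
    qed simp
    finally have E3: "cmod (\<psi> ^ k - z ^ k) \<le> k * (C * \<bar>s\<bar> ^ 3 * real p ^ 3 + C * (s\<^sup>2 * p)\<^sup>2)" .
    have "(\<integral>x. iexp (s * bsum h n x) \<partial>M) - z ^ k =
        ((\<integral>x. iexp (s * bsum h n x) \<partial>M) - \<Psi> k) + ((\<Psi> k - \<psi> ^ k) + (\<psi> ^ k - z ^ k))" by simp
    also have "cmod \<dots> \<le> cmod ((\<integral>x. iexp (s * bsum h n x) \<partial>M) - \<Psi> k) + (cmod (\<Psi> k - \<psi> ^ k) + cmod (\<psi> ^ k - z ^ k))"
      by (intro norm_triangle_mono order_refl)
    finally show ?thesis using E1 E2 E3 unfolding zk[symmetric] V_def by linarith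
  qed
  then show ?thesis using C C1 by blast
qed

text \<open>In \<open>block_estimate\<close> the blocks must be long enough for the gaps to be
  negligible and short enough for the Taylor error to vanish. With the lengths below every error is
  of order \<open>1 / sqrt a\<close> or smaller, where \<open>a\<close> is the gap length.\<close>

lemma clt_lip: assumes lip: "lip H h" and H: "0 < H" and h0: "(\<integral>x. h x \<partial>M) = 0"
    and v: "(\<lambda>N. (\<integral>x. (bsum h N x)\<^sup>2 \<partial>M) / real N) \<longlonglongrightarrow> v"
  shows "(\<lambda>n. \<integral>x. iexp (t / sqrt (real n) * bsum h n x) \<partial>M) \<longlonglongrightarrow> exp (- complex_of_real (t\<^sup>2 * v / 2))"
proof -
  define V where "V p = (\<integral>x. (bsum h p x)\<^sup>2 \<partial>M)" for p
  obtain C \<theta> where C: "C \<ge> 0" "\<theta> > 0" "\<theta> < 1" and est: "\<And>s n k p q. \<bar>s\<bar> \<le> \<bar>t\<bar> \<Longrightarrow> 1 \<le> q \<Longrightarrow> k * (p + q) \<le> n \<Longrightarrow>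
    cmod ((\<integral>x. iexp (s * bsum h n x) \<partial>M) - exp (- complex_of_real (k * (s\<^sup>2 * V p / 2))))
    \<le> \<bar>s\<bar> * sqrt (C * real (n - k * p)) + k * (C * \<theta> ^ q) + k * (C * \<bar>s\<bar> ^ 3 * real p ^ 3 + C * (s\<^sup>2 * p)\<^sup>2)"
    using block_estimate[OF lip H h0, of "\<bar>t\<bar>"] unfolding V_def by auto
  \<comment> \<open>Gaps of length about \<open>n^(1/10)\<close> and blocks of length
    \<open>a^2\<close>: the gaps occupy a fraction about \<open>1 / a\<close> of the time, and as
    \<open>k * a^2 \<le> n\<close> and \<open>a^10 \<le> n\<close>, the cubic error
    \<open>k * p^3 / n^(3/2)\<close> is at most \<open>a^4 / sqrt n \<le> 1 / a\<close>.\<close>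
  define a where "a n = nat \<lfloor>real n powr (1 / 10)\<rfloor>" for n
  define p where "p n = (a n)\<^sup>2" for n
  define k where "k n = n div (p n + a n)" for n
  have a_lim: "filterlim a at_top sequentially" unfolding a_def by real_asymp
  have p_lim: "filterlim p at_top sequentially"
    by (rule filterlim_at_top_mono[OF a_lim]) (simp add: p_def power2_eq_square)
  define Er where "Er x = \<bar>t\<bar> * sqrt (C * (3 / real x)) + C * ((real x + 1) ^ 10 * \<theta> ^ x) + C * \<bar>t\<bar> ^ 3 / real x + C * t ^ 4 / real x" for x
  have "(\<lambda>x. (real x + 1) ^ 10 * \<theta> ^ x) \<longlonglongrightarrow> 0" using C by real_asymp
  moreover have "(\<lambda>x. 3 / real x) \<longlonglongrightarrow> 0" by real_asymp
  moreover have "(\<lambda>x. C * \<bar>t\<bar> ^ 3 / real x) \<longlonglongrightarrow> 0" "(\<lambda>x. C * t ^ 4 / real x) \<longlonglongrightarrow> 0" by real_asymp+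
  ultimately have "Er \<longlonglongrightarrow> \<bar>t\<bar> * sqrt (C * 0) + C * 0 + 0 + 0"
    unfolding Er_def[abs_def] by (intro tendsto_intros)
  then have Er0: "(\<lambda>n. Er (a n)) \<longlonglongrightarrow> 0" using filterlim_compose[OF _ a_lim, of Er] by simp
  have bounds: "\<bar>1 - real (k n * p n) / real n\<bar> \<le> 3 / real (a n) \<and>
     cmod ((\<integral>x. iexp (t / sqrt (real n) * bsum h n x) \<partial>M) -
       exp (- complex_of_real (k n * ((t / sqrt (real n))\<^sup>2 * V (p n) / 2)))) \<le> Er (a n)"
    if n: "n \<ge> 1" for n
  proof -
    define A where "A = real (a n)"
    have "1 \<le> real n powr (1 / 10)" using n by (simp add: ge_one_powr_ge_zero)
    then have a1: "a n \<ge> 1" and aA: "A \<le> real n powr (1 / 10)" "real n powr (1 / 10) < A + 1"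
      unfolding A_def a_def by (auto simp: le_nat_iff)
    have A1: "1 \<le> A" using a1 by (simp add: A_def)
    have pw: "(real n powr (1 / 10)) ^ 10 = real n" using n by (simp add: powr_realpow[symmetric] powr_powr)
    have nA: "A ^ 10 \<le> real n" "real n \<le> (A + 1) ^ 10"
      using power_mono[OF aA(1), of 10] power_mono[OF less_imp_le[OF aA(2)], of 10] A1 unfolding pw by auto
    have sq: "A ^ 5 \<le> sqrt (real n)"
    proof (rule real_le_rsqrt)
      show "(A ^ 5)\<^sup>2 \<le> real n" using nA(1) by (simp add: power_mult[symmetric])
    qed
    define l where "l = p n + a n"
    have l: "l > 0" using a1 by (simp add: l_def)
    have rp: "real (p n) = A\<^sup>2" by (simp add: p_def A_def)
    have rl: "real l = A\<^sup>2 + A" by (simp add: l_def rp A_def)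
    have kl: "k n * l \<le> n" "n - k n * l < l"
      unfolding k_def l_def[symmetric] using l by (simp_all add: minus_div_mult_eq_mod)
    have kp_le: "k n * p n \<le> n" using kl(1) by (auto simp: l_def algebra_simps)
    have rn: "real n > 0" using n by simp
    have kAn: "real (k n) * A\<^sup>2 \<le> real n" using kp_le rp by (metis of_nat_le_iff of_nat_mult)
    have kAAn: "real (k n) * (A\<^sup>2 + A) \<le> real n" using kl(1) rl by (metis of_nat_le_iff of_nat_mult)
    \<comment> \<open>Uncovered are the end, shorter than \<open>l \<le> 2 * n / A\<close>, and the
      \<open>k n\<close> gaps, of total length at most \<open>n / A\<close>.\<close>
    have gap: "real (n - k n * p n) \<le> (3 / A) * real n"
    proof -
      have "n - k n * p n \<le> (n - k n * l) + k n * a n" using kl(1) by (simp add: l_def algebra_simps)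
      also have "\<dots> \<le> l + k n * a n" using kl(2) by simp
      finally have "real (n - k n * p n) \<le> real (l + k n * a n)" by (rule of_nat_mono)
      then have 1: "real (n - k n * p n) \<le> (A\<^sup>2 + A) + real (k n) * A"
        by (simp add: rl A_def)
      have "A * (A\<^sup>2 + A) \<le> A * (A\<^sup>2 + A\<^sup>2)" using A1 by (intro mult_left_mono) (auto simp: power2_eq_square)
      also have "\<dots> = 2 * A ^ 3" by (simp add: power2_eq_square power3_eq_cube)
      also have "\<dots> \<le> 2 * A ^ 10" using A1 by (intro mult_left_mono power_increasing) auto
      also have "\<dots> \<le> 2 * real n" using nA by simp
      finally have "A * (A\<^sup>2 + A) + A * (real (k n) * A) \<le> 3 * real n"
        using kAn by (simp add: power2_eq_square mult_ac)
      then have "A * real (n - k n * p n) \<le> 3 * real n"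
        using mult_left_mono[OF 1, of A] A1 by (simp add: distrib_left)
      then show ?thesis using A1 by (simp add: field_simps)
    qed
    have rdiff: "real (n - k n * p n) = real n - real (k n * p n)" using kp_le by (rule of_nat_diff)
    have "real (k n * p n) / real n \<le> 1"
      using of_nat_mono[OF kp_le] by (simp only: divide_le_eq_1_pos[OF rn])
    then have "\<bar>1 - real (k n * p n) / real n\<bar> = 1 - real (k n * p n) / real n" by (simp only: abs_of_nonneg diff_ge_0_iff_ge)
    also have "\<dots> = real (n - k n * p n) / real n"
      unfolding rdiff diff_divide_distrib using rn by simp
    also have "\<dots> \<le> 3 / A" using gap rn by (simp add: pos_divide_le_eq)
    finally have 1: "\<bar>1 - real (k n * p n) / real n\<bar> \<le> 3 / A" .
    define s where "s = t / sqrt (real n)"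
    have s_abs: "\<bar>s\<bar> = \<bar>t\<bar> / sqrt (real n)" by (simp add: s_def)
    have s_le: "\<bar>s\<bar> \<le> \<bar>t\<bar>" unfolding s_abs using n by (simp add: divide_le_eq mult_le_cancel_left1)
    have e: "cmod ((\<integral>x. iexp (s * bsum h n x) \<partial>M) - exp (- complex_of_real (k n * (s\<^sup>2 * V (p n) / 2))))
      \<le> \<bar>s\<bar> * sqrt (C * real (n - k n * p n)) + k n * (C * \<theta> ^ a n) + k n * (C * \<bar>s\<bar> ^ 3 * real (p n) ^ 3 + C * (s\<^sup>2 * p n)\<^sup>2)"
      by (rule est[OF s_le a1]) (use kl in \<open>simp add: l_def\<close>)
    have sn: "sqrt (real n) * sqrt (real n) = real n" by simp
    have sn0: "0 < sqrt (real n)" using rn by simp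
    have E1: "\<bar>s\<bar> * sqrt (C * real (n - k n * p n)) \<le> \<bar>t\<bar> * sqrt (C * (3 / A))"
    proof -
      have "sqrt (C * real (n - k n * p n)) \<le> sqrt (C * (3 / A) * real n)"
        using mult_left_mono[OF gap C(1)] by (intro real_sqrt_le_mono) (simp add: mult.assoc)
      also have "\<dots> = sqrt (C * (3 / A)) * sqrt (real n)" by (rule real_sqrt_mult)
      finally have "\<bar>s\<bar> * sqrt (C * real (n - k n * p n)) \<le> \<bar>s\<bar> * (sqrt (C * (3 / A)) * sqrt (real n))"
        by (intro mult_left_mono) auto
      also have "\<dots> = \<bar>t\<bar> * sqrt (C * (3 / A))" unfolding s_abs using sn0 by simp
      finally show ?thesis .
    qed
    have E2: "k n * (C * \<theta> ^ a n) \<le> C * ((A + 1) ^ 10 * \<theta> ^ a n)"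
    proof -
      have "real (k n) \<le> real n" unfolding k_def by (simp add: div_le_dividend)
      then have "real (k n) \<le> (A + 1) ^ 10" using nA by linarith
      then have "real (k n) * (C * \<theta> ^ a n) \<le> (A + 1) ^ 10 * (C * \<theta> ^ a n)"
        using C by (intro mult_right_mono) auto
      then show ?thesis by (simp add: mult_ac)
    qed
    have E3: "k n * (C * \<bar>s\<bar> ^ 3 * real (p n) ^ 3) \<le> C * \<bar>t\<bar> ^ 3 / A"
    proof -
      have "real (k n) * real (p n) ^ 3 * A \<le> sqrt (real n) ^ 3"
      proof -
        have "real (k n) * real (p n) ^ 3 * A = (real (k n) * A\<^sup>2) * A ^ 5"
          unfolding rp by (simp add: eval_nat_numeral mult_ac)
        also have "\<dots> \<le> real n * sqrt (real n)" using kAn sq A1 by (intro mult_mono) auto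
        also have "\<dots> = sqrt (real n) ^ 3" using sn by (simp add: power3_eq_cube)
        finally show ?thesis .
      qed
      then have "real (k n) * real (p n) ^ 3 / sqrt (real n) ^ 3 \<le> 1 / A"
        using A1 sn0 by (simp add: field_simps)
      then have "C * \<bar>t\<bar> ^ 3 * (real (k n) * real (p n) ^ 3 / sqrt (real n) ^ 3) \<le> C * \<bar>t\<bar> ^ 3 * (1 / A)"
        using C by (intro mult_left_mono) auto
      then show ?thesis unfolding s_abs power_divide by (simp add: mult_ac)
    qed
    have E4: "k n * (C * (s\<^sup>2 * p n)\<^sup>2) \<le> C * t ^ 4 / A"
    proof -
      have "real (k n) * real (p n) ^ 2 * A \<le> real n ^ 2"
      proof -
        have "real (k n) * real (p n) ^ 2 * A = (real (k n) * A\<^sup>2) * A ^ 3"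
          unfolding rp by (simp add: eval_nat_numeral mult_ac)
        also have "\<dots> \<le> real n * real n"
          using kAn A1 nA(1) power_increasing[of 3 10 A] by (intro mult_mono) auto
        finally show ?thesis by (simp add: power2_eq_square)
      qed
      then have "real (k n) * real (p n) ^ 2 / real n ^ 2 \<le> 1 / A"
        using A1 rn by (simp add: field_simps)
      then have "C * t ^ 4 * (real (k n) * real (p n) ^ 2 / real n ^ 2) \<le> C * t ^ 4 * (1 / A)"
        using C by (intro mult_left_mono) auto
      moreover have "(s\<^sup>2 * real (p n))\<^sup>2 = t ^ 4 * (real (p n) ^ 2 / real n ^ 2)"
        using rn by (simp add: s_def power_divide power_mult_distrib power_mult[symmetric])
      ultimately show ?thesis by (simp add: mult_ac)
    qed
    show ?thesis
      using 1 e E1 E2 E3 E4 unfolding s_def[symmetric] Er_def A_def[symmetric] distrib_left by linarith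
  qed
  \<comment> \<open>The exponent of the Gaussian product equals \<open>t^2 / 2\<close> times the
    covered fraction of time, tending to 1, times the variance per step of a block, tending to
    \<open>v\<close>.\<close>
  define m where "m n = real (k n) * ((t / sqrt (real n))\<^sup>2 * V (p n) / 2)" for n
  have "(\<lambda>n. 1 - real (k n * p n) / real n) \<longlonglongrightarrow> 0"
  proof (rule Lim_null_comparison)
    show "\<forall>\<^sub>F n in sequentially. norm (1 - real (k n * p n) / real n) \<le> 3 / real (a n)"
      using eventually_ge_at_top[of 1] by eventually_elim (use bounds in auto)
    have "(\<lambda>x. 3 / real x) \<longlonglongrightarrow> 0" by real_asymp
    then show "(\<lambda>n. 3 / real (a n)) \<longlonglongrightarrow> 0" by (rule filterlim_compose[OF _ a_lim])
  qed
  then have "(\<lambda>n. 1 - (1 - real (k n * p n) / real n)) \<longlonglongrightarrow> 1 - 0" by (intro tendsto_intros)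
  then have r1: "(\<lambda>n. real (k n * p n) / real n) \<longlonglongrightarrow> 1" by simp
  have r2: "(\<lambda>n. V (p n) / real (p n)) \<longlonglongrightarrow> v"
    using filterlim_compose[OF v p_lim] by (simp add: V_def)
  have "(\<lambda>n. t\<^sup>2 / 2 * (real (k n * p n) / real n) * (V (p n) / real (p n))) \<longlonglongrightarrow> t\<^sup>2 / 2 * 1 * v"
    by (intro tendsto_intros r1 r2)
  moreover have "\<forall>\<^sub>F n in sequentially. t\<^sup>2 / 2 * (real (k n * p n) / real n) * (V (p n) / real (p n)) = m n"
    using eventually_ge_at_top[of 1] filterlim_at_top[THEN iffD1, OF p_lim, rule_format, of 1]
    by eventually_elim (simp add: m_def power_divide mult_ac)
  ultimately have "m \<longlonglongrightarrow> t\<^sup>2 / 2 * 1 * v" by (rule Lim_transform_eventually)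
  then have "m \<longlonglongrightarrow> t\<^sup>2 * v / 2" by simp
  then have main: "(\<lambda>n. exp (- complex_of_real (m n))) \<longlonglongrightarrow> exp (- complex_of_real (t\<^sup>2 * v / 2))"
    by (intro tendsto_intros)
  have "(\<lambda>n. (\<integral>x. iexp (t / sqrt (real n) * bsum h n x) \<partial>M) - exp (- complex_of_real (m n))) \<longlonglongrightarrow> 0"
  proof (rule Lim_null_comparison[OF _ Er0])
    show "\<forall>\<^sub>F n in sequentially. cmod ((\<integral>x. iexp (t / sqrt (real n) * bsum h n x) \<partial>M) - exp (- complex_of_real (m n))) \<le> Er (a n)"
      using eventually_ge_at_top[of 1] by eventually_elim (use bounds in \<open>simp only: m_def\<close>)
  qed
  from tendsto_add[OF this main] show ?thesis by simp
qed

end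

section \<open>Gibbs-Markov systems\<close>

lemma funpow_1: fixes f :: "'a \<Rightarrow> 'a" shows "f ^^ 1 = f"
  by simp

text \<open>The elements of \<open>\<alpha>\<close> as a sequence, with empty sets for the indices that do not occur.\<close>

definition atom :: "'a set set \<Rightarrow> 'a set \<Rightarrow> nat \<Rightarrow> 'a set" where
  "atom \<alpha> X i = {x\<in>X. \<exists>a\<in>\<alpha>. x \<in> a \<and> to_nat_on \<alpha> a = i}"

lemma atom_cases:
  assumes "countable \<alpha>"
  shows "atom \<alpha> X i = {} \<or> (\<exists>a\<in>\<alpha>. atom \<alpha> X i = a \<inter> X \<and> to_nat_on \<alpha> a = i)"
proof (cases "\<exists>a\<in>\<alpha>. to_nat_on \<alpha> a = i")
  case True
  then obtain a where a: "a \<in> \<alpha>" "to_nat_on \<alpha> a = i" by blast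
  have "b = a" if "b \<in> \<alpha>" "to_nat_on \<alpha> b = i" for b
    using inj_onD[OF inj_on_to_nat_on[OF assms], of b a] a that by simp
  then have "atom \<alpha> X i = a \<inter> X" using a unfolding atom_def by blast
  then show ?thesis using a by blast
qed (auto simp: atom_def)

lemma partition_mod_unique:
  "partition_mod M X \<alpha> \<Longrightarrow> a \<in> \<alpha> \<Longrightarrow> b \<in> \<alpha> \<Longrightarrow> x \<in> a \<Longrightarrow> x \<in> b \<Longrightarrow> x \<in> X \<Longrightarrow> a = b"
  unfolding partition_mod_def by blast

text \<open>The sets that contain or avoid each atom form a sigma-algebra on \<open>X\<close>. This
  yields the Markov property of images, and later puts each atom inside one element of
  \<open>\<beta>\<close>.\<close>

lemma sigma_mod_atoms:
  assumes \<alpha>: "partition_mod M X \<alpha>" and S: "S \<in> sigma_mod X \<alpha>"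
  shows "atom \<alpha> X j \<subseteq> S \<or> atom \<alpha> X j \<inter> S = {}"
  using S unfolding sigma_mod_def
proof induction
  case (Basic S)
  then obtain a where a: "a \<in> \<alpha>" "S = a \<inter> X" by auto
  have "countable \<alpha>" using \<alpha> by (simp add: partition_mod_def)
  then consider "atom \<alpha> X j = {}" | b where "b \<in> \<alpha>" "atom \<alpha> X j = b \<inter> X"
    using atom_cases[of \<alpha> X j] by blast
  then show ?case
  proof cases
    case (2 b)
    then show ?thesis using a partition_mod_unique[OF \<alpha> 2(1) a(1)] by (cases "a = b") auto
  qed simp
next
  case (Compl S)
  have "atom \<alpha> X j \<subseteq> X" by (auto simp: atom_def)
  then show ?case using Compl by blast
next
  case (Union S)
  then show ?case by blast
qed simp

text \<open>Points with the same first \<open>n\<close> symbols can differ at index \<open>n\<close>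
  at the earliest, which the definition counts as time \<open>n + 1\<close>.\<close>

lemma sep_dist_le:
  assumes \<alpha>: "partition_mod M X \<alpha>" and r: "0 < r" "r < 1"
    and x: "x \<in> cyl T X (atom \<alpha> X) q n" and y: "y \<in> cyl T X (atom \<alpha> X) q n"
  shows "sep_dist T \<alpha> r x y \<le> r ^ (n + 1)"
proof -
  have "enat (n + 1) \<le> separation_time T \<alpha> x y"
    unfolding separation_time_def
  proof (rule INF_greatest, clarify)
    fix m a b assume ab: "a \<in> \<alpha>" "b \<in> \<alpha>" "a \<noteq> b" "(T ^^ m) x \<in> a" "(T ^^ m) y \<in> b"
    have "\<not> m < n"
    proof
      assume "m < n"
      then have m: "(T ^^ m) x \<in> atom \<alpha> X (q m)" "(T ^^ m) y \<in> atom \<alpha> X (q m)"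
        using x y by (auto simp: cyl_def)
      then obtain c where c: "c \<in> \<alpha>" "atom \<alpha> X (q m) = c \<inter> X"
        using atom_cases[of \<alpha> X "q m"] \<alpha> unfolding partition_mod_def by auto
      then have "a = c" "b = c"
        using partition_mod_unique[OF \<alpha> ab(1) c(1) ab(4)] partition_mod_unique[OF \<alpha> ab(2) c(1) ab(5)] m by auto
      then show False using ab by simp
    qed
    then show "enat (n + 1) \<le> enat (m + 1)" by simp
  qed
  then show ?thesis
  proof (cases "separation_time T \<alpha> x y")
    case (enat k)
    then have "n + 1 \<le> k" using \<open>enat (n + 1) \<le> separation_time T \<alpha> x y\<close> by simp
    then have "r ^ k \<le> r ^ (n + 1)" by (rule power_decreasing) (use r in auto)
    then show ?thesis using enat by (simp add: sep_dist_def)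
  qed (use r in \<open>simp add: sep_dist_def\<close>)
qed

lemma sep_dist_nonneg: "0 < r \<Longrightarrow> 0 \<le> sep_dist T \<alpha> r x y"
  unfolding sep_dist_def by (auto split: enat.split)

text \<open>The derivative of the inverse branch is the density of the measure
  \<open>S \<mapsto> prob (A \<inter> T -\<close> S)\<open>on\<close>T \<open>A\<close>, so
  \<open>density_ratio\<close> turns the pointwise distortion bound into one for sets.\<close>

lemma (in prob_space) inverse_branch_density:
  assumes A: "A \<in> sets M" and inj: "inj_on T A" and T: "T \<in> measurable M M"
    and img: "\<And>B. B \<in> sets M \<Longrightarrow> B \<subseteq> A \<Longrightarrow> T ` B \<in> sets M \<and> (emeasure M (T ` B) = 0 \<longleftrightarrow> emeasure M B = 0)"
    and N: "N \<in> null_sets M" and c: "0 \<le> c"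
    and BB: "B \<in> sets M" "B' \<in> sets M" "B \<subseteq> T ` A" "B' \<subseteq> T ` A"
    and dist: "\<And>x y. x \<in> B - N \<Longrightarrow> y \<in> B' - N \<Longrightarrow>
      \<bar>inverse_branch_deriv M T 1 A x / inverse_branch_deriv M T 1 A y - 1\<bar> \<le> c"
  shows "prob (A \<inter> T -` B) * prob B' \<le> exp c * prob (A \<inter> T -` B') * prob B"
proof -
  have TA: "T ` A \<in> sets M" using img[OF A order_refl] by simp
  have sA: "A \<subseteq> space M" and sTA: "T ` A \<subseteq> space M" using A TA sets.sets_into_space by auto
  define Y where "Y = restrict_space M (T ` A)"
  have spY: "space Y = T ` A" using sTA by (auto simp: Y_def space_restrict_space)
  have setsY: "S \<in> sets Y \<longleftrightarrow> S \<subseteq> T ` A \<and> S \<in> sets M" for S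
    unfolding Y_def using TA sTA by (subst sets_restrict_space_iff) (auto simp: Int_absorb2)
  have emY: "emeasure Y S = emeasure M S" if "S \<subseteq> T ` A" for S
    unfolding Y_def using that TA sTA by (intro emeasure_restrict_space) (auto simp: Int_absorb2)
  interpret Y: finite_measure Y unfolding Y_def by (rule finite_measure_restrict_space[OF _ TA]) unfold_locales
  define R where "R = restrict_space M A"
  have spR: "space R = A" using sA by (auto simp: R_def space_restrict_space)
  have TY: "T \<in> measurable R Y"
    unfolding Y_def
    by (rule measurable_restrict_space2) (use spR T in \<open>auto simp: R_def intro: measurable_restrict_space1\<close>)
  define L where "L = distr R Y T"
  have inv: "A \<inter> T -` S \<in> sets M" if "S \<in> sets M" for S
  proof -
    have "A \<inter> T -` S = A \<inter> (T -` S \<inter> space M)" using sA by auto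
    then show ?thesis using A measurable_sets[OF T that] by auto
  qed
  have emL: "emeasure L S = emeasure M (A \<inter> T -` S)" if "S \<in> sets Y" for S
  proof -
    have "emeasure L S = emeasure R (T -` S \<inter> A)"
      unfolding L_def by (subst emeasure_distr[OF TY that]) (simp add: spR)
    also have "\<dots> = emeasure M (T -` S \<inter> A)"
      unfolding R_def using A sA by (intro emeasure_restrict_space) (auto simp: Int_absorb2)
    finally show ?thesis by (simp add: Int_commute)
  qed
  interpret L: finite_measure L
  proof (rule finite_measureI)
    have "emeasure L (space L) = emeasure M (A \<inter> T -` space Y)" unfolding L_def[symmetric]
      using emL[OF sets.top] by (simp add: L_def)
    then show "emeasure L (space L) \<noteq> \<infinity>" by simp
  qed
  have setsL: "sets L = sets Y" by (simp add: L_def)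
  \<comment> \<open>\<open>inverse_branch_deriv\<close> is stated through a set function on images;
    it agrees on measurable sets with the push-forward \<open>L\<close>, which is known to be a
    measure.\<close>
  have Leq: "measure_of (space Y) (sets Y) (\<lambda>B. emeasure M (inverse_branch T 1 A ` B)) = L"
  proof -
    have "measure_of (space Y) (sets Y) (\<lambda>B. emeasure M (inverse_branch T 1 A ` B)) =
        measure_of (space Y) (sets Y) (emeasure L)"
    proof (rule measure_of_eq)
      show "sets Y \<subseteq> Pow (space Y)" by (rule sets.space_closed)
      fix S assume "S \<in> sigma_sets (space Y) (sets Y)"
      then have S: "S \<in> sets Y" by (simp add: sets.sigma_sets_eq)
      have "inverse_branch T 1 A ` S = A \<inter> T -` S"
      proof -
        have "S = T ` (A \<inter> T -` S)" using S setsY by auto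
        moreover have "the_inv_into A T ` T ` C = C" if "C \<subseteq> A" for C
          using that the_inv_into_f_f[OF inj] by (force simp: image_image)
        ultimately show ?thesis unfolding inverse_branch_def funpow_1 by (metis Int_lower1)
      qed
      then show "emeasure M (inverse_branch T 1 A ` S) = emeasure L S" using emL[OF S] by simp
    qed
    also have "\<dots> = L" using measure_of_of_measure[of L] setsL sets_eq_imp_space_eq[OF setsL] by simp
    finally show ?thesis .
  qed
  have null: "emeasure L S = 0 \<longleftrightarrow> emeasure Y S = 0" if S: "S \<in> sets Y" for S
  proof -
    have "T ` (A \<inter> T -` S) = S" using S setsY by auto
    then show ?thesis using img[OF inv[of S]] S setsY by (auto simp: emL[OF S] emY)
  qed
  have ac: "absolutely_continuous Y L"
    unfolding absolutely_continuous_def using null setsL by (auto simp: null_sets_def)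
  define w where "w = RN_deriv Y L"
  have w [measurable]: "w \<in> borel_measurable Y" by (simp add: w_def)
  have dens: "density Y w = L" unfolding w_def by (rule Y.density_RN_deriv[OF ac setsL])
  have intw: "(\<integral>\<^sup>+x. w x * indicator S x \<partial>Y) = ennreal (prob (A \<inter> T -` S))" if S: "S \<in> sets Y" for S
  proof -
    have "(\<integral>\<^sup>+x. w x * indicator S x \<partial>Y) = emeasure (density Y w) S" by (rule emeasure_density[symmetric]) (use S in auto)
    then show ?thesis by (simp add: dens emL[OF S] emeasure_eq_measure)
  qed
  have fin: "AE x in Y. w x \<noteq> \<infinity>"
    unfolding w_def by (rule Y.RN_deriv_finite[OF _ ac setsL]) unfold_locales
  \<comment> \<open>Where \<open>w\<close> is 0 or infinite, \<open>enn2real\<close> gives 0 and the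
    real quotient says nothing about \<open>w\<close>. Two-sided nonsingularity makes the zeros a
    null set, finiteness of \<open>L\<close> the infinite values.\<close>
  have pos: "AE x in Y. w x \<noteq> 0"
  proof -
    let ?Z = "{x\<in>space Y. w x = 0}"
    have Z: "?Z \<in> sets Y" by measurable
    have "emeasure L ?Z = (\<integral>\<^sup>+x. w x * indicator ?Z x \<partial>Y)"
      unfolding dens[symmetric] by (rule emeasure_density) (use Z in auto)
    also have "\<dots> = 0" by (subst nn_integral_0_iff_AE) (auto split: split_indicator)
    finally have "emeasure Y ?Z = 0" using null[OF Z] by simp
    then show ?thesis using Z by (auto intro!: AE_I[where N="?Z"])
  qed
  from fin pos have "AE x in Y. w x \<noteq> \<infinity> \<and> w x \<noteq> 0" by eventually_elim simp
  then obtain N2 where N2: "\<And>x. x \<in> space Y - N2 \<Longrightarrow> w x \<noteq> \<infinity> \<and> w x \<noteq> 0" "N2 \<in> null_sets Y"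
    using that by (rule AE_E3) auto
  define N3 where "N3 = (N \<inter> T ` A) \<union> N2"
  have "N \<inter> T ` A \<in> null_sets Y"
    unfolding Y_def using N TA by (subst null_sets_restrict_space) (auto intro: null_set_Int2)
  then have N3: "N3 \<in> null_sets Y" unfolding N3_def by (intro null_sets.Un N2(2))
  have deriv: "inverse_branch_deriv M T 1 A x = enn2real (w x)" for x
    unfolding inverse_branch_deriv_def Let_def funpow_1 Y_def[symmetric] Leq w_def[symmetric] ..
  have sB: "B \<in> sets Y" "B' \<in> sets Y" using BB setsY by auto
  have "(\<integral>\<^sup>+x. w x * indicator B x \<partial>Y) * emeasure Y B' \<le> ennreal (exp c) * (\<integral>\<^sup>+x. w x * indicator B' x \<partial>Y) * emeasure Y B"
  proof (rule density_ratio[OF w sB N3])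
    fix x y assume xy: "x \<in> B - N3" "y \<in> B' - N3"
    then have "x \<in> B - N" "y \<in> B' - N" and xyY: "x \<in> space Y - N2" "y \<in> space Y - N2"
      using BB by (auto simp: N3_def spY)
    then have d: "\<bar>enn2real (w x) / enn2real (w y) - 1\<bar> \<le> c" using dist deriv by simp
    obtain u where u: "w x = ennreal u" "0 \<le> u" using N2(1)[OF xyY(1)] by (cases "w x") auto
    obtain v where v: "w y = ennreal v" "0 < v" using N2(1)[OF xyY(2)] by (cases "w y") (auto simp: order.order_iff_strict)
    have "u / v \<le> 1 + c" using d u v by simp
    then have "u \<le> (1 + c) * v" using v by (simp add: pos_divide_le_eq)
    also have "\<dots> \<le> exp c * v" using v by (intro mult_right_mono exp_ge_add_one_self) auto
    finally show "w x \<le> ennreal (exp c) * w y" using u v by (simp add: ennreal_mult[symmetric] ennreal_leI)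
  qed
  then show ?thesis
    unfolding intw[OF sB(1)] intw[OF sB(2)] emY[OF BB(3)] emY[OF BB(4)] emeasure_eq_measure
    by (simp add: ennreal_mult[symmetric])
qed

text \<open>The constants of the locale are the infimum of the image measures and the distortion
  constant. The exponent \<open>n + 1\<close> in \<open>dist\<close> is the separation time of
  points in a common \<open>n\<close>-cylinder.\<close>

lemma gibbs_markov_atoms:
  assumes gm: "gibbs_markov M T \<alpha> r X" and mp: "measure_preserving M T" and mix: "topologically_mixing T \<alpha> X"
  shows "\<exists>\<delta> D. markov_system M T X (atom \<alpha> X) r \<delta> D"
proof -
  let ?P = "atom \<alpha> X"
  note c0 = gm[unfolded gibbs_markov_def]
  note c2 = c0[THEN conjunct2, THEN conjunct2]
  note c4 = c2[THEN conjunct2, THEN conjunct2]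
  note c7 = c4[THEN conjunct2, THEN conjunct2, THEN conjunct2]
  note std = c0[THEN conjunct1] and inv = c2[THEN conjunct1] and part = c2[THEN conjunct2, THEN conjunct1]
    and r = c4[THEN conjunct1] c4[THEN conjunct2, THEN conjunct1]
    and branch = c7[THEN conjunct1, rule_format] and bigim = c7[THEN conjunct2, THEN conjunct1]
  have "\<exists>C>0. \<forall>n\<ge>1. \<forall>a\<in>cylinders T \<alpha> X n. \<exists>N\<in>null_sets M.
        \<forall>x\<in>(T ^^ n) ` a - N. \<forall>y\<in>(T ^^ n) ` a - N.
          \<bar>inverse_branch_deriv M T n a x / inverse_branch_deriv M T n a y - 1\<bar> \<le> C * sep_dist T \<alpha> r x y"
    by (rule c7[THEN conjunct2, THEN conjunct2])
  then obtain C where C: "C > 0" and dist: "\<And>n a. n \<ge> 1 \<Longrightarrow> a \<in> cylinders T \<alpha> X n \<Longrightarrow> \<exists>N\<in>null_sets M.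
        \<forall>x\<in>(T ^^ n) ` a - N. \<forall>y\<in>(T ^^ n) ` a - N.
          \<bar>inverse_branch_deriv M T n a x / inverse_branch_deriv M T n a y - 1\<bar> \<le> C * sep_dist T \<alpha> r x y"
    by (elim exE conjE) metis
  interpret prob_space M using std by (simp add: standard_prob_space_def)
  have T: "T \<in> measurable M M" "distr M M T = M" using mp by (auto simp: measure_preserving_def)
  have X: "X \<in> sets M" "space M - X \<in> null_sets M" "T ` X \<subseteq> X" using inv by (auto simp: full_invariant_def)
  have \<alpha>: "countable \<alpha>" "\<alpha> \<subseteq> sets M" "X \<subseteq> \<Union>\<alpha>" "\<And>a b. a \<in> \<alpha> \<Longrightarrow> b \<in> \<alpha> \<Longrightarrow> a \<noteq> b \<Longrightarrow> a \<inter> b \<inter> X = {}"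
    using part by (auto simp: partition_mod_def)
  have cases: "?P i = {} \<or> (\<exists>a\<in>\<alpha>. ?P i = a \<inter> X)" for i using atom_cases[OF \<alpha>(1)] by blast
  have Un: "(\<Union>i. ?P i) = X" using \<alpha>(3) unfolding atom_def by blast
  define \<delta> where "\<delta> = enn2real (INF a\<in>\<alpha>. emeasure M (T ` (a \<inter> X)))"
  have X1: "prob X = 1"
  proof -
    have "prob (space M - X) = 0" using X(2) by (auto simp: null_sets_def measure_def)
    then show ?thesis using prob_compl[OF X(1)] by simp
  qed
  \<comment> \<open>A nonempty \<open>\<alpha>\<close> is needed because an empty infimum is
    infinite, which \<open>enn2real\<close> sends to 0.\<close>
  have "X \<noteq> {}" using X1 by auto
  then obtain a0 where a0: "a0 \<in> \<alpha>" using \<alpha>(3) by auto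
  have \<delta>le: "\<delta> \<le> prob (T ` (a \<inter> X))" if "a \<in> \<alpha>" for a
  proof -
    have "(INF a\<in>\<alpha>. emeasure M (T ` (a \<inter> X))) \<le> emeasure M (T ` (a \<inter> X))" by (rule INF_lower[OF that])
    then show ?thesis unfolding \<delta>_def measure_def by (rule enn2real_mono) (simp add: less_top[symmetric])
  qed
  have \<delta>: "0 < \<delta>"
  proof -
    have "(INF a\<in>\<alpha>. emeasure M (T ` (a \<inter> X))) \<le> emeasure M (T ` (a0 \<inter> X))" by (rule INF_lower[OF a0])
    also have "\<dots> < \<infinity>" by (simp add: less_top[symmetric])
    finally show ?thesis unfolding \<delta>_def using bigim by (simp add: enn2real_positive_iff)
  qed
  have "markov_system M T X ?P r \<delta> C"
  proof unfold_locales
    show "T \<in> measurable M M" "distr M M T = M" "X \<in> sets M" "prob X = 1" "(\<Union>i. ?P i) = X"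
      "0 < \<delta>" "0 < r" "r < 1" "0 \<le> C"
      using T X X1 Un \<delta> r C by auto
    show "T x \<in> X" if "x \<in> X" for x using X(3) that by auto
    show "?P i \<in> sets M" for i
    proof -
      consider "?P i = {}" | a where "a \<in> \<alpha>" "?P i = a \<inter> X" using cases by blast
      then show ?thesis by cases (use X \<alpha>(2) in auto)
    qed
    show "disjoint_family ?P"
    proof (unfold disjoint_family_on_def, intro ballI impI)
      fix i j :: nat assume ij: "i \<noteq> j"
      show "?P i \<inter> ?P j = {}"
      proof (rule ccontr)
        assume "?P i \<inter> ?P j \<noteq> {}"
        then obtain x a b where "x \<in> X" "a \<in> \<alpha>" "b \<in> \<alpha>" "x \<in> a" "x \<in> b" "to_nat_on \<alpha> a = i" "to_nat_on \<alpha> b = j"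
          by (auto simp: atom_def)
        then show False using ij \<alpha>(4)[of a b] by auto
      qed
    qed
    show "T ` B \<in> sets M" if "B \<in> sets M" "B \<subseteq> ?P i" for i B
    proof -
      consider "?P i = {}" | a where "a \<in> \<alpha>" "?P i = a \<inter> X" using cases by blast
      then show ?thesis by cases (use branch that in auto)
    qed
    show "prob (T ` B) = 0 \<longleftrightarrow> prob B = 0" if "B \<in> sets M" "B \<subseteq> ?P i" for i B
    proof -
      consider "?P i = {}" | a where "a \<in> \<alpha>" "?P i = a \<inter> X" using cases by blast
      then have "emeasure M (T ` B) = 0 \<longleftrightarrow> emeasure M B = 0" by cases (use branch that in auto)
      then show ?thesis by (simp add: emeasure_eq_measure)
    qed
    show "?P j \<subseteq> T ` ?P i \<or> ?P j \<inter> T ` ?P i = {}" for i j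
    proof -
      consider "?P i = {}" | a where "a \<in> \<alpha>" "?P i = a \<inter> X" using cases by blast
      then show ?thesis by cases (use branch sigma_mod_atoms[OF part] in auto)
    qed
    show "\<delta> \<le> prob (T ` ?P i)" if "?P i \<noteq> {}" for i
      using cases[of i] that \<delta>le by auto
    show "\<exists>m. \<forall>n>m. ?P j \<subseteq> (T ^^ n) ` ?P i" if ne: "?P i \<noteq> {}" "?P j \<noteq> {}" for i j
    proof -
      obtain a b where "a \<in> \<alpha>" "?P i = a \<inter> X" "b \<in> \<alpha>" "?P j = b \<inter> X" using cases[of i] cases[of j] ne by blast
      then show ?thesis using mix unfolding topologically_mixing_def by simp
    qed
    show "prob (?P i \<inter> T -` B) * prob B' \<le> exp (C * r ^ (n + 1)) * prob (?P i \<inter> T -` B') * prob B"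
      if B: "B \<in> sets M" "B' \<in> sets M" and BC: "B \<subseteq> cyl T X ?P q n \<inter> T ` ?P i" "B' \<subseteq> cyl T X ?P q n \<inter> T ` ?P i"
      for i q n B B'
    proof -
      consider "?P i = {}" | a where "a \<in> \<alpha>" "?P i = a \<inter> X" using cases by blast
      then show ?thesis
      proof cases
        case (2 a)
        have "a \<inter> X \<in> cylinders T \<alpha> X 1"
          unfolding cylinders_def using 2(1) by (auto intro!: exI[of _ "\<lambda>_. a"])
        then obtain N where N: "N \<in> null_sets M" "\<And>x y. x \<in> T ` (a \<inter> X) - N \<Longrightarrow> y \<in> T ` (a \<inter> X) - N \<Longrightarrow>
          \<bar>inverse_branch_deriv M T 1 (a \<inter> X) x / inverse_branch_deriv M T 1 (a \<inter> X) y - 1\<bar> \<le> C * sep_dist T \<alpha> r x y"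
          using dist[of 1 "a \<inter> X"] unfolding funpow_1 by blast
        show ?thesis unfolding 2(2)
        proof (rule inverse_branch_density[OF _ _ T(1) _ N(1)])
          show "a \<inter> X \<in> sets M" using 2(1) \<alpha>(2) X by auto
          show "inj_on T (a \<inter> X)" using branch[OF 2(1)] by blast
          show "T ` B \<in> sets M \<and> (emeasure M (T ` B) = 0 \<longleftrightarrow> emeasure M B = 0)"
            if "B \<in> sets M" "B \<subseteq> a \<inter> X" for B using branch[OF 2(1)] that by blast
          show "0 \<le> C * r ^ (n + 1)" using C r by simp
          show "B \<subseteq> T ` (a \<inter> X)" "B' \<subseteq> T ` (a \<inter> X)" using BC 2(2) by auto
          fix x y assume xy: "x \<in> B - N" "y \<in> B' - N"
          then have "\<bar>inverse_branch_deriv M T 1 (a \<inter> X) x / inverse_branch_deriv M T 1 (a \<inter> X) y - 1\<bar> \<le> C * sep_dist T \<alpha> r x y"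
            using BC 2(2) by (intro N(2)) auto
          also have "\<dots> \<le> C * r ^ (n + 1)"
            using xy BC C by (intro mult_left_mono sep_dist_le[OF part r]) auto
          finally show "\<bar>inverse_branch_deriv M T 1 (a \<inter> X) x / inverse_branch_deriv M T 1 (a \<inter> X) y - 1\<bar> \<le> C * r ^ (n + 1)" .
        qed (use B in auto)
      qed simp
    qed
  qed
  then show ?thesis by blast
qed

text \<open>As \<open>\<beta>\<close> consists of unions of atoms modulo \<open>X\<close>, two
  points of one cylinder of positive length share an element of \<open>\<beta>\<close>, and
  \<open>D_seminorm\<close> bounds their difference by \<open>H * sep_dist\<close>.\<close>

lemma L_norm_lip:
  assumes ms: "markov_system M T X (atom \<alpha> X) r \<delta> D"
    and part: "partition_mod M X \<alpha>" and \<beta>: "partition_mod M X \<beta>"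
    and \<beta>\<alpha>: "\<And>b. b \<in> \<beta> \<Longrightarrow> b \<inter> X \<in> sigma_mod X \<alpha>"
    and g [measurable]: "g \<in> borel_measurable M"
    and L: "L_norm M T \<alpha> r \<beta> (\<lambda>x. complex_of_real (g x)) < ennreal H"
  shows "markov_system.lip M T X (atom \<alpha> X) r H g"
proof -
  interpret markov_system M T X "atom \<alpha> X" r \<delta> D by (rule ms)
  let ?g = "\<lambda>x. complex_of_real (g x)"
  have H: "0 < H" using L by (metis ennreal_eq_0_iff not_less_zero not_le_imp_less)
  have ess: "esssup M (\<lambda>x. ennreal (cmod (?g x))) \<le> ennreal H" and Ds: "D_seminorm M T \<alpha> r \<beta> ?g < ennreal H"
  proof -
    let ?e = "esssup M (\<lambda>x. ennreal (cmod (?g x)))"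
    have "?e \<le> ?e + D_seminorm M T \<alpha> r \<beta> ?g" by (rule add_increasing2[OF zero_le order_refl])
    then show "?e \<le> ennreal H" using L unfolding L_norm_def by (rule order_trans[OF _ less_imp_le])
    have "D_seminorm M T \<alpha> r \<beta> ?g \<le> ?e + D_seminorm M T \<alpha> r \<beta> ?g" by (rule add_increasing[OF zero_le order_refl])
    then show "D_seminorm M T \<alpha> r \<beta> ?g < ennreal H" using L unfolding L_norm_def by (rule le_less_trans)
  qed
  have "AE x in M. \<bar>g x\<bar> \<le> H"
    using esssup_AE[of "\<lambda>x. ennreal (cmod (?g x))" M]
  proof (rule eventually_mono)
    fix x assume "ennreal (cmod (?g x)) \<le> esssup M (\<lambda>x. ennreal (cmod (?g x)))"
    then have "ennreal (cmod (?g x)) \<le> ennreal H" using ess by (rule order_trans)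
    then show "\<bar>g x\<bar> \<le> H" using H by simp
  qed
  then obtain N1 where N1: "\<And>x. x \<in> space M - N1 \<Longrightarrow> \<bar>g x\<bar> \<le> H" "N1 \<in> null_sets M"
    using that by (rule AE_E3) auto
  \<comment> \<open>The strict inequality yields an actual null set although the seminorm is an
    infimum over null sets.\<close>
  obtain N2 where N2: "N2 \<in> null_sets M" and
    sup: "(SUP b\<in>\<beta>. SUP x\<in>b - N2. SUP y\<in>b - N2 - {x}. ennreal (cmod (?g x - ?g y)) / ennreal (sep_dist T \<alpha> r x y)) < ennreal H"
    using Ds unfolding D_seminorm_def INF_less_iff by blast
  have "\<bar>g x - g y\<bar> \<le> H * r ^ n"
    if n: "n \<ge> 1" and x: "x \<in> Cyl q n - (N1 \<union> N2)" and y: "y \<in> Cyl q n - (N1 \<union> N2)" for n q x y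
  proof (cases "x = y")
    case True then show ?thesis using H r_pos by simp
  next
    case False
    have xy: "x \<in> atom \<alpha> X (q 0)" "y \<in> atom \<alpha> X (q 0)" "x \<in> X" using x y n by (force simp: cyl_def)+
    obtain b where b: "b \<in> \<beta>" "x \<in> b" using xy(3) \<beta> by (auto simp: partition_mod_def)
    have "atom \<alpha> X (q 0) \<subseteq> b \<inter> X" using sigma_mod_atoms[OF part \<beta>\<alpha>[OF b(1)], of "q 0"] b xy by blast
    then have yb: "y \<in> b" using xy by auto
    let ?s = "sep_dist T \<alpha> r x y"
    have "ennreal (cmod (?g x - ?g y)) / ennreal ?s \<le>
      (SUP b\<in>\<beta>. SUP x\<in>b - N2. SUP y\<in>b - N2 - {x}. ennreal (cmod (?g x - ?g y)) / ennreal (sep_dist T \<alpha> r x y))"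
      by (rule SUP_upper2[OF b(1)], rule SUP_upper2[of x], use b x in blast, rule SUP_upper, use yb y False in blast)
    then have q: "ennreal (cmod (?g x - ?g y)) / ennreal ?s < ennreal H" using sup by (rule le_less_trans)
    have c: "cmod (?g x - ?g y) = \<bar>g x - g y\<bar>" by (metis norm_of_real of_real_diff)
    have s: "?s \<le> r ^ n"
    proof -
      have "?s \<le> r ^ (n + 1)" by (rule sep_dist_le[OF part r_pos r_less]) (use x y in auto)
      also have "\<dots> \<le> r ^ n" using r_pos r_less by (intro power_decreasing) auto
      finally show ?thesis .
    qed
    show ?thesis
    \<comment> \<open>At distance 0 the quotient is infinite unless the values agree, so a finite
      seminorm forces equality.\<close>
    proof (cases "?s = 0")
      case True
      then have "\<bar>g x - g y\<bar> = 0" using q unfolding c by (cases "\<bar>g x - g y\<bar> = 0") (auto simp: ennreal_divide_eq_top_iff)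
      then show ?thesis using H r_pos by simp
    next
      case False
      then have sp: "0 < ?s" using sep_dist_nonneg[OF r_pos] by (metis less_eq_real_def)
      then have "\<bar>g x - g y\<bar> / ?s < H" using q H unfolding c by (simp add: divide_ennreal ennreal_less_iff)
      then have "\<bar>g x - g y\<bar> \<le> H * ?s" using sp by (simp add: pos_divide_less_eq)
      also have "\<dots> \<le> H * r ^ n" using s H by simp
      finally show ?thesis .
    qed
  qed
  moreover have "\<bar>g x\<bar> \<le> H" if "x \<in> space M - (N1 \<union> N2)" for x using N1(1)[of x] that by auto
  ultimately show ?thesis
    unfolding lip_def using null_sets.Un[OF N1(2) N2]
    by (intro conjI bexI[of _ "N1 \<union> N2"]) (auto simp del: Un_iff)
qed

section \<open>Series of Lipschitz functions\<close>

text \<open>The interchange of limits that is possible because the approximation error is uniform in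
  \<open>n\<close>.\<close>

lemma uniform_approx_tendsto:
  fixes a :: "nat \<Rightarrow> 'a :: real_normed_vector"
  assumes ab: "\<And>m n. norm (a n - b m n) \<le> \<epsilon> m" and \<epsilon>: "\<epsilon> \<longlonglongrightarrow> 0"
    and b: "\<And>m. b m \<longlonglongrightarrow> l m" and l: "l \<longlonglongrightarrow> L"
  shows "a \<longlonglongrightarrow> L"
proof (rule LIMSEQ_I)
  fix e :: real assume e: "0 < e"
  have "\<forall>\<^sub>F m in sequentially. \<epsilon> m < e / 3" by (rule order_tendstoD[OF \<epsilon>]) (use e in simp)
  moreover have "\<forall>\<^sub>F m in sequentially. dist (l m) L < e / 3" by (rule tendstoD[OF l]) (use e in simp)
  ultimately have "\<forall>\<^sub>F m in sequentially. \<epsilon> m < e / 3 \<and> dist (l m) L < e / 3" by eventually_elim simp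
  then obtain m where m: "\<epsilon> m < e / 3" "dist (l m) L < e / 3" by (auto simp: eventually_sequentially)
  obtain N where N: "\<And>n. n \<ge> N \<Longrightarrow> norm (b m n - l m) < e / 3" using LIMSEQ_D[OF b[of m], of "e / 3"] e by auto
  have "norm (a n - L) < e" if "n \<ge> N" for n
  proof -
    have "a n - L = (a n - b m n) + ((b m n - l m) + (l m - L))" by simp
    then have "norm (a n - L) \<le> norm (a n - b m n) + (norm (b m n - l m) + norm (l m - L))"
      by (metis norm_triangle_mono order_refl)
    then show ?thesis using ab[of n m] m N[OF that] by (simp add: dist_norm)
  qed
  then show "\<exists>no. \<forall>n\<ge>no. norm (a n - L) < e" by blast
qed

context markov_system
begin

lemma bsum_diff: "bsum f n x - bsum g n x = bsum (\<lambda>x. f x - g x) n x"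
  by (simp add: bsum_def sum_subtractf)

lemma bsum_sum: "bsum (\<lambda>x. \<Sum>k\<in>A. h k x) n x = (\<Sum>k\<in>A. bsum (h k) n x)"
  unfolding bsum_def by (rule sum.swap)

lemma bsum_integrable: "integrable M f \<Longrightarrow> integrable M (bsum f n)"
  unfolding bsum_def[abs_def] by (intro Bochner_Integration.integrable_sum integrable_Tn)

lemma bsum_L1: assumes f: "integrable M f"
  shows "(\<integral>x. \<bar>bsum f n x\<bar> \<partial>M) \<le> real n * (\<integral>x. \<bar>f x\<bar> \<partial>M)"
proof -
  have m: "(\<lambda>x. \<bar>f x\<bar>) \<in> borel_measurable M" using f by simp
  have "(\<integral>x. \<bar>bsum f n x\<bar> \<partial>M) \<le> (\<integral>x. (\<Sum>j<n. \<bar>f ((T ^^ j) x)\<bar>) \<partial>M)"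
  proof (rule integral_mono)
    show "integrable M (\<lambda>x. \<Sum>j<n. \<bar>f ((T ^^ j) x)\<bar>)"
      using f by (intro Bochner_Integration.integrable_sum integrable_abs integrable_Tn)
    show "integrable M (\<lambda>x. \<bar>bsum f n x\<bar>)" by (intro integrable_abs bsum_integrable f)
  qed (auto simp: bsum_def sum_abs)
  also have "\<dots> = (\<Sum>j<n. \<integral>x. \<bar>f ((T ^^ j) x)\<bar> \<partial>M)"
    using f by (intro Bochner_Integration.integral_sum integrable_abs integrable_Tn)
  also have "\<dots> = real n * (\<integral>x. \<bar>f x\<bar> \<partial>M)" by (simp add: integral_Tn[OF m])
  finally show ?thesis .
qed

text \<open>No Minkowski inequality is needed: the Birkhoff sums of the tail are estimated in \<open>L\<^sup>1\<close>, and the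
  variances \<open>v m\<close> of the partial sums converge since their characteristic functions do.\<close>

lemma clt_series:
  assumes lip: "\<And>k. k \<ge> 1 \<Longrightarrow> lip C0 (h k)" and C0: "0 < C0"
    and h0: "\<And>k. k \<ge> 1 \<Longrightarrow> (\<integral>x. h k x \<partial>M) = 0"
    and summ: "summable (\<lambda>k. sqrt (\<integral>x. \<bar>h (Suc k) x\<bar> \<partial>M))"
    and f: "integrable M f"
    and conv: "(\<lambda>n. \<integral>x. \<bar>f x - (\<Sum>k=1..n. h k x)\<bar> \<partial>M) \<longlonglongrightarrow> 0"
    and c: "0 < c"
    and var: "\<And>n v. n \<ge> 1 \<Longrightarrow> (\<lambda>N. (\<integral>x. (bsum (\<lambda>x. \<Sum>k=1..n. h k x) N x)\<^sup>2 \<partial>M) / real N) \<longlonglongrightarrow> v \<Longrightarrow> c \<le> v"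
  shows "\<exists>w>0. \<forall>s. (\<lambda>n. \<integral>x. iexp (s / sqrt (real n) * bsum f n x) \<partial>M) \<longlonglongrightarrow> exp (- complex_of_real (s\<^sup>2 * w / 2))"
proof -
  \<comment> \<open>The shift by one makes every index \<open>m\<close> a partial sum with at least
    one term. The Lipschitz constant of \<open>F m\<close> grows with \<open>m\<close>, harmless
    since \<open>clt_lip\<close> is used for fixed \<open>m\<close> only.\<close>
  define F where "F m x = (\<Sum>k=1..Suc m. h k x)" for m x
  have F_lip: "lip (real (Suc m) * C0) (F m)" for m
  proof -
    have "lip (\<Sum>k=1..Suc m. C0) (\<lambda>x. \<Sum>k=1..Suc m. h k x)" by (rule lip_sum) (auto intro: lip)
    then show ?thesis by (simp add: F_def[abs_def])
  qed
  have F_pos: "0 < real (Suc m) * C0" for m using C0 by simp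
  have F0: "(\<integral>x. F m x \<partial>M) = 0" for m
    unfolding F_def by (subst Bochner_Integration.integral_sum) (auto intro!: lip_integrable[OF lip] simp: h0)
  have F_int: "integrable M (F m)" for m by (rule lip_integrable[OF F_lip])
  have [measurable]: "F m \<in> borel_measurable M" for m by (rule lip_meas[OF F_lip])
  have [measurable]: "f \<in> borel_measurable M" using f by simp
  have "\<forall>m. \<exists>v. (\<lambda>N. (\<integral>x. (bsum (F m) N x)\<^sup>2 \<partial>M) / real N) \<longlonglongrightarrow> v"
    by (intro allI variance_converges[OF F_lip F_pos F0])
  from choice[OF this] obtain v where v: "\<And>m. (\<lambda>N. (\<integral>x. (bsum (F m) N x)\<^sup>2 \<partial>M) / real N) \<longlonglongrightarrow> v m"
    by blast
  have v_ge: "c \<le> v m" for m using var[of "Suc m" "v m"] v[of m] by (simp add: F_def[abs_def])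
  define \<Phi> where "\<Phi> u s n = (\<integral>x. iexp (s / sqrt (real n) * bsum u n x) \<partial>M)" for u s n
  have clt: "\<Phi> (F m) s \<longlonglongrightarrow> exp (- complex_of_real (s\<^sup>2 * v m / 2))" for m s
    unfolding \<Phi>_def by (rule clt_lip[OF F_lip F_pos F0 v])
  obtain C where C: "C \<ge> 0" and vb: "\<And>H h J. lip H h \<Longrightarrow> 0 < H \<Longrightarrow> (\<integral>x. h x \<partial>M) = 0 \<Longrightarrow> finite J \<Longrightarrow>
     (\<integral>x. (\<Sum>j\<in>J. h ((T ^^ j) x))\<^sup>2 \<partial>M) \<le> C * H * (\<integral>x. \<bar>h x\<bar> \<partial>M) * card J"
    using variance_bound by blast
  define B where "B = sqrt (C * C0)"
  have B: "0 \<le> B" using C C0 by (simp add: B_def)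
  define e where "e k = sqrt (\<integral>x. \<bar>h k x\<bar> \<partial>M)" for k
  have e0: "0 \<le> e k" for k by (simp add: e_def)
  \<comment> \<open>The scale \<open>sqrt n\<close> comes with the factor \<open>e k\<close>, the
    square root of the \<open>L^1\<close> norm, while the Lipschitz constant is the common
    \<open>C0\<close>; hence the sum over \<open>k\<close> converges uniformly in
    \<open>n\<close>.\<close>
  have h_L1: "(\<integral>x. \<bar>bsum (h k) n x\<bar> \<partial>M) \<le> sqrt (real n) * (B * e k)" if k: "k \<ge> 1" for k n
  proof -
    have [measurable]: "h k \<in> borel_measurable M" by (rule lip_meas[OF lip[OF k]])
    have "(\<integral>x. \<bar>bsum (h k) n x\<bar> \<partial>M) \<le> sqrt (\<integral>x. (bsum (h k) n x)\<^sup>2 \<partial>M)"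
      by (rule abs_expectation_le_sqrt(2)) (auto intro: bsum_square(1)[OF lip[OF k]])
    also have "\<dots> \<le> sqrt (C * C0 * (\<integral>x. \<bar>h k x\<bar> \<partial>M) * real n)"
      using vb[OF lip[OF k] C0 h0[OF k], of "{..<n}"] by (intro real_sqrt_le_mono) (simp add: bsum_def)
    also have "\<dots> = sqrt (real n) * (B * e k)" by (simp add: real_sqrt_mult B_def e_def mult_ac)
    finally show ?thesis .
  qed
  define \<tau> where "\<tau> m = (\<Sum>k. e (Suc (k + Suc m)))" for m
  have summ_e: "summable (\<lambda>k. e (Suc k))" using summ by (simp add: e_def)
  have summ_t: "summable (\<lambda>k. e (Suc (k + Suc m)))" for m
    using summable_ignore_initial_segment[OF summ_e, of "Suc m"] by simp
  have \<tau>0: "\<tau> \<longlonglongrightarrow> 0"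
  proof -
    have "(\<lambda>m. \<Sum>k. e (Suc (k + m))) \<longlonglongrightarrow> 0" by (rule suminf_exist_split2[OF summ_e])
    then show ?thesis unfolding \<tau>_def by (rule LIMSEQ_Suc)
  qed
  have FF: "(\<integral>x. \<bar>bsum (F m') n x - bsum (F m) n x\<bar> \<partial>M) \<le> sqrt (real n) * (B * \<tau> m)" if "m \<le> m'" for m m' n
  proof -
    have hi: "integrable M (\<lambda>x. \<bar>bsum (h k) n x\<bar>)" if "k \<in> {Suc (Suc m)..Suc m'}" for k
      using that by (intro integrable_abs bsum_integrable lip_integrable[OF lip]) auto
    have "F m' x - F m x = (\<Sum>k=Suc (Suc m)..Suc m'. h k x)" for x
    proof -
      have "{1..Suc m'} = {1..Suc m} \<union> {Suc (Suc m)..Suc m'}" using that by auto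
      then show ?thesis unfolding F_def by (simp add: sum.union_disjoint)
    qed
    then have dec: "bsum (F m') n x - bsum (F m) n x = (\<Sum>k=Suc (Suc m)..Suc m'. bsum (h k) n x)" for x
      unfolding bsum_diff bsum_sum[symmetric] by (simp only:)
    have "(\<integral>x. \<bar>bsum (F m') n x - bsum (F m) n x\<bar> \<partial>M) \<le> (\<integral>x. (\<Sum>k=Suc (Suc m)..Suc m'. \<bar>bsum (h k) n x\<bar>) \<partial>M)"
    proof (rule integral_mono)
      show "integrable M (\<lambda>x. \<bar>bsum (F m') n x - bsum (F m) n x\<bar>)"
        by (intro integrable_abs Bochner_Integration.integrable_diff bsum_integrable F_int)
      show "integrable M (\<lambda>x. \<Sum>k=Suc (Suc m)..Suc m'. \<bar>bsum (h k) n x\<bar>)"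
        by (intro Bochner_Integration.integrable_sum hi)
      show "\<bar>bsum (F m') n x - bsum (F m) n x\<bar> \<le> (\<Sum>k=Suc (Suc m)..Suc m'. \<bar>bsum (h k) n x\<bar>)" for x
        unfolding dec by (rule sum_abs)
    qed
    also have "\<dots> = (\<Sum>k=Suc (Suc m)..Suc m'. \<integral>x. \<bar>bsum (h k) n x\<bar> \<partial>M)"
      by (rule Bochner_Integration.integral_sum) (rule hi)
    also have "\<dots> \<le> (\<Sum>k=Suc (Suc m)..Suc m'. sqrt (real n) * (B * e k))" by (intro sum_mono h_L1) auto
    also have "\<dots> = sqrt (real n) * (B * (\<Sum>k=Suc (Suc m)..Suc m'. e k))" by (simp only: sum_distrib_left)
    also have "(\<Sum>k=Suc (Suc m)..Suc m'. e k) \<le> \<tau> m"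
    proof -
      have "(\<Sum>k=Suc (Suc m)..Suc m'. e k) = (\<Sum>k<m' - m. e (Suc (k + Suc m)))"
        using that by (intro sum.reindex_bij_witness[of _ "\<lambda>k. Suc (k + Suc m)" "\<lambda>k. k - Suc (Suc m)"]) (auto intro!: arg_cong[where f=e])
      also have "\<dots> \<le> \<tau> m" unfolding \<tau>_def by (rule sum_le_suminf[OF summ_t]) (auto simp: e0)
      finally show ?thesis .
    qed
    finally show ?thesis using B by (simp add: mult_left_mono)
  qed
  \<comment> \<open>The limit \<open>f\<close> need not be Lipschitz. For fixed \<open>n\<close> it
    is replaced by \<open>F m'\<close> at cost \<open>n * d m'\<close>, which disappears as
    \<open>m'\<close> grows, while the bound from \<open>FF\<close> is free of
    \<open>m'\<close>.\<close>
  have fF: "(\<integral>x. \<bar>bsum f n x - bsum (F m) n x\<bar> \<partial>M) \<le> sqrt (real n) * (B * \<tau> m)" for m n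
  proof -
    define d where "d m' = (\<integral>x. \<bar>f x - F m' x\<bar> \<partial>M)" for m'
    have d0: "d \<longlonglongrightarrow> 0" unfolding d_def F_def by (rule LIMSEQ_Suc[OF conv])
    have "(\<integral>x. \<bar>bsum f n x - bsum (F m) n x\<bar> \<partial>M) \<le> real n * d m' + sqrt (real n) * (B * \<tau> m)" if "m' \<ge> m" for m'
    proof -
      have "(\<integral>x. \<bar>bsum f n x - bsum (F m) n x\<bar> \<partial>M) \<le>
          (\<integral>x. \<bar>bsum f n x - bsum (F m') n x\<bar> + \<bar>bsum (F m') n x - bsum (F m) n x\<bar> \<partial>M)"
        by (intro integral_mono Bochner_Integration.integrable_add integrable_abs Bochner_Integration.integrable_diff
            bsum_integrable F_int f) auto
      also have "\<dots> = (\<integral>x. \<bar>bsum f n x - bsum (F m') n x\<bar> \<partial>M) + (\<integral>x. \<bar>bsum (F m') n x - bsum (F m) n x\<bar> \<partial>M)"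
        by (intro Bochner_Integration.integral_add integrable_abs Bochner_Integration.integrable_diff bsum_integrable F_int f)
      also have "(\<integral>x. \<bar>bsum f n x - bsum (F m') n x\<bar> \<partial>M) \<le> real n * d m'"
        unfolding bsum_diff d_def by (intro bsum_L1 Bochner_Integration.integrable_diff F_int f)
      also note FF[OF that]
      finally show ?thesis by simp
    qed
    moreover have "(\<lambda>m'. real n * d m' + sqrt (real n) * (B * \<tau> m)) \<longlonglongrightarrow> real n * 0 + sqrt (real n) * (B * \<tau> m)"
      by (intro tendsto_intros d0)
    ultimately show ?thesis by (intro LIMSEQ_le_const[where X="\<lambda>m'. real n * d m' + sqrt (real n) * (B * \<tau> m)"]) auto
  qed
  define \<epsilon> where "\<epsilon> m = B * \<tau> m" for m
  have \<epsilon>0: "\<epsilon> \<longlonglongrightarrow> 0" unfolding \<epsilon>_def[abs_def] using tendsto_mult[OF tendsto_const \<tau>0, of B] by simp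
  have \<epsilon>nn: "0 \<le> \<epsilon> m" for m unfolding \<epsilon>_def \<tau>_def using B by (intro mult_nonneg_nonneg suminf_nonneg summ_t e0)
  have close: "cmod (\<Phi> f s n - \<Phi> (F m) s n) \<le> \<bar>s\<bar> * \<epsilon> m" for s n m
  proof (cases "n = 0")
    case True then show ?thesis using \<epsilon>nn by (simp add: \<Phi>_def bsum_def)
  next
    case False
    have "cmod (\<Phi> f s n - \<Phi> (F m) s n) \<le> \<bar>s / sqrt (real n)\<bar> * (\<integral>x. \<bar>bsum f n x - bsum (F m) n x\<bar> \<partial>M)"
      unfolding \<Phi>_def
      by (rule cmod_expectation_iexp_diff)
         (auto intro!: Bochner_Integration.integrable_diff bsum_integrable F_int f)
    also have "\<dots> \<le> \<bar>s / sqrt (real n)\<bar> * (sqrt (real n) * \<epsilon> m)"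
      unfolding \<epsilon>_def by (intro mult_left_mono fF) auto
    also have "\<dots> = \<bar>s\<bar> * \<epsilon> m" using False by (simp add: abs_divide)
    finally show ?thesis .
  qed
  define E where "E s m = exp (- (s\<^sup>2 * v m / 2))" for s m
  have Ec: "exp (- complex_of_real (s\<^sup>2 * v m / 2)) = complex_of_real (E s m)" for s m
    unfolding E_def by (simp only: of_real_minus[symmetric] exp_of_real)
  \<comment> \<open>Both partial sums are close to \<open>f\<close> at the same \<open>n\<close>,
    uniformly in \<open>n\<close>; the limit in \<open>n\<close> passes this on to their Gaussian
    limits.\<close>
  have E_diff: "\<bar>E s m - E s m'\<bar> \<le> \<bar>s\<bar> * \<epsilon> m + \<bar>s\<bar> * \<epsilon> m'" for s m m'
  proof -
    have "(\<lambda>n. cmod (\<Phi> (F m) s n - \<Phi> (F m') s n)) \<longlonglongrightarrow> cmod (complex_of_real (E s m) - complex_of_real (E s m'))"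
      unfolding Ec[symmetric] by (intro tendsto_intros clt)
    moreover have "cmod (\<Phi> (F m) s n - \<Phi> (F m') s n) \<le> \<bar>s\<bar> * \<epsilon> m + \<bar>s\<bar> * \<epsilon> m'" for n
      using norm_triangle_ineq4[of "\<Phi> f s n - \<Phi> (F m') s n" "\<Phi> f s n - \<Phi> (F m) s n"] close[of s n m] close[of s n m']
      by simp
    ultimately have "cmod (complex_of_real (E s m) - complex_of_real (E s m')) \<le> \<bar>s\<bar> * \<epsilon> m + \<bar>s\<bar> * \<epsilon> m'"
      by (intro LIMSEQ_le_const2) auto
    then show ?thesis by (metis norm_of_real of_real_diff)
  qed
  \<comment> \<open>A point so small that \<open>E s0 0 - s0 * \<epsilon> 0\<close> is positive.
    This keeps the limit \<open>L\<close> of the Gaussian values away from 0, so the variances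
    cannot escape to infinity.\<close>
  define s0 where "s0 = 1 / (1 + v 0 + \<epsilon> 0)"
  have v0: "0 < v 0" using v_ge[of 0] c by simp
  have s0: "0 < s0" "s0 \<le> 1" using v0 \<epsilon>nn[of 0] by (auto simp: s0_def)
  have "Cauchy (E s0)"
  proof (rule metric_CauchyI)
    fix \<delta>' :: real assume d: "0 < \<delta>'"
    have "\<forall>\<^sub>F m in sequentially. \<epsilon> m < \<delta>' / 2" by (rule order_tendstoD[OF \<epsilon>0]) (use d in simp)
    then obtain N where N: "\<And>m. m \<ge> N \<Longrightarrow> \<epsilon> m < \<delta>' / 2" by (auto simp: eventually_sequentially)
    have "dist (E s0 m) (E s0 m') < \<delta>'" if "m \<ge> N" "m' \<ge> N" for m m'
    proof -
      have "s0 * \<epsilon> m \<le> \<epsilon> m" "s0 * \<epsilon> m' \<le> \<epsilon> m'" using s0 \<epsilon>nn by (auto intro: mult_left_le_one_le)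
      then show ?thesis using E_diff[of s0 m m'] N[OF that(1)] N[OF that(2)] s0 by (simp add: dist_real_def)
    qed
    then show "\<exists>M. \<forall>m\<ge>M. \<forall>n\<ge>M. dist (E s0 m) (E s0 n) < \<delta>'" by blast
  qed
  then obtain L where L: "E s0 \<longlonglongrightarrow> L" using Cauchy_convergent convergent_def by blast
  have "E s0 0 - s0 * \<epsilon> 0 \<le> L"
  proof (rule LIMSEQ_le_const)
    show "(\<lambda>m. E s0 m + s0 * \<epsilon> m) \<longlonglongrightarrow> L" using tendsto_add[OF L tendsto_mult[OF tendsto_const \<epsilon>0, of s0]] by simp
    show "\<exists>N. \<forall>m\<ge>N. E s0 0 - s0 * \<epsilon> 0 \<le> E s0 m + s0 * \<epsilon> m"
    proof (intro exI allI impI)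
      fix m :: nat
      show "E s0 0 - s0 * \<epsilon> 0 \<le> E s0 m + s0 * \<epsilon> m" using E_diff[of s0 0 m] s0 by (simp add: abs_le_iff)
    qed
  qed
  moreover have "0 < E s0 0 - s0 * \<epsilon> 0"
  proof -
    have "s0\<^sup>2 * v 0 \<le> s0 * v 0" using s0 v0 by (simp add: power2_eq_square mult_left_le_one_le)
    then have "s0\<^sup>2 * v 0 / 2 + s0 * \<epsilon> 0 < s0 * (1 + v 0 + \<epsilon> 0)"
      unfolding distrib_left using s0(1) mult_pos_pos[OF s0(1) v0] by linarith
    also have "\<dots> = 1" using v0 \<epsilon>nn[of 0] by (simp add: s0_def)
    finally show ?thesis using exp_ge_add_one_self[of "- (s0\<^sup>2 * v 0 / 2)"] by (simp add: E_def)
  qed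
  ultimately have Lpos: "0 < L" by simp
  \<comment> \<open>The logarithm recovers \<open>v m\<close> from the single value
    \<open>E s0 m\<close>, so convergence at \<open>s0\<close> gives convergence of the
    variances.\<close>
  define w where "w = - 2 * ln L / s0\<^sup>2"
  have "(\<lambda>m. - 2 * ln (E s0 m) / s0\<^sup>2) \<longlonglongrightarrow> w"
    unfolding w_def using Lpos s0 by (intro tendsto_intros L) auto
  moreover have "- 2 * ln (E s0 m) / s0\<^sup>2 = v m" for m using s0 by (simp add: E_def)
  ultimately have vw: "v \<longlonglongrightarrow> w" by simp
  have "c \<le> w" by (rule LIMSEQ_le_const[OF vw]) (use v_ge in auto)
  then have w: "0 < w" using c by simp
  have "\<Phi> f s \<longlonglongrightarrow> exp (- complex_of_real (s\<^sup>2 * w / 2))" for s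
  proof (rule uniform_approx_tendsto)
    show "norm (\<Phi> f s n - \<Phi> (F m) s n) \<le> \<bar>s\<bar> * \<epsilon> m" for m n by (rule close)
    show "(\<lambda>m. \<bar>s\<bar> * \<epsilon> m) \<longlonglongrightarrow> 0" using tendsto_mult[OF tendsto_const \<epsilon>0, of "\<bar>s\<bar>"] by simp
    show "\<Phi> (F m) s \<longlonglongrightarrow> exp (- complex_of_real (s\<^sup>2 * v m / 2))" for m by (rule clt)
    show "(\<lambda>m. exp (- complex_of_real (s\<^sup>2 * v m / 2))) \<longlonglongrightarrow> exp (- complex_of_real (s\<^sup>2 * w / 2))"
      by (intro tendsto_intros vw) simp
  qed
  then show ?thesis using w by (auto simp: \<Phi>_def[abs_def])
qed

end

text \<open>A single term is at most the tail it begins, so its root is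
  \<open>O(n powr ((- 3 - \<eta>) / 2))\<close>, with an exponent below -1.\<close>

lemma summable_sqrt_of_tail_bound:
  fixes \<gamma> :: "nat \<Rightarrow> real"
  assumes \<eta>: "\<eta> > 0" and summ: "summable (\<lambda>k. \<bar>\<gamma> k\<bar>)"
    and tail: "\<And>n. n \<ge> 1 \<Longrightarrow> (\<Sum>k. \<bar>\<gamma> (k + n + 1)\<bar>) \<le> K * real n powr (- 3 - \<eta>)"
  shows "summable (\<lambda>k. sqrt \<bar>\<gamma> k\<bar>)"
proof -
  have le: "\<bar>\<gamma> (n + 1)\<bar> \<le> K * real n powr (- 3 - \<eta>)" if "n \<ge> 1" for n
  proof -
    have "summable (\<lambda>k. \<bar>\<gamma> (k + n + 1)\<bar>)" using summable_ignore_initial_segment[OF summ, of "n + 1"] by (simp add: add.assoc)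
    then have "(\<Sum>k\<in>{0}. \<bar>\<gamma> (k + n + 1)\<bar>) \<le> (\<Sum>k. \<bar>\<gamma> (k + n + 1)\<bar>)" by (intro sum_le_suminf) auto
    then show ?thesis using tail[OF that] by simp
  qed
  have "summable (\<lambda>n. sqrt \<bar>\<gamma> (n + 1)\<bar>)"
  proof (rule summable_comparison_test_ev)
    show "\<forall>\<^sub>F n in sequentially. norm (sqrt \<bar>\<gamma> (n + 1)\<bar>) \<le> sqrt K * real n powr ((- 3 - \<eta>) / 2)"
      using eventually_ge_at_top[of 1]
    proof eventually_elim
      case (elim n)
      have "sqrt \<bar>\<gamma> (n + 1)\<bar> \<le> sqrt (K * real n powr (- 3 - \<eta>))" by (intro real_sqrt_le_mono le elim)
      also have "\<dots> = sqrt K * sqrt (real n powr (- 3 - \<eta>))" by (rule real_sqrt_mult)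
      also have "sqrt (real n powr (- 3 - \<eta>)) = real n powr ((- 3 - \<eta>) / 2)"
        by (simp add: powr_half_sqrt[symmetric] powr_powr)
      finally show ?case by simp
    qed
    show "summable (\<lambda>n. sqrt K * real n powr ((- 3 - \<eta>) / 2))"
      using \<eta> by (intro summable_mult) (simp add: summable_real_powr_iff)
  qed
  then show ?thesis using summable_iff_shift[of "\<lambda>k. sqrt \<bar>\<gamma> k\<bar>" 1] by simp
qed

theorem corollary4p2:
  fixes M :: "'a measure" and T :: "'a \<Rightarrow> 'a" and \<alpha> \<beta> :: "'a set set" and X :: "'a set"
    and r K \<eta> :: real and f :: "'a \<Rightarrow> real" and g :: "nat \<Rightarrow> 'a \<Rightarrow> real" and \<gamma> :: "nat \<Rightarrow> real"
  assumes "gibbs_markov M T \<alpha> r X"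
    and "measure_preserving M T"
    and "topologically_mixing T \<alpha> X"
    and "partition_mod M X \<beta>"
    and "sigma_mod X \<beta> = sigma_mod X {T ` (a \<inter> X) |a. a \<in> \<alpha>}"
    and "\<And>n. n \<ge> 1 \<Longrightarrow> (\<lambda>x. complex_of_real (g n x)) \<in> L_space M T \<alpha> r \<beta>"
    and "\<And>n. n \<ge> 1 \<Longrightarrow> (\<integral>x. g n x \<partial>M) = 0"
    and "bdd_above ((\<lambda>n. norm2 M (g n)) ` {1..})"
    and "(SUP n\<in>{1..}. ennreal \<bar>\<gamma> n\<bar> * L_norm M T \<alpha> r \<beta> (\<lambda>x. complex_of_real (g n x))) < \<infinity>"
    and "K > 0" and "\<eta> > 0"
    and "summable (\<lambda>k. \<bar>\<gamma> k\<bar>)"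
    and "\<And>n. n \<ge> 1 \<Longrightarrow> (\<Sum>k. \<bar>\<gamma> (k + n + 1)\<bar>) \<le> K * real n powr (- 3 - \<eta>)"
    and "f \<in> borel_measurable M" and "integrable M (\<lambda>x. (f x)\<^sup>2)"
    and "(\<lambda>n. norm2 M (\<lambda>x. f x - (\<Sum>k=1..n. \<gamma> k * g k x))) \<longlonglongrightarrow> 0"
    and "\<exists>c>0. \<forall>n\<ge>1. asymptotic_variance M T (\<lambda>x. \<Sum>k=1..n. \<gamma> k * g k x) \<ge> c"
  shows "\<exists>\<sigma> :: nat \<Rightarrow> real. (\<forall>n. \<sigma> n > 0) \<and>
    weak_conv_m
      (\<lambda>n. distr M borel (\<lambda>x. 1 / (sqrt (real n) * \<sigma> n) * (\<Sum>j<n. f ((T ^^ j) x))))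
      std_normal_distribution"
proof -
  obtain \<delta> D where ms: "markov_system M T X (atom \<alpha> X) r \<delta> D"
    using gibbs_markov_atoms[OF assms(1-3)] by blast
  interpret markov_system M T X "atom \<alpha> X" r \<delta> D by (rule ms)
  have part: "partition_mod M X \<alpha>" and images: "\<And>a. a \<in> \<alpha> \<Longrightarrow> T ` (a \<inter> X) \<in> sigma_mod X \<alpha>"
    using assms(1) unfolding gibbs_markov_def by blast+
  \<comment> \<open>Images of atoms belong to the sigma-algebra of \<open>\<alpha>\<close>, and
    \<open>\<beta>\<close> generates the same sigma-algebra as these images.\<close>
  have \<beta>\<alpha>: "b \<inter> X \<in> sigma_mod X \<alpha>" if "b \<in> \<beta>" for b
  proof -
    have sub: "sigma_mod X \<alpha> \<subseteq> Pow X" 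
      using sigma_sets_into_sp[of "(\<lambda>A. A \<inter> X) ` \<alpha>" X] by (auto simp: sigma_mod_def)
    have "(\<lambda>A. A \<inter> X) ` {T ` (a \<inter> X) |a. a \<in> \<alpha>} \<subseteq> sigma_sets X ((\<lambda>A. A \<inter> X) ` \<alpha>)"
    proof clarify
      fix a assume "a \<in> \<alpha>"
      then have "T ` (a \<inter> X) \<in> sigma_mod X \<alpha>" by (rule images)
      moreover from this have "T ` (a \<inter> X) \<inter> X = T ` (a \<inter> X)" using sub by auto
      ultimately show "T ` (a \<inter> X) \<inter> X \<in> sigma_sets X ((\<lambda>A. A \<inter> X) ` \<alpha>)" by (simp add: sigma_mod_def)
    qed
    then have "sigma_mod X {T ` (a \<inter> X) |a. a \<in> \<alpha>} \<subseteq> sigma_mod X \<alpha>"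
      unfolding sigma_mod_def by (rule sigma_sets_mono)
    moreover have "b \<inter> X \<in> sigma_mod X \<beta>" using that unfolding sigma_mod_def by blast
    ultimately show ?thesis using assms(5) by auto
  qed
  let ?L = "\<lambda>n. L_norm M T \<alpha> r \<beta> (\<lambda>x. complex_of_real (g n x))"
  have gm [measurable]: "g n \<in> borel_measurable M" if "n \<ge> 1" for n
  proof -
    have "(\<lambda>x. complex_of_real (g n x)) \<in> borel_measurable M"
      using assms(6)[OF that] by (simp add: L_space_def)
    from measurable_compose[OF this borel_measurable_continuous_onI[OF continuous_on_Re[OF continuous_on_id]]]
    show ?thesis by simp
  qed
  have g_lip: "lip H (g n)" if "n \<ge> 1" "?L n < ennreal H" for n H
    by (rule L_norm_lip[OF ms part assms(4) \<beta>\<alpha> gm[OF that(1)] that(2)])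
  have g_lip': "\<exists>H. lip H (g n)" if n: "n \<ge> 1" for n
  proof -
    have "?L n < \<infinity>" using assms(6)[OF n] by (simp add: L_space_def)
    then obtain u where "?L n = ennreal u" "0 \<le> u" by (cases "?L n") auto
    then have "?L n < ennreal (u + 1)" by (simp add: ennreal_less_iff del: ennreal_plus)
    then show ?thesis using g_lip[OF n] by blast
  qed
  define S where "S = (SUP n\<in>{1..}. ennreal \<bar>\<gamma> n\<bar> * ?L n)"
  obtain u where u: "S = ennreal u" "0 \<le> u" using assms(9) unfolding S_def[symmetric] by (cases S) auto
  \<comment> \<open>Adding 1 gives the strict inequality that \<open>L_norm_lip\<close> requires,
    for all \<open>k\<close> at once.\<close>
  define C0 where "C0 = u + 1"
  have C0: "0 < C0" using u by (simp add: C0_def)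
  define h where "h k x = \<gamma> k * g k x" for k x
  have h_lip: "lip C0 (h k)" if k: "k \<ge> 1" for k
  proof (cases "\<gamma> k = 0")
    case True
    then show ?thesis using lip_mono[OF lip_zero] C0 by (simp add: h_def[abs_def])
  next
    case False
    have "ennreal \<bar>\<gamma> k\<bar> * ?L k \<le> S" unfolding S_def by (rule SUP_upper) (use k in auto)
    also have "S < ennreal C0" unfolding u(1) C0_def using u(2) by (simp add: ennreal_less_iff del: ennreal_plus)
    also have "ennreal C0 = ennreal \<bar>\<gamma> k\<bar> * ennreal (C0 / \<bar>\<gamma> k\<bar>)"
      using False C0 by (simp add: ennreal_mult[symmetric])
    finally have "?L k < ennreal (C0 / \<bar>\<gamma> k\<bar>)"
      by (metis linorder_not_le mult_left_mono zero_le)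
    from lip_scale[OF g_lip[OF k this], of "\<gamma> k"] show ?thesis using False by (simp add: h_def[abs_def])
  qed
  have h0: "(\<integral>x. h k x \<partial>M) = 0" if "k \<ge> 1" for k
    using assms(7)[OF that] by (simp add: h_def)
  obtain G where G: "\<And>k. k \<ge> 1 \<Longrightarrow> norm2 M (g k) \<le> G" using assms(8) by (auto simp: bdd_above_def)
  have sq: "integrable M (\<lambda>x. (u x)\<^sup>2)" if "lip H u" for u H
    using lip_mult_integrable[OF that, of 0 0] by (simp add: power2_eq_square)
  \<comment> \<open>Only the \<open>L^1\<close> norm gains the factor
    \<open>\<bar>\<gamma> k\<bar>\<close>: the functions \<open>g k\<close> are bounded in
    \<open>norm2\<close>, but their Lipschitz norms may grow.\<close>
  have hL1: "sqrt (\<integral>x. \<bar>h k x\<bar> \<partial>M) \<le> sqrt G * sqrt \<bar>\<gamma> k\<bar>" if k: "k \<ge> 1" for k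
  proof -
    obtain H where H: "lip H (g k)" using g_lip'[OF k] by blast
    have "(\<integral>x. \<bar>g k x\<bar> \<partial>M) \<le> norm2 M (g k)"
      unfolding norm2_def by (rule abs_expectation_le_sqrt(2)[OF gm[OF k] sq[OF H]])
    then have "(\<integral>x. \<bar>g k x\<bar> \<partial>M) \<le> G" using G[OF k] by simp
    then have "\<bar>\<gamma> k\<bar> * (\<integral>x. \<bar>g k x\<bar> \<partial>M) \<le> \<bar>\<gamma> k\<bar> * G" by (rule mult_left_mono) simp
    then have "(\<integral>x. \<bar>h k x\<bar> \<partial>M) \<le> G * \<bar>\<gamma> k\<bar>" by (simp add: h_def abs_mult mult.commute)
    then show ?thesis unfolding real_sqrt_mult[symmetric] by (rule real_sqrt_le_mono)
  qed
  have summ: "summable (\<lambda>k. sqrt (\<integral>x. \<bar>h (Suc k) x\<bar> \<partial>M))"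
  proof (rule summable_comparison_test')
    have "summable (\<lambda>k. sqrt \<bar>\<gamma> (Suc k)\<bar>)"
      unfolding summable_Suc_iff[of "\<lambda>k. sqrt \<bar>\<gamma> k\<bar>"] by (rule summable_sqrt_of_tail_bound[OF assms(11-13)])
    then show "summable (\<lambda>k. sqrt G * sqrt \<bar>\<gamma> (Suc k)\<bar>)" by (rule summable_mult)
    show "norm (sqrt (\<integral>x. \<bar>h (Suc k) x\<bar> \<partial>M)) \<le> sqrt G * sqrt \<bar>\<gamma> (Suc k)\<bar>" for k
      using hL1[of "Suc k"] by simp
  qed
  have f: "integrable M f" by (rule abs_expectation_le_sqrt(1)[OF assms(14,15)])
  have F_lip: "lip (\<Sum>k=1..n. C0) (\<lambda>x. \<Sum>k=1..n. h k x)" for n by (rule lip_sum) (auto intro: h_lip)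
  have conv: "(\<lambda>n. \<integral>x. \<bar>f x - (\<Sum>k=1..n. h k x)\<bar> \<partial>M) \<longlonglongrightarrow> 0"
  proof (rule Lim_null_comparison)
    show "\<forall>\<^sub>F n in sequentially. norm (\<integral>x. \<bar>f x - (\<Sum>k=1..n. h k x)\<bar> \<partial>M) \<le> norm2 M (\<lambda>x. f x - (\<Sum>k=1..n. \<gamma> k * g k x))"
    proof (intro always_eventually allI)
      fix n
      let ?F = "\<lambda>x. \<Sum>k=1..n. h k x"
      have [measurable]: "?F \<in> borel_measurable M" by (rule lip_meas[OF F_lip])
      note assms(14) [measurable]
      have "integrable M (\<lambda>x. (f x - ?F x)\<^sup>2)"
      proof (rule Bochner_Integration.integrable_bound)
        show "integrable M (\<lambda>x. 2 * (f x)\<^sup>2 + 2 * (?F x)\<^sup>2)"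
          by (intro Bochner_Integration.integrable_add integrable_mult_right assms(15) sq[OF F_lip])
        have "(a - b)\<^sup>2 \<le> 2 * a\<^sup>2 + 2 * b\<^sup>2" for a b :: real
          using zero_le_power2[of "a + b"] by (simp add: power2_eq_square algebra_simps)
        then show "AE x in M. norm ((f x - ?F x)\<^sup>2) \<le> norm (2 * (f x)\<^sup>2 + 2 * (?F x)\<^sup>2)" by simp
      qed measurable
      then have "(\<integral>x. \<bar>f x - ?F x\<bar> \<partial>M) \<le> sqrt (\<integral>x. (f x - ?F x)\<^sup>2 \<partial>M)"
        by (intro abs_expectation_le_sqrt(2)) measurable
      then show "norm (\<integral>x. \<bar>f x - ?F x\<bar> \<partial>M) \<le> norm2 M (\<lambda>x. f x - (\<Sum>k=1..n. \<gamma> k * g k x))"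
        by (simp add: norm2_def h_def)
    qed
  qed (rule assms(16))
  obtain c where c: "0 < c" and avar: "\<And>n. n \<ge> 1 \<Longrightarrow> c \<le> asymptotic_variance M T (\<lambda>x. \<Sum>k=1..n. \<gamma> k * g k x)"
    using assms(17) by blast
  have var: "c \<le> v" if "n \<ge> 1" "(\<lambda>N. (\<integral>x. (bsum (\<lambda>x. \<Sum>k=1..n. h k x) N x)\<^sup>2 \<partial>M) / real N) \<longlonglongrightarrow> v" for n v
  proof -
    \<comment> \<open>The value of \<open>lim\<close> is determined by the assumed convergence to
      \<open>v\<close>.\<close>
    have "asymptotic_variance M T (\<lambda>x. \<Sum>k=1..n. \<gamma> k * g k x) = v"
      unfolding asymptotic_variance_def using that(2) by (intro limI) (simp add: bsum_def h_def)
    then show ?thesis using avar[OF that(1)] by simp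
  qed
  have "\<exists>w>0. \<forall>s. (\<lambda>n. \<integral>x. iexp (s / sqrt (real n) * bsum f n x) \<partial>M) \<longlonglongrightarrow> exp (- complex_of_real (s\<^sup>2 * w / 2))"
    by (rule clt_series[OF _ C0 _ summ f conv c]; (rule h_lip | rule h0 | rule var); assumption)
  then obtain w where w: "0 < w" and lim: "\<And>s. (\<lambda>n. \<integral>x. iexp (s / sqrt (real n) * bsum f n x) \<partial>M) \<longlonglongrightarrow>
      exp (- complex_of_real (s\<^sup>2 * w / 2))"
    by blast
  let ?X = "\<lambda>n x. 1 / (sqrt (real n) * sqrt w) * (\<Sum>j<n. f ((T ^^ j) x))"
  have Xm: "?X n \<in> borel_measurable M" for n
    using bsum_meas[OF assms(14), of n] by (simp add: bsum_def[abs_def])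
  have "weak_conv_m (\<lambda>n. distr M borel (?X n)) std_normal_distribution"
  proof (rule levy_continuity)
    show "real_distribution (distr M borel (?X n))" for n by (rule real_distribution_distr[OF Xm])
    show "real_distribution std_normal_distribution" by (rule real_dist_normal_dist)
    fix t :: real
    \<comment> \<open>Normalization by \<open>sqrt w\<close> amounts to evaluating the limit at
      \<open>t / sqrt w\<close>, where the variance \<open>w\<close> cancels.\<close>
    have "char (distr M borel (?X n)) t = (\<integral>x. iexp ((t / sqrt w) / sqrt (real n) * bsum f n x) \<partial>M)" for n
      unfolding char_def using Xm[of n] by (subst integral_distr) (auto simp: bsum_def divide_simps mult_ac)
    moreover have "exp (- complex_of_real ((t / sqrt w)\<^sup>2 * w / 2)) = char std_normal_distribution t"
      unfolding char_std_normal_distribution of_real_minus[symmetric] exp_of_real using w by (simp add: power_divide)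
    ultimately show "(\<lambda>n. char (distr M borel (?X n)) t) \<longlonglongrightarrow> char std_normal_distribution t"
      using lim[of "t / sqrt w"] by simp
  qed
  then show ?thesis using w by (intro exI[of _ "\<lambda>_. sqrt w"]) auto
qed

end
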